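(* Let $M$ be a closed orientable 3-manifold and let $\Sigma\subset M$ be an embedded closed nonorientable surface. Suppose the map $H_1(\Sigma;\mathbb F_2)\to H_1(M;\mathbb F_2)$ induced by inclusion is not surjective (this holds in particular if $\dim_{\mathbb F_2}H_1(M;\mathbb F_2)>\dim_{\mathbb F_2}H_1(\Sigma;\mathbb F_2)$). Then there is a connected unramified double covering $N\to M$ with first Betti number $b_1(N)>0$. *)

theory Defs
  imports "HOL-Analysis.Analysis" "HOL-Homology.Homology"
begin

definition manifold :: "nat \<Rightarrow> 'a topology \<Rightarrow> bool" where
  "manifold n X \<longleftrightarrow> Hausdorff_space X \<and> second_countable X \<and>
     (\<forall>x\<in>topspace X. \<exists>U. openin X U \<and> x \<in> U \<and>
        (\<exists>V. openin (Euclidean_space n) V \<and>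
             subtopology X U homeomorphic_space subtopology (Euclidean_space n) V))"

definition closed_manifold :: "nat \<Rightarrow> 'a topology \<Rightarrow> bool" where
  "closed_manifold n X \<longleftrightarrow> manifold n X \<and> compact_space X \<and> connected_space X \<and> topspace X \<noteq> {}"

definition group_generator :: "('g, 'b) monoid_scheme \<Rightarrow> 'g \<Rightarrow> bool" where
  "group_generator G a \<longleftrightarrow> a \<in> carrier G \<and> (\<forall>b\<in>carrier G. \<exists>k::int. b = a [^]\<^bsub>G\<^esub> k)"

(* Z-orientability (Hatcher, Sec. 3.3): a choice of generators mu_x of the local
   homology groups H_n(X, X - {x}) that is locally consistent. *)
definition orientable :: "nat \<Rightarrow> 'a topology \<Rightarrow> bool" where
  "orientable n X \<longleftrightarrow>
     (\<exists>\<mu>. (\<forall>x\<in>topspace X.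
             group_generator (relative_homology_group (int n) X (topspace X - {x})) (\<mu> x)) \<and>
          (\<forall>x\<in>topspace X. \<exists>U \<mu>U. openin X U \<and> x \<in> U \<and>
             \<mu>U \<in> carrier (relative_homology_group (int n) X (topspace X - U)) \<and>
             (\<forall>y\<in>U. hom_induced (int n) X (topspace X - U) X (topspace X - {y}) id \<mu>U = \<mu> y)))"

definition locally_flat_surface :: "'a topology \<Rightarrow> 'a set \<Rightarrow> bool" where
  "locally_flat_surface M S \<longleftrightarrow> S \<subseteq> topspace M \<and>
     (\<forall>x\<in>S. \<exists>U h. openin M U \<and> x \<in> U \<and>
        homeomorphic_map (subtopology M U) (Euclidean_space 3) h \<and>
        h ` (U \<inter> S) = {v \<in> topspace (Euclidean_space 3). v 2 = 0})"

(* Mod-2 singular homology in degree 1, written via integral chains: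
   C_*(X;F_2) = C_*(X;Z)/2C_*(X;Z).  A mod-2 1-cycle is an integral 1-chain whose
   boundary lies in 2 C_0; mod-2 1-boundaries are boundaries of 2-chains plus 2 C_1. *)
definition mod2_cycle1 :: "'a topology \<Rightarrow> 'a chain \<Rightarrow> bool" where
  "mod2_cycle1 X c \<longleftrightarrow> singular_chain 1 X c \<and>
     (\<exists>e. singular_chain 0 X e \<and> chain_boundary 1 c = e + e)"

definition mod2_homologous1 :: "'a topology \<Rightarrow> 'a chain \<Rightarrow> 'a chain \<Rightarrow> bool" where
  "mod2_homologous1 X c d \<longleftrightarrow>
     (\<exists>b e. singular_chain 2 X b \<and> singular_chain 1 X e \<and> c - d = chain_boundary 2 b + e + e)"

definition H1_mod2_inclusion_surjective :: "'a topology \<Rightarrow> 'a set \<Rightarrow> bool" where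
  "H1_mod2_inclusion_surjective X S \<longleftrightarrow>
     (\<forall>c. mod2_cycle1 X c \<longrightarrow>
        (\<exists>d. mod2_cycle1 (subtopology X S) d \<and> mod2_homologous1 X c d))"

definition covering_map :: "'b topology \<Rightarrow> ('b \<Rightarrow> 'a) \<Rightarrow> 'a topology \<Rightarrow> bool" where
  "covering_map N p M \<longleftrightarrow>
     continuous_map N M p \<and> p ` topspace N = topspace M \<and>
     (\<forall>x\<in>topspace M. \<exists>T. x \<in> T \<and> openin M T \<and>
        (\<exists>v. \<Union>v = topspace N \<inter> p -` T \<and> (\<forall>u\<in>v. openin N u) \<and> pairwise disjnt v \<and>
             (\<forall>u\<in>v. homeomorphic_map (subtopology N u) (subtopology M T) p)))"

definition double_covering :: "'b topology \<Rightarrow> ('b \<Rightarrow> 'a) \<Rightarrow> 'a topology \<Rightarrow> bool" where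
  "double_covering N p M \<longleftrightarrow> covering_map N p M \<and>
     (\<forall>x\<in>topspace M. card {y \<in> topspace N. p y = x} = 2)"

definition free_rank :: "('g, 'b) monoid_scheme \<Rightarrow> enat" where
  "free_rank G = Sup {enat (card A) | A. A \<subseteq> carrier G \<and> finite A \<and>
      (\<forall>k::'g \<Rightarrow> int. finprod G (\<lambda>a. a [^]\<^bsub>G\<^esub> k a) A = \<one>\<^bsub>G\<^esub> \<longrightarrow> (\<forall>a\<in>A. k a = 0))}"

definition betti :: "nat \<Rightarrow> 'a topology \<Rightarrow> enat" where
  "betti k X = free_rank (homology_group (int k) X)"

end

theory Submission
  imports Defs
begin

text \<open>Let \<open>w\<close> be the mod-2 class dual to \<open>S\<close> and let \<open>\<alpha> \<noteq> 0\<close> be a character of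
  \<open>H\<^sub>1(M; \<int>/2)\<close> vanishing on the image of \<open>H\<^sub>1(S; \<int>/2)\<close>. The cover is the one of the class \<open>\<alpha> + w\<close>.
  Along \<open>S\<close> its sheets correspond to the two local sides of \<open>S\<close>, so the preimage of \<open>S\<close> is
  two-sided and defines an integral 1-cocycle, represented by local primitives with values
  \<open>\<plusminus>1\<close> off the preimage and \<open>0\<close> on it. If \<open>b\<^sub>1(N) = 0\<close>, the cocycle has a global
  primitive; let \<open>\<Phi>\<close> be its antisymmetrization under the deck transformation. Then \<open>\<bar>\<Phi>\<bar>\<close> takes a constant
  value \<open>D\<close> on \<open>S\<close>. If \<open>D < 1\<close>, then off \<open>S\<close> the sign of \<open>\<Phi>\<close> trivializes \<open>\<alpha>\<close>; if
  \<open>D \<ge> 1\<close>, then \<open>\<bar>\<Phi>\<bar> - D\<close> distinguishes the sides of \<open>S\<close>. Both are impossible, since a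
  two-sided surface in an orientable 3-manifold is orientable. One-sidedness also makes the cover
  connected: a section of it would choose a side of \<open>S\<close>.\<close>

section \<open>Local homology of a surface in a 3-manifold\<close>

text \<open>No duality, intersection theory or tubular neighbourhood enters. The class
  \<open>w\<close> appears only as the sign by which the side functions of two charts differ along
  the surface, and cocycles may have discontinuous local primitives, so a merely locally flat
  surface causes no trouble. The deck transformation negates the cocycle, which is why
  antisymmetrizing a primitive yields a primitive. The threshold 1 for \<open>D\<close> is the jump
  of the side function at the surface. Up to a sign, \<open>\<Phi>\<close> is a local constant d on
  \<open>S\<close> and d + 1, d - 1 on its two sides. If the absolute value of d is below 1, the
  signs of d + 1 and d - 1 are those of the sides; otherwise the two sides are told apart by whether
  the absolute value grows or shrinks. The obstacle is the last step. Orientability is phrased by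
  local homology, so a choice of sides must be turned into local generators of the surface,
  independently of charts and consistently near each point. The first section builds this passage
  from degree 3 of the ambient manifold to degree 2 of the surface.\<close>

lemma starlike_imp_contractible_fun:
  fixes S :: "(nat \<Rightarrow> real) set"
  assumes c: "c \<in> S"
    and star: "\<And>x t. \<lbrakk>x \<in> S; 0 \<le> t; t \<le> 1\<rbrakk> \<Longrightarrow> (\<lambda>i. (1 - t) * x i + t * c i) \<in> S"
  shows "contractible S"
proof -
  have "homotopic_with_canon (\<lambda>x. True) S S id (\<lambda>x. c)"
    unfolding homotopic_with_def
  proof (intro exI conjI)
    let ?h = "\<lambda>p::real \<times> (nat \<Rightarrow> real). \<lambda>i. (1 - fst p) * snd p i + fst p * c i"
    have "continuous_on ({0..1} \<times> S) ?h"
      by (intro continuous_on_coordinatewise_then_product continuous_intros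
          continuous_on_product_then_coordinatewise[OF continuous_on_snd[OF continuous_on_id]])
    then show "continuous_map (prod_topology (top_of_set {0..1}) (top_of_set S)) (top_of_set S) ?h"
      using star by auto
  qed auto
  then show ?thesis unfolding contractible_def by blast
qed

text \<open>\<open>P\<close> and \<open>Q\<close> are the closed sides of the surface \<open>P \<inter> Q\<close>. The class \<open>b\<close> is the image of
  \<open>a\<close> under \<open>H\<^sub>3(X, X - K) \<rightarrow> H\<^sub>2(X - K, Q - K) \<cong> H\<^sub>2(P - K, P \<inter> Q - K) \<rightarrow> H\<^sub>1(P \<inter> Q - K) \<cong> H\<^sub>2(P \<inter> Q, P \<inter> Q - K)\<close>.
  As a relation this is natural in \<open>X\<close> without any isomorphism being inverted.\<close>
definition side_rel ::
  "'a topology \<Rightarrow> 'a set \<Rightarrow> 'a set \<Rightarrow> 'a set \<Rightarrow> 'a chain set \<Rightarrow> 'a chain set \<Rightarrow> bool" where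
  "side_rel X P Q K a b \<longleftrightarrow>
     a \<in> carrier (relative_homology_group 3 X (topspace X - K)) \<and>
     b \<in> carrier (relative_homology_group 2 (subtopology X (P \<inter> Q)) (P \<inter> Q - K)) \<and>
     (\<exists>c \<in> carrier (relative_homology_group 2 (subtopology X (P - K)) (P \<inter> Q - K)).
        hom_induced 2 (subtopology X (P - K)) (P \<inter> Q - K) (subtopology X (topspace X - K)) (Q - K) id c
          = hom_relboundary 3 X (topspace X - K) (Q - K) a \<and>
        hom_boundary 2 (subtopology X (P - K)) (P \<inter> Q - K) c
          = hom_boundary 2 (subtopology X (P \<inter> Q)) (P \<inter> Q - K) b)"

text \<open>The intermediate class \<open>c\<close> is pushed forward along \<open>f\<close>; the
  two squares commute by naturality of the connecting maps of the triple and of the pair. Asking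
  \<open>f\<close> only to respect the sides and the complements of \<open>K\<close> lets one lemma
  serve inclusions of boxes, changes of chart and the shrinking of \<open>K\<close>.\<close>

lemma side_rel_natural:
  assumes f: "continuous_map X Y f" and P: "P \<subseteq> topspace X" "f ` P \<subseteq> P'" "P' \<subseteq> topspace Y"
    and Q: "Q \<subseteq> topspace X" "f ` Q \<subseteq> Q'" "Q' \<subseteq> topspace Y"
    and K: "f ` (topspace X - K) \<subseteq> topspace Y - K'"
    and rel: "side_rel X P Q K a b"
  shows "side_rel Y P' Q' K' (hom_induced 3 X (topspace X - K) Y (topspace Y - K') f a)
      (hom_induced 2 (subtopology X (P \<inter> Q)) (P \<inter> Q - K) (subtopology Y (P' \<inter> Q')) (P' \<inter> Q' - K') f b)"
proof -
  obtain c where a: "a \<in> carrier (relative_homology_group 3 X (topspace X - K))"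
    and b: "b \<in> carrier (relative_homology_group 2 (subtopology X (P \<inter> Q)) (P \<inter> Q - K))"
    and c: "c \<in> carrier (relative_homology_group 2 (subtopology X (P - K)) (P \<inter> Q - K))"
    and c1: "hom_induced 2 (subtopology X (P - K)) (P \<inter> Q - K) (subtopology X (topspace X - K)) (Q - K) id c
          = hom_relboundary 3 X (topspace X - K) (Q - K) a"
    and c2: "hom_boundary 2 (subtopology X (P - K)) (P \<inter> Q - K) c
          = hom_boundary 2 (subtopology X (P \<inter> Q)) (P \<inter> Q - K) b"
    using rel unfolding side_rel_def by blast
  define c' where "c' = hom_induced 2 (subtopology X (P - K)) (P \<inter> Q - K) (subtopology Y (P' - K')) (P' \<inter> Q' - K') f c"
  have cm: "continuous_map (subtopology X S) (subtopology Y T) f" if "f ` (topspace X \<inter> S) \<subseteq> T" for S T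
    using f that by (auto simp: continuous_map_in_subtopology continuous_map_from_subtopology)
  have PK: "f \<in> P - K \<rightarrow> P' - K'" and QK: "f \<in> Q - K \<rightarrow> Q' - K'" and PQK: "f \<in> P \<inter> Q - K \<rightarrow> P' \<inter> Q' - K'"
    and TK: "f \<in> topspace X - K \<rightarrow> topspace Y - K'"
    using P Q K by (auto simp: image_subset_iff)
  have cm1: "continuous_map (subtopology X (P - K)) (subtopology Y (P' - K')) f"
    by (rule cm) (use PK in auto)
  have cm2: "continuous_map (subtopology X (topspace X - K)) (subtopology Y (topspace Y - K')) f"
    by (rule cm) (use K in auto)
  have cm3: "continuous_map (subtopology X (P \<inter> Q)) (subtopology Y (P' \<inter> Q')) f"
    by (rule cm) (use P Q in auto)
  have id1: "continuous_map (subtopology X (P - K)) (subtopology X (topspace X - K)) id"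
    using P by (auto simp: continuous_map_in_subtopology)
  have id2: "continuous_map (subtopology Y (P' - K')) (subtopology Y (topspace Y - K')) id"
    using P by (auto simp: continuous_map_in_subtopology)
  have e1: "subtopology (subtopology X (P - K)) (P \<inter> Q - K) = subtopology (subtopology X (P \<inter> Q)) (P \<inter> Q - K)"
    unfolding subtopology_subtopology by (intro arg_cong[where f="subtopology _"]) blast
  have e2: "subtopology (subtopology Y (P' - K')) (P' \<inter> Q' - K') = subtopology (subtopology Y (P' \<inter> Q')) (P' \<inter> Q' - K')"
    unfolding subtopology_subtopology by (intro arg_cong[where f="subtopology _"]) blast
  have "hom_induced 2 (subtopology Y (P' - K')) (P' \<inter> Q' - K') (subtopology Y (topspace Y - K')) (Q' - K') id c'
     = hom_induced 2 (subtopology X (P - K)) (P \<inter> Q - K) (subtopology Y (topspace Y - K')) (Q' - K') (id \<circ> f) c"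
    unfolding c'_def by (rule hom_induced_compose'[OF cm1 PQK id2]) auto
  also have "\<dots> = hom_induced 2 (subtopology X (P - K)) (P \<inter> Q - K) (subtopology Y (topspace Y - K')) (Q' - K') (f \<circ> id) c"
    by simp
  also have "\<dots> = hom_induced 2 (subtopology X (topspace X - K)) (Q - K) (subtopology Y (topspace Y - K')) (Q' - K') f
      (hom_induced 2 (subtopology X (P - K)) (P \<inter> Q - K) (subtopology X (topspace X - K)) (Q - K) id c)"
    by (rule hom_induced_compose'[OF id1 _ cm2 QK, symmetric]) auto
  also have "\<dots> = hom_relboundary 3 Y (topspace Y - K') (Q' - K') (hom_induced 3 X (topspace X - K) Y (topspace Y - K') f a)"
    unfolding c1 using fun_cong[OF naturality_hom_induced_relboundary[OF f TK QK, of 3], of a] by simp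
  finally have 1: "hom_induced 2 (subtopology Y (P' - K')) (P' \<inter> Q' - K') (subtopology Y (topspace Y - K')) (Q' - K') id c'
    = hom_relboundary 3 Y (topspace Y - K') (Q' - K') (hom_induced 3 X (topspace X - K) Y (topspace Y - K') f a)" .
  have "hom_boundary 2 (subtopology Y (P' - K')) (P' \<inter> Q' - K') c'
    = hom_induced 1 (subtopology (subtopology X (P - K)) (P \<inter> Q - K)) {} (subtopology (subtopology Y (P' - K')) (P' \<inter> Q' - K')) {} f
       (hom_boundary 2 (subtopology X (P - K)) (P \<inter> Q - K) c)"
    using fun_cong[OF naturality_hom_induced[OF cm1 PQK, of 2], of c] by (simp add: c'_def)
  also have "\<dots> = hom_boundary 2 (subtopology Y (P' \<inter> Q')) (P' \<inter> Q' - K')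
      (hom_induced 2 (subtopology X (P \<inter> Q)) (P \<inter> Q - K) (subtopology Y (P' \<inter> Q')) (P' \<inter> Q' - K') f b)"
    using fun_cong[OF naturality_hom_induced[OF cm3 PQK, of 2], of b] by (simp add: c2 e1 e2)
  finally have 2: "hom_boundary 2 (subtopology Y (P' - K')) (P' \<inter> Q' - K') c' = hom_boundary 2 (subtopology Y (P' \<inter> Q')) (P' \<inter> Q' - K')
      (hom_induced 2 (subtopology X (P \<inter> Q)) (P \<inter> Q - K) (subtopology Y (P' \<inter> Q')) (P' \<inter> Q' - K') f b)" .
  show ?thesis
    unfolding side_rel_def
  proof (intro conjI bexI[of _ c'])
    show "c' \<in> carrier (relative_homology_group 2 (subtopology Y (P' - K')) (P' \<inter> Q' - K'))"
      unfolding c'_def by (rule hom_induced_carrier)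
  qed (use 1 2 in \<open>auto intro: hom_induced_carrier\<close>)
qed

text \<open>Contractibility makes every connecting map in the chain an isomorphism by the long exact
  sequences, and the one inclusion is an isomorphism by \<open>e\<close>. The relation is then the
  graph of the composite. In degree 1 reduced and ordinary homology agree, so the boundary maps land
  in \<open>homology_group 1\<close>.\<close>

lemma side_rel_iso:
  assumes P: "P \<subseteq> topspace X" and Q: "Q \<subseteq> topspace X"
    and X: "contractible_space X" and QK: "contractible_space (subtopology X (Q - K))"
    and PK: "contractible_space (subtopology X (P - K))" and B: "contractible_space (subtopology X (P \<inter> Q))"
    and ne: "P \<inter> Q - K \<noteq> {}"
    and e: "hom_induced 2 (subtopology X (P - K)) (P \<inter> Q - K) (subtopology X (topspace X - K)) (Q - K) id
      \<in> iso (relative_homology_group 2 (subtopology X (P - K)) (P \<inter> Q - K))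
            (relative_homology_group 2 (subtopology X (topspace X - K)) (Q - K))"
  obtains \<phi> where "\<phi> \<in> iso (relative_homology_group 3 X (topspace X - K))
      (relative_homology_group 2 (subtopology X (P \<inter> Q)) (P \<inter> Q - K))"
    "\<And>a b. side_rel X P Q K a b \<longleftrightarrow> a \<in> carrier (relative_homology_group 3 X (topspace X - K)) \<and> b = \<phi> a"
proof -
  let ?e = "hom_induced 2 (subtopology X (P - K)) (P \<inter> Q - K) (subtopology X (topspace X - K)) (Q - K) id"
  let ?r = "hom_relboundary 3 X (topspace X - K) (Q - K)"
  let ?d2 = "hom_boundary 2 (subtopology X (P - K)) (P \<inter> Q - K)"
  let ?d3 = "hom_boundary 2 (subtopology X (P \<inter> Q)) (P \<inter> Q - K)"
  let ?A = "relative_homology_group 3 X (topspace X - K)"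
  let ?B = "relative_homology_group 2 (subtopology X (P \<inter> Q)) (P \<inter> Q - K)"
  let ?C = "relative_homology_group 2 (subtopology X (P - K)) (P \<inter> Q - K)"
  let ?D = "relative_homology_group 2 (subtopology X (topspace X - K)) (Q - K)"
  let ?E = "homology_group 1 (subtopology X (P \<inter> Q - K))"
  have e1: "subtopology (subtopology X (P - K)) (P \<inter> Q - K) = subtopology X (P \<inter> Q - K)"
    unfolding subtopology_subtopology by (intro arg_cong[where f="subtopology _"]) blast
  have e2: "subtopology (subtopology X (P \<inter> Q)) (P \<inter> Q - K) = subtopology X (P \<inter> Q - K)"
    unfolding subtopology_subtopology by (intro arg_cong[where f="subtopology _"]) blast
  have r: "?r \<in> iso ?A ?D"
  proof -
    have "Q - K \<subseteq> topspace X - K" "topspace X \<inter> (Q - K) \<noteq> {}" using Q ne by auto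
    from iso_hom_relboundary_contractible[OF X QK this, of 3] show ?thesis by simp
  qed
  have red: "reduced_homology_group (2 - 1) Z = homology_group 1 Z" for Z :: "'a topology"
    by (simp add: un_reduced_homology_group)
  have "topspace (subtopology X (P - K)) \<inter> (P \<inter> Q - K) \<noteq> {}" "topspace (subtopology X (P \<inter> Q)) \<inter> (P \<inter> Q - K) \<noteq> {}"
    using ne P by auto
  from iso_relative_homology_of_contractible[OF PK this(1), of 2] iso_relative_homology_of_contractible[OF B this(2), of 2]
  have d2: "?d2 \<in> iso ?C ?E" and d3: "?d3 \<in> iso ?B ?E"
    unfolding red e1 e2 .
  define \<phi> where "\<phi> = inv_into (carrier ?B) ?d3 \<circ> (?d2 \<circ> (inv_into (carrier ?C) ?e \<circ> ?r))"
  have ie: "inv_into (carrier ?C) ?e \<in> iso ?D ?C"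
    using group.iso_set_sym[OF group_relative_homology_group e] by blast
  have id3: "inv_into (carrier ?B) ?d3 \<in> iso ?E ?B"
    using group.iso_set_sym[OF group_relative_homology_group d3] by blast
  have phi: "\<phi> \<in> iso ?A ?B"
    unfolding \<phi>_def by (intro iso_set_trans[OF _ id3] iso_set_trans[OF _ d2] iso_set_trans[OF r ie])
  have be: "bij_betw ?e (carrier ?C) (carrier ?D)" and br: "bij_betw ?r (carrier ?A) (carrier ?D)"
    and b2: "bij_betw ?d2 (carrier ?C) (carrier ?E)" and b3: "bij_betw ?d3 (carrier ?B) (carrier ?E)"
    using e r d2 d3 by (auto simp: iso_def)
  have "side_rel X P Q K a b \<longleftrightarrow> a \<in> carrier ?A \<and> b = \<phi> a" for a b
  proof
    assume "side_rel X P Q K a b"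
    then obtain c where a: "a \<in> carrier ?A" and b: "b \<in> carrier ?B" and c: "c \<in> carrier ?C"
      and "?e c = ?r a" "?d2 c = ?d3 b" unfolding side_rel_def by blast
    then have "inv_into (carrier ?C) ?e (?r a) = c" "inv_into (carrier ?B) ?d3 (?d2 c) = b"
      using bij_betw_inv_into_left[OF be] bij_betw_inv_into_left[OF b3] by metis+
    with a show "a \<in> carrier ?A \<and> b = \<phi> a" by (simp add: \<phi>_def)
  next
    assume ab: "a \<in> carrier ?A \<and> b = \<phi> a"
    define c where "c = inv_into (carrier ?C) ?e (?r a)"
    have ra: "?r a \<in> carrier ?D" using ab bij_betw_apply[OF br] by blast
    have c: "c \<in> carrier ?C" "?e c = ?r a"
      unfolding c_def using bij_betw_apply[OF bij_betw_inv_into[OF be] ra] bij_betw_inv_into_right[OF be ra] .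
    have "?d2 c \<in> carrier ?E" using c bij_betw_apply[OF b2] by blast
    moreover have "b = inv_into (carrier ?B) ?d3 (?d2 c)" using ab by (simp add: \<phi>_def c_def)
    ultimately have "b \<in> carrier ?B" "?d3 b = ?d2 c"
      using bij_betw_apply[OF bij_betw_inv_into[OF b3]] bij_betw_inv_into_right[OF b3] by blast+
    then show "side_rel X P Q K a b" unfolding side_rel_def using ab c by metis
  qed
  with phi show thesis using that by blast
qed

text \<open>Radius 0 gives a single point of the plane, as needed for local homology; positive
  radius gives the compact neighbourhoods over which local classes must be consistent. One model
  computation covers both.\<close>

definition plane_square :: "(nat \<Rightarrow> real) \<Rightarrow> real \<Rightarrow> (nat \<Rightarrow> real) set" where
  "plane_square y r = {v \<in> topspace (Euclidean_space 3). v 2 = 0 \<and> \<bar>v 0 - y 0\<bar> \<le> r \<and> \<bar>v 1 - y 1\<bar> \<le> r}"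

lemma continuous_on_fun_upd_coord:
  fixes f :: "'b::topological_space \<Rightarrow> nat \<Rightarrow> real"
  assumes "continuous_on S f" "continuous_on S g"
  shows "continuous_on S (\<lambda>x. (f x)(k := g x))"
proof (rule continuous_on_coordinatewise_then_product)
  fix i
  show "continuous_on S (\<lambda>x. ((f x)(k := g x)) i)"
    using assms(2) continuous_on_product_then_coordinatewise[OF assms(1), of i] by (cases "i = k") auto
qed

lemma continuous_on_coordinate [simp]: "continuous_on S (\<lambda>x::nat \<Rightarrow> real. x i)"
  by (rule continuous_on_product_then_coordinatewise[OF continuous_on_id])

text \<open>Convexity makes the pieces star-shaped, with star centres off the plane supplied by
  \<open>\<eta>\<close> and the reflection, so only the excision isomorphism \<open>e\<close>
  remains. It is factored through \<open>Y - Z\<close>, a thickening of \<open>P - K\<close> below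
  the plane that pinches towards \<open>K\<close>: excision removes \<open>Z\<close>, and the
  thickening is pushed vertically onto \<open>P - K\<close>. The point \<open>w\<close> keeps
  \<open>P \<inter> Q - K\<close> nonempty.\<close>

lemma side_rel_model:
  fixes A :: "(nat \<Rightarrow> real) set"
  assumes A: "A \<subseteq> topspace (Euclidean_space 3)"
    and conv: "\<And>x z t. \<lbrakk>x \<in> A; z \<in> A; 0 \<le> t; t \<le> 1\<rbrakk> \<Longrightarrow> (\<lambda>i. (1 - t) * x i + t * z i) \<in> A"
    and refl: "\<And>x. x \<in> A \<Longrightarrow> x(2 := - x 2) \<in> A"
    and y: "y \<in> A" "y 2 = 0" and \<eta>: "\<eta> > 0" "y(2 := \<eta>) \<in> A" and r: "r \<ge> 0"
    and w: "w \<in> A" "w 2 = 0" "w \<notin> plane_square y r"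
  defines "P \<equiv> A \<inter> {v. 0 \<le> v 2}" and "Q \<equiv> A \<inter> {v. v 2 \<le> 0}" and "K \<equiv> plane_square y r"
  obtains \<phi> where "\<phi> \<in> iso (relative_homology_group 3 (top_of_set A) (A - K))
      (relative_homology_group 2 (top_of_set (P \<inter> Q)) (P \<inter> Q - K))"
    "\<And>a b. side_rel (top_of_set A) P Q K a b \<longleftrightarrow> a \<in> carrier (relative_homology_group 3 (top_of_set A) (A - K)) \<and> b = \<phi> a"
proof -
  \<comment> \<open>The point \<open>x\<close> and its mirror image span a vertical segment of
    \<open>A\<close>; \<open>t\<close> is the parameter at which it has height
    \<open>s\<close>.\<close>
  have shrink: "x(2 := s) \<in> A" if "x \<in> A" "\<bar>s\<bar> \<le> \<bar>x 2\<bar>" for x s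
  proof (cases "x 2 = 0")
    case True then show ?thesis using that by (simp add: fun_upd_idem)
  next
    case False
    define t where "t = (1 - s / x 2) / 2"
    have "\<bar>s / x 2\<bar> \<le> 1" using that False by (simp add: abs_divide)
    then have "s / x 2 \<le> 1" "- (s / x 2) \<le> 1" unfolding abs_le_iff by blast+
    then have "0 \<le> t" "t \<le> 1" by (auto simp: t_def)
    from conv[OF \<open>x \<in> A\<close> refl[OF \<open>x \<in> A\<close>] this] have "(\<lambda>i. (1 - t) * x i + t * (x(2 := - x 2)) i) \<in> A" .
    moreover have "(\<lambda>i. (1 - t) * x i + t * (x(2 := - x 2)) i) = x(2 := s)"
      using False by (auto simp: fun_eq_iff t_def field_simps)
    ultimately show ?thesis by simp
  qed
  \<comment> \<open>Distance in the maximum norm from the horizontal part of \<open>v\<close> to the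
    square, hence 0 exactly on the square and straight above and below it.\<close>
  define \<delta> where "\<delta> v = max 0 (max \<bar>v 0 - y 0\<bar> \<bar>v 1 - y 1\<bar> - r)" for v :: "nat \<Rightarrow> real"
  have \<delta>_cont: "continuous_on S \<delta>" for S
    unfolding \<delta>_def by (intro continuous_intros) auto
  have \<delta>0: "\<delta> v \<ge> 0" for v by (simp add: \<delta>_def)
  have K\<delta>: "v \<in> K \<longleftrightarrow> v 2 = 0 \<and> \<delta> v = 0" if "v \<in> A" for v
    using that A by (auto simp: K_def plane_square_def \<delta>_def max_def)
  have \<delta>_upd [simp]: "\<delta> (v(2 := s)) = \<delta> v" for v s by (simp add: \<delta>_def)
  have sub: "subtopology (top_of_set A) S = top_of_set (A \<inter> S)" for S
    by (simp add: subtopology_subtopology)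
  have QA: "A \<inter> (Q - K) = Q - K" and PA: "A \<inter> (P - K) = P - K" and BA: "A \<inter> (P \<inter> Q) = P \<inter> Q" and AK: "A \<inter> (A - K) = A - K"
    by (auto simp: P_def Q_def)
  have cX: "contractible_space (top_of_set A)"
    using starlike_imp_contractible_fun[OF y(1)] conv y by simp
  \<comment> \<open>The star centre lies strictly below the plane, so a segment towards it is
    strictly below the plane after its start and cannot meet \<open>K\<close>.\<close>
  have "contractible (Q - K)"
  proof (rule starlike_imp_contractible_fun)
    let ?c = "y(2 := - \<eta>)"
    have c: "?c \<in> A" using refl[OF \<eta>(2)] by simp
    then show "?c \<in> Q - K" using \<eta> by (auto simp: Q_def K\<delta>)
    fix x t :: _ assume x: "x \<in> Q - K" and t: "0 \<le> t" "t \<le> (1::real)"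
    let ?z = "\<lambda>i. (1 - t) * x i + t * ?c i"
    have zA: "?z \<in> A" using conv[OF _ c t] x by (auto simp: Q_def)
    have x2: "x 2 \<le> 0" using x by (auto simp: Q_def)
    have z2: "?z 2 = (1 - t) * x 2 - t * \<eta>" by simp
    have n1: "(1 - t) * x 2 \<le> 0" using x2 t by (intro mult_nonneg_nonpos) auto
    have n2: "t * \<eta> \<ge> 0" using t \<eta> by simp
    have "?z 2 \<le> 0" unfolding z2 using n1 n2 by linarith
    moreover have "?z \<notin> K"
    proof (cases "t = 0")
      case True then show ?thesis using x by simp
    next
      case False
      then have "t * \<eta> > 0" using t \<eta> by simp
      then have "?z 2 < 0" unfolding z2 using n1 by linarith
      then show ?thesis using zA K\<delta> by force
    qed
    ultimately show "?z \<in> Q - K" using zA by (simp add: Q_def)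
  qed
  then have cQ: "contractible_space (subtopology (top_of_set A) (Q - K))" by (simp add: QA sub)
  have "contractible (P - K)"
  proof (rule starlike_imp_contractible_fun)
    let ?c = "y(2 := \<eta>)"
    have c: "?c \<in> A" using \<eta>(2) by simp
    then show "?c \<in> P - K" using \<eta> by (auto simp: P_def K\<delta>)
    fix x t :: _ assume x: "x \<in> P - K" and t: "0 \<le> t" "t \<le> (1::real)"
    let ?z = "\<lambda>i. (1 - t) * x i + t * ?c i"
    have zA: "?z \<in> A" using conv[OF _ c t] x by (auto simp: P_def)
    have x2: "x 2 \<ge> 0" using x by (auto simp: P_def)
    have "?z 2 \<ge> 0" using x2 t \<eta> by simp
    moreover have "?z \<notin> K"
    proof (cases "t = 0")
      case True then show ?thesis using x by simp
    next
      case False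
      then have "t * \<eta> > 0" using t \<eta> by simp
      moreover have "(1 - t) * x 2 \<ge> 0" using x2 t by (intro mult_nonneg_nonneg) auto
      ultimately have "?z 2 > 0" by simp
      then show ?thesis using zA K\<delta> by force
    qed
    ultimately show "?z \<in> P - K" using zA by (simp add: P_def)
  qed
  then have cP: "contractible_space (subtopology (top_of_set A) (P - K))" by (simp add: PA sub)
  have "contractible (P \<inter> Q)"
  proof (rule starlike_imp_contractible_fun)
    show "y \<in> P \<inter> Q" using y by (simp add: P_def Q_def)
    fix x t :: _ assume x: "x \<in> P \<inter> Q" and t: "0 \<le> t" "t \<le> (1::real)"
    then show "(\<lambda>i. (1 - t) * x i + t * y i) \<in> P \<inter> Q"
      using conv[OF _ y(1) t, of x] y(2) by (auto simp: P_def Q_def)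
  qed
  then have cB: "contractible_space (subtopology (top_of_set A) (P \<inter> Q))" by (simp add: BA sub)
  have ne: "P \<inter> Q - K \<noteq> {}" using w by (auto simp: P_def Q_def K_def)
  define Y where "Y = A - K"
  \<comment> \<open>Everything directly below the square is removed, so the later vertical push
    cannot run into \<open>K\<close>. Elsewhere the cut is strictly below the plane, which the
    closure condition of excision requires.\<close>
  define Z where "Z = {v \<in> Y. v 2 < - \<delta> v}"
  have 1: "hom_induced 2 (top_of_set (Y - Z)) (Q - K - Z) (top_of_set Y) (Q - K) id
    \<in> iso (relative_homology_group 2 (top_of_set (Y - Z)) (Q - K - Z)) (relative_homology_group 2 (top_of_set Y) (Q - K))"
  proof -
    have cl: "closedin (top_of_set Y) {v \<in> Y. v 2 \<le> - \<delta> v}"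
      using continuous_closedin_preimage[of Y "\<lambda>v. v 2 + \<delta> v" "{..0}"] \<delta>_cont
      by (force simp: vimage_def Int_def le_diff_eq intro!: continuous_on_add elim!: back_subst[of "closedin _"])
    have "top_of_set Y closure_of Z \<subseteq> {v \<in> Y. v 2 \<le> - \<delta> v}"
      using cl by (intro closure_of_minimal) (auto simp: Z_def)
    \<comment> \<open>Height 0 together with \<open>\<delta> v = 0\<close> would put
      \<open>v\<close> into \<open>K\<close>, which \<open>Y\<close> omits.\<close>
    also have "\<dots> \<subseteq> {v \<in> Y. v 2 < 0}"
    proof clarsimp
      fix v assume "v \<in> Y" "v 2 \<le> - \<delta> v"
      then show "v 2 < 0" using \<delta>0[of v] K\<delta>[of v] by (auto simp: Y_def)
    qed
    also have "\<dots> \<subseteq> top_of_set Y interior_of (Q - K)"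
    proof (rule interior_of_maximal)
      show "{v \<in> Y. v 2 < 0} \<subseteq> Q - K" by (auto simp: Y_def Q_def)
      show "openin (top_of_set Y) {v \<in> Y. v 2 < 0}"
        using continuous_openin_preimage_gen[of Y "\<lambda>v. v 2" "{..<0}"] by (auto simp: vimage_def Int_def)
    qed
    finally have "top_of_set Y closure_of Z \<subseteq> top_of_set Y interior_of (Q - K)" .
    from homology_excision_axiom[OF this, of Y 2]
    have "hom_induced 2 (subtopology (top_of_set Y) (Y - Z)) (Q - K - Z) (subtopology (top_of_set Y) Y) (Q - K) id
      \<in> iso (relative_homology_group 2 (subtopology (top_of_set Y) (Y - Z)) (Q - K - Z))
         (relative_homology_group 2 (subtopology (top_of_set Y) Y) (Q - K))"
      by (auto simp: Y_def Q_def)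
    moreover have "Y \<inter> (Y - Z) = Y - Z" by auto
    ultimately show ?thesis by (simp add: subtopology_subtopology)
  qed
  have 2: "hom_induced 2 (top_of_set (P - K)) (P \<inter> Q - K) (top_of_set (Y - Z)) (Q - K - Z) id
    \<in> iso (relative_homology_group 2 (top_of_set (P - K)) (P \<inter> Q - K)) (relative_homology_group 2 (top_of_set (Y - Z)) (Q - K - Z))"
  proof (rule deformation_retract_relative_homology_group_isomorphism_id)
    \<comment> \<open>Heights above the plane stay, negative ones are multiplied by the time: time 0
      is the retraction, time 1 the identity.\<close>
    define h where "h p = (snd p)(2 := (1 - fst p) * max (snd p 2) 0 + fst p * snd p 2)" for p :: "real \<times> (nat \<Rightarrow> real)"
    have hpos: "h (t, v) = v" if "v 2 \<ge> 0" for t v using that by (simp add: h_def max_def fun_upd_idem algebra_simps)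
    have hneg: "h (t, v) = v(2 := t * v 2)" if "v 2 \<le> 0" for t v using that by (simp add: h_def max_def)
    have hYZ: "h (t, v) \<in> Y - Z" if v: "v \<in> Y - Z" and t: "0 \<le> t" "t \<le> 1" for t v
    proof (cases "v 2 \<ge> 0")
      case True then show ?thesis using v hpos by simp
    next
      case False
      have vA: "v \<in> A" and d: "v 2 \<ge> - \<delta> v" using v by (auto simp: Y_def Z_def)
      have "\<bar>t * v 2\<bar> \<le> \<bar>v 2\<bar>" using t by (simp add: abs_mult mult_left_le_one_le)
      then have hA: "v(2 := t * v 2) \<in> A" using shrink vA by blast
      have "\<delta> v > 0" using d False by linarith
      moreover have "t * v 2 \<ge> v 2" using t False by (simp add: mult_le_cancel_right1)
      moreover have "\<not> t * v 2 < - \<delta> v" using calculation(2) d by linarith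
      ultimately show ?thesis using hA False d K\<delta>[OF hA] by (auto simp: hneg Y_def Z_def)
    qed
    have hcont: "continuous_on S h" for S
      unfolding h_def
      by (intro continuous_on_fun_upd_coord continuous_intros
          continuous_on_product_then_coordinatewise[OF continuous_on_snd[OF continuous_on_id]])
    have r1: "h (0, v) \<in> P - K" if "v \<in> Y - Z" for v
      using hYZ[OF that, of 0] by (auto simp: P_def Y_def h_def)
    show "retraction_maps (top_of_set (Y - Z)) (top_of_set (P - K)) (\<lambda>v. h (0, v)) id"
      unfolding retraction_maps_def
    proof (intro conjI ballI)
      show "continuous_map (top_of_set (Y - Z)) (top_of_set (P - K)) (\<lambda>v. h (0, v))"
      proof -
        have "continuous_on (Y - Z) (\<lambda>v. h (0, v))"
          by (rule continuous_on_compose2[OF hcont[of UNIV]]) (auto intro!: continuous_on_Pair continuous_on_const continuous_on_id)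
        then show ?thesis using r1 by auto
      qed
      show "continuous_map (top_of_set (P - K)) (top_of_set (Y - Z)) id"
        using \<delta>0 by (auto simp: P_def Y_def Z_def) (smt (verit) \<delta>0)
      fix x assume "x \<in> topspace (top_of_set (P - K))"
      then show "h (0, id x) = x" by (simp add: hpos P_def)
    qed
    show "P \<inter> Q - K \<subseteq> Q - K - Z" using \<delta>0 by (auto simp: P_def Y_def Z_def) (smt (verit) \<delta>0)
    show "(\<lambda>v. h (0, v)) \<in> Q - K - Z \<rightarrow> P \<inter> Q - K"
    proof
      fix v assume v: "v \<in> Q - K - Z"
      then have "v \<in> Y - Z" by (auto simp: Q_def Y_def)
      from r1[OF this] v show "h (0, v) \<in> P \<inter> Q - K" by (auto simp: hneg Q_def P_def)
    qed
    show "homotopic_with (\<lambda>h. h ` (Q - K - Z) \<subseteq> Q - K - Z) (top_of_set (Y - Z)) (top_of_set (Y - Z)) (\<lambda>v. h (0, v)) id"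
      unfolding homotopic_with_def
    proof (intro exI conjI ballI)
      show "continuous_map (prod_topology (top_of_set {0..1}) (top_of_set (Y - Z))) (top_of_set (Y - Z)) h"
        using hcont hYZ by auto
      show "\<forall>v. h (1, v) = id v" by (simp add: h_def)
      fix t :: real assume t: "t \<in> {0..1}"
      have "h (t, v) \<in> Q - K - Z" if v: "v \<in> Q - K - Z" for v
      proof -
        have "v \<in> Y - Z" "v 2 \<le> 0" using v by (auto simp: Q_def Y_def)
        then show ?thesis using hYZ[of v t] t hneg[of v t] by (auto simp: Q_def Y_def mult_nonneg_nonpos)
      qed
      then show "(\<lambda>v. h (t, v)) ` (Q - K - Z) \<subseteq> Q - K - Z" by auto
    qed auto
  qed
  have c1: "continuous_map (top_of_set (P - K)) (top_of_set (Y - Z)) id"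
    using \<delta>0 by (auto simp: P_def Y_def Z_def) (smt (verit) \<delta>0)
  have c2: "continuous_map (top_of_set (Y - Z)) (top_of_set Y) id" by auto
  have i1: "id \<in> P \<inter> Q - K \<rightarrow> Q - K - Z" using \<delta>0 by (auto simp: P_def Y_def Z_def) (smt (verit) \<delta>0)
  have e: "hom_induced 2 (subtopology (top_of_set A) (P - K)) (P \<inter> Q - K) (subtopology (top_of_set A) (topspace (top_of_set A) - K)) (Q - K) id
      \<in> iso (relative_homology_group 2 (subtopology (top_of_set A) (P - K)) (P \<inter> Q - K))
            (relative_homology_group 2 (subtopology (top_of_set A) (topspace (top_of_set A) - K)) (Q - K))"
    using iso_set_trans[OF 2 1] hom_induced_compose[OF c1 i1 c2, of "Q - K" 2]
    unfolding sub topspace_euclidean_subtopology PA AK by (simp add: Y_def)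
  have "P \<subseteq> topspace (top_of_set A)" "Q \<subseteq> topspace (top_of_set A)" by (auto simp: P_def Q_def)
  from side_rel_iso[OF this cX cQ cP cB ne e] that show thesis
    unfolding sub topspace_euclidean_subtopology BA by blast
qed

lemma Euclidean_space_eq_top_of_set: "Euclidean_space n = top_of_set (topspace (Euclidean_space n))"
  by (simp add: Euclidean_space_def euclidean_product_topology)

lemma group_generator_iso:
  assumes f: "f \<in> iso G H" and G: "group G" and H: "group H" and a: "group_generator G a"
  shows "group_generator H (f a)"
proof -
  interpret f: group_hom G H f
    using f G H by (simp add: group_hom_def group_hom_axioms_def iso_def)
  have aG: "a \<in> carrier G" and gen: "\<And>b. b \<in> carrier G \<Longrightarrow> \<exists>k::int. b = a [^]\<^bsub>G\<^esub> k"
    using a by (auto simp: group_generator_def)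
  have "\<exists>k::int. b = f a [^]\<^bsub>H\<^esub> k" if b: "b \<in> carrier H" for b
  proof -
    obtain c where "c \<in> carrier G" "b = f c"
      using f b by (auto simp: iso_def bij_betw_def)
    with gen show ?thesis using f.hom_int_pow aG by blast
  qed
  then show ?thesis using aG by (simp add: group_generator_def)
qed

text \<open>Excision of everything outside \<open>U\<close>. Compactness of \<open>K\<close> makes
  its image closed in the Hausdorff space \<open>Y\<close>, so that the closed complement of
  \<open>U\<close> lies in the interior of the complement of the image.\<close>

lemma open_embedding_local_homology_iso:
  assumes Y: "Hausdorff_space Y" and U: "openin Y U"
    and \<theta>: "homeomorphic_map X (subtopology Y U) \<theta>" and K: "compactin X K"
  shows "hom_induced p X (topspace X - K) Y (topspace Y - \<theta> ` K) \<theta>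
    \<in> iso (relative_homology_group p X (topspace X - K)) (relative_homology_group p Y (topspace Y - \<theta> ` K))"
proof -
  have UY: "U \<subseteq> topspace Y" using U openin_subset by blast
  have cm: "continuous_map X (subtopology Y U) \<theta>" and im: "\<theta> ` topspace X = U" and inj: "inj_on \<theta> (topspace X)"
    using \<theta> UY by (auto simp: homeomorphic_imp_continuous_map homeomorphic_imp_injective_map
        homeomorphic_imp_surjective_map inf.absorb2)
  have KX: "K \<subseteq> topspace X" using K compactin_subset_topspace by blast
  have KU: "\<theta> ` K \<subseteq> U" using KX im by blast
  have clK: "closedin Y (\<theta> ` K)"
    by (rule compactin_imp_closedin[OF Y image_compactin[OF K continuous_map_into_fulltopology[OF cm]]])
  have im2: "\<theta> ` (topspace X - K) = U - \<theta> ` K"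
    using inj_on_image_set_diff[OF inj _ KX, of "topspace X"] im by simp
  have 1: "hom_induced p X (topspace X - K) (subtopology Y U) (U - \<theta> ` K) \<theta>
      \<in> iso (relative_homology_group p X (topspace X - K)) (relative_homology_group p (subtopology Y U) (U - \<theta> ` K))"
    by (rule homeomorphic_map_relative_homology_iso[OF \<theta> _ im2]) auto
  have "Y closure_of (topspace Y - U) \<subseteq> Y interior_of (topspace Y - \<theta> ` K)"
  proof -
    have "Y closure_of (topspace Y - U) = topspace Y - U"
      using U by (simp add: closure_of_closedin closedin_diff)
    moreover have "Y interior_of (topspace Y - \<theta> ` K) = topspace Y - \<theta> ` K"
      using clK by (simp add: interior_of_openin openin_diff)
    ultimately show ?thesis using KU by auto
  qed
  from homology_excision_axiom[OF this, of "topspace Y" p]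
  have 2: "hom_induced p (subtopology Y (topspace Y - (topspace Y - U))) (topspace Y - \<theta> ` K - (topspace Y - U)) Y (topspace Y - \<theta> ` K) id
     \<in> iso (relative_homology_group p (subtopology Y (topspace Y - (topspace Y - U))) (topspace Y - \<theta> ` K - (topspace Y - U)))
           (relative_homology_group p Y (topspace Y - \<theta> ` K))"
    by simp
  have UU: "topspace Y - (topspace Y - U) = U" "topspace Y - \<theta> ` K - (topspace Y - U) = U - \<theta> ` K"
    using UY by auto
  note 2 = 2[unfolded UU]
  have "hom_induced p X (topspace X - K) Y (topspace Y - \<theta> ` K) (id \<circ> \<theta>) =
     hom_induced p (subtopology Y U) (U - \<theta> ` K) Y (topspace Y - \<theta> ` K) id \<circ>
     hom_induced p X (topspace X - K) (subtopology Y U) (U - \<theta> ` K) \<theta>"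
    by (rule hom_induced_compose) (use cm im2 UY in auto)
  with iso_set_trans[OF 1 2] show ?thesis by simp
qed

text \<open>A product of compact intervals, degenerate from coordinate 2 on.\<close>

lemma compactin_plane_square: "compactin (Euclidean_space 3) (plane_square y r)"
proof -
  let ?F = "\<lambda>i::nat. if i = 0 then {y 0 - r..y 0 + r} else if i = 1 then {y 1 - r..y 1 + r} else {0::real}"
  have "plane_square y r = PiE UNIV ?F"
    unfolding plane_square_def topspace_Euclidean_space PiE_UNIV_domain
  proof (intro Set.set_eqI iffI)
    fix v :: "nat \<Rightarrow> real" assume v: "v \<in> {v \<in> {x. \<forall>i\<ge>3. x i = 0}. v 2 = 0 \<and> \<bar>v 0 - y 0\<bar> \<le> r \<and> \<bar>v 1 - y 1\<bar> \<le> r}"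
    have "v i \<in> ?F i" for i
    proof -
      consider "i = 0" | "i = 1" | "i = 2" | "i \<ge> 3" by linarith
      then show ?thesis using v by cases auto
    qed
    then show "v \<in> Pi UNIV ?F" by auto
  next
    fix v :: "nat \<Rightarrow> real" assume "v \<in> Pi UNIV ?F"
    then have v: "v i \<in> ?F i" for i by blast
    have "v i = 0" if "i \<ge> 2" for i using v[of i] that by (auto split: if_splits)
    then show "v \<in> {v \<in> {x. \<forall>i\<ge>3. x i = 0}. v 2 = 0 \<and> \<bar>v 0 - y 0\<bar> \<le> r \<and> \<bar>v 1 - y 1\<bar> \<le> r}"
      using v[of 0] v[of 1] by auto
  qed
  moreover have "compactin (powertop_real UNIV) (PiE UNIV ?F)"
    by (rule compactin_PiE[THEN iffD2]) auto
  ultimately show ?thesis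
    unfolding Euclidean_space_def compactin_subtopology by (auto simp: plane_square_def topspace_Euclidean_space)
qed

text \<open>The topology is that of a countable product, but the coordinates from \<open>n\<close>
  on vanish on the whole space, so only the first \<open>n\<close> constrain the radius.\<close>

lemma Euclidean_space_box_nhd:
  assumes "openin (Euclidean_space n) W" "y \<in> W"
  obtains \<epsilon> where "\<epsilon> > 0" "{v \<in> topspace (Euclidean_space n). \<forall>i<n. \<bar>v i - y i\<bar> < \<epsilon>} \<subseteq> W"
proof -
  obtain G where G: "openin (powertop_real UNIV) G" "W = G \<inter> {x. \<forall>i\<ge>n. x i = 0}"
    using assms(1) unfolding Euclidean_space_def openin_subtopology by blast
  then obtain X where X: "finite {i. X i \<noteq> UNIV}" "\<And>i. open (X i)" "y \<in> PiE UNIV X" "PiE UNIV X \<subseteq> G"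
    using assms(2) unfolding openin_product_topology_alt by (force simp: )
  have "\<exists>e>0. \<forall>t. \<bar>t - y i\<bar> < e \<longrightarrow> t \<in> X i" for i
  proof -
    have "y i \<in> X i" using X(3) by (auto simp: PiE_UNIV_domain)
    then show ?thesis using X(2)[of i] unfolding open_dist dist_real_def by blast
  qed
  then obtain e where e: "\<And>i. e i > 0" "\<And>i t. \<bar>t - y i\<bar> < e i \<Longrightarrow> t \<in> X i" by metis
  \<comment> \<open>The inserted 1 keeps the minimum defined when \<open>n\<close> is 0.\<close>
  define \<epsilon> where "\<epsilon> = Min (insert 1 (e ` {..<n}))"
  have "\<epsilon> > 0" unfolding \<epsilon>_def using e(1) by (subst Min_gr_iff) auto
  moreover have "v \<in> W" if v: "v \<in> topspace (Euclidean_space n)" "\<forall>i<n. \<bar>v i - y i\<bar> < \<epsilon>" for v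
  proof -
    have "v i \<in> X i" for i
    proof (cases "i < n")
      case True
      then have "\<epsilon> \<le> e i" unfolding \<epsilon>_def by (intro Min_le) auto
      then show ?thesis using v True e(2) by fastforce
    next
      case False
      then have "v i = y i" using v assms(2) G(2) by (auto simp: topspace_Euclidean_space)
      then show ?thesis using e by simp
    qed
    then show ?thesis using X(4) G(2) v by (auto simp: PiE_UNIV_domain topspace_Euclidean_space)
  qed
  ultimately show ?thesis using that by blast
qed

section \<open>Flat charts and the models in which they are read\<close>

abbreviation R3 :: "(nat \<Rightarrow> real) set" where "R3 \<equiv> topspace (Euclidean_space 3)"
abbreviation upper3 :: "(nat \<Rightarrow> real) set" where "upper3 \<equiv> R3 \<inter> {v. 0 \<le> v 2}"
abbreviation lower3 :: "(nat \<Rightarrow> real) set" where "lower3 \<equiv> R3 \<inter> {v. v 2 \<le> 0}"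
abbreviation plane3 :: "(nat \<Rightarrow> real) set" where "plane3 \<equiv> upper3 \<inter> lower3"

definition flat_chart :: "'a topology \<Rightarrow> 'a set \<Rightarrow> 'a set \<Rightarrow> ('a \<Rightarrow> nat \<Rightarrow> real) \<Rightarrow> bool" where
  "flat_chart M S U h \<longleftrightarrow> openin M U \<and> homeomorphic_map (subtopology M U) (Euclidean_space 3) h \<and>
     h ` (U \<inter> S) = {v \<in> topspace (Euclidean_space 3). v 2 = 0}"

lemma plane_square_0: "y \<in> R3 \<Longrightarrow> y 2 = 0 \<Longrightarrow> plane_square y 0 = {y}"
proof (intro Set.set_eqI iffI)
  fix v assume y: "y \<in> R3" "y 2 = 0" and "v \<in> plane_square y 0"
  then have v: "v \<in> R3" "v 2 = 0" "v 0 = y 0" "v 1 = y 1" by (auto simp: plane_square_def)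
  have "v i = y i" for i
  proof -
    consider "i = 0" | "i = 1" | "i = 2" | "i \<ge> 3" by linarith
    then show ?thesis using v y by cases (auto simp: topspace_Euclidean_space)
  qed
  then show "v \<in> {y}" by auto
qed (auto simp: plane_square_def)

lemma model_R3:
  assumes y: "y \<in> R3" "y 2 = 0" and r: "r \<ge> 0"
  obtains \<phi> where "\<phi> \<in> iso (relative_homology_group 3 (top_of_set R3) (R3 - plane_square y r))
      (relative_homology_group 2 (top_of_set plane3) (plane3 - plane_square y r))"
    "\<And>a b. side_rel (top_of_set R3) upper3 lower3 (plane_square y r) a b \<longleftrightarrow>
       a \<in> carrier (relative_homology_group 3 (top_of_set R3) (R3 - plane_square y r)) \<and> b = \<phi> a"
proof (rule side_rel_model[of R3 y 1 r "y(0 := y 0 + r + 1)"])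
  show "y(0 := y 0 + r + 1) \<notin> plane_square y r" using r by (simp add: plane_square_def)
qed (use y r that in \<open>auto simp: topspace_Euclidean_space\<close>)

lemma abs_convex_less:
  fixes p q y t r :: real
  assumes "\<bar>p - y\<bar> < r" "\<bar>q - y\<bar> < r" "0 \<le> t" "t \<le> 1"
  shows "\<bar>(1 - t) * p + t * q - y\<bar> < r"
proof -
  have "(1 - t) * p + t * q - y = (1 - t) * (p - y) + t * (q - y)" by (simp add: algebra_simps)
  also have "\<bar>\<dots>\<bar> < r"
    using convex_bound_lt[of "\<bar>p - y\<bar>" r "\<bar>q - y\<bar>" "1 - t" t] assms
      abs_triangle_ineq[of "(1 - t) * (p - y)" "t * (q - y)"] by (simp add: abs_mult)
  finally show ?thesis .
qed

text \<open>A box is needed besides the whole space because two charts agree on the sides only near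
  a point.\<close>

lemma model_box:
  assumes y: "y \<in> R3" "y 2 = 0" and e: "\<epsilon> > 0"
  defines "A \<equiv> {v \<in> R3. \<forall>i<3. \<bar>v i - y i\<bar> < \<epsilon>}"
  obtains \<phi> where "\<phi> \<in> iso (relative_homology_group 3 (top_of_set A) (A - {y}))
      (relative_homology_group 2 (top_of_set (A \<inter> {v. 0 \<le> v 2} \<inter> (A \<inter> {v. v 2 \<le> 0}))) (A \<inter> {v. 0 \<le> v 2} \<inter> (A \<inter> {v. v 2 \<le> 0}) - {y}))"
    "\<And>a b. side_rel (top_of_set A) (A \<inter> {v. 0 \<le> v 2}) (A \<inter> {v. v 2 \<le> 0}) {y} a b \<longleftrightarrow>
       a \<in> carrier (relative_homology_group 3 (top_of_set A) (A - {y})) \<and> b = \<phi> a"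
proof (rule side_rel_model[of A y "\<epsilon> / 2" 0 "y(0 := y 0 + \<epsilon> / 2)"])
  show "A \<subseteq> R3" by (auto simp: A_def)
  show "(\<lambda>i. (1 - t) * x i + t * z i) \<in> A" if "x \<in> A" "z \<in> A" "0 \<le> t" "t \<le> 1" for x z t
  proof -
    have "\<bar>(1 - t) * x i + t * z i - y i\<bar> < \<epsilon>" if "i < 3" for i
      using abs_convex_less[of "x i" "y i" \<epsilon> "z i" t] \<open>x \<in> A\<close> \<open>z \<in> A\<close> \<open>0 \<le> t\<close> \<open>t \<le> 1\<close> that by (simp add: A_def)
    then show ?thesis using that by (auto simp: A_def topspace_Euclidean_space)
  qed
  show "x(2 := - x 2) \<in> A" if "x \<in> A" for x
  proof -
    have "\<bar>(x(2 := - x 2)) i - y i\<bar> < \<epsilon>" if "i < 3" for i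
      using \<open>x \<in> A\<close> y(2) that by (auto simp: A_def)
    then show ?thesis using that by (simp add: A_def topspace_Euclidean_space)
  qed
  show "y(0 := y 0 + \<epsilon> / 2) \<notin> plane_square y 0" using e by (auto simp: plane_square_def)
qed (use y e that in \<open>auto simp: A_def topspace_Euclidean_space plane_square_0\<close>)

lemma model_point:
  assumes y: "y \<in> R3" "y 2 = 0"
  obtains \<phi> where "\<phi> \<in> iso (relative_homology_group 3 (top_of_set R3) (R3 - {y}))
      (relative_homology_group 2 (top_of_set plane3) (plane3 - {y}))"
    "\<And>a b. side_rel (top_of_set R3) upper3 lower3 {y} a b \<longleftrightarrow>
       a \<in> carrier (relative_homology_group 3 (top_of_set R3) (R3 - {y})) \<and> b = \<phi> a"
  by (rule model_R3[OF y order_refl, unfolded plane_square_0[OF y]]) (rule that)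

text \<open>Naturality for the identity map: restricts local classes from a compact set to a smaller
  one, in particular from a square to its points.\<close>

lemma side_rel_inclusion:
  assumes "K \<subseteq> L" "side_rel (top_of_set R3) upper3 lower3 L a b"
  shows "side_rel (top_of_set R3) upper3 lower3 K
     (hom_induced 3 (top_of_set R3) (R3 - L) (top_of_set R3) (R3 - K) id a)
     (hom_induced 2 (top_of_set plane3) (plane3 - L) (top_of_set plane3) (plane3 - K) id b)"
proof -
  have s: "subtopology (top_of_set R3) plane3 = top_of_set plane3"
    unfolding subtopology_subtopology by (intro arg_cong[where f="subtopology _"]) blast
  show ?thesis
    using side_rel_natural[of "top_of_set R3" "top_of_set R3" id upper3 upper3 lower3 lower3 L K a b] assms
    unfolding s by auto
qed

lemma flat_chart_open: "flat_chart M S U h \<Longrightarrow> openin M U"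
  and flat_chart_homeo: "flat_chart M S U h \<Longrightarrow> homeomorphic_map (subtopology M U) (Euclidean_space 3) h"
  and flat_chart_image: "flat_chart M S U h \<Longrightarrow> h ` (U \<inter> S) = {v \<in> R3. v 2 = 0}"
  by (simp_all add: flat_chart_def)

lemma flat_chart_inverse:
  assumes "flat_chart M S U h"
  defines "\<theta> \<equiv> inv_into U h"
  shows "continuous_map (subtopology M U) (top_of_set R3) h"
    and "homeomorphic_map (top_of_set R3) (subtopology M U) \<theta>"
    and "continuous_map (top_of_set R3) M \<theta>"
    and "homeomorphic_map (top_of_set plane3) (subtopology (subtopology M S) (U \<inter> S)) \<theta>"
    and "continuous_map (top_of_set plane3) (subtopology M S) \<theta>"
    and "\<And>x. x \<in> U \<Longrightarrow> h x \<in> R3" and "\<And>x. x \<in> U \<Longrightarrow> \<theta> (h x) = x"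
    and "\<And>v. v \<in> R3 \<Longrightarrow> \<theta> v \<in> U" and "\<And>v. v \<in> R3 \<Longrightarrow> h (\<theta> v) = v"
    and "\<And>v. v \<in> R3 \<Longrightarrow> \<theta> v \<in> S \<longleftrightarrow> v 2 = 0" and "\<And>x. x \<in> U \<Longrightarrow> x \<in> S \<longleftrightarrow> h x 2 = 0"
    and "openin (subtopology M S) (U \<inter> S)"
proof -
  note U = flat_chart_open[OF assms(1)] and hS = flat_chart_image[OF assms(1)]
  have UM: "U \<subseteq> topspace M" using U by (rule openin_subset)
  then have tU: "topspace (subtopology M U) = U" by auto
  note h = flat_chart_homeo[OF assms(1)]
  have bij: "bij_betw h U R3"
    using tU homeomorphic_imp_injective_map[OF h] homeomorphic_imp_surjective_map[OF h]
    by (simp add: bij_betw_def)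
  note heq = Euclidean_space_eq_top_of_set[of 3]
  show 0: "continuous_map (subtopology M U) (top_of_set R3) h"
    using homeomorphic_imp_continuous_map[OF h] heq by simp
  show n1: "h x \<in> R3" if "x \<in> U" for x by (rule bij_betw_apply[OF bij that])
  show n1i: "\<theta> (h x) = x" if "x \<in> U" for x unfolding \<theta>_def by (rule bij_betw_inv_into_left[OF bij that])
  show n2: "\<theta> v \<in> U" if "v \<in> R3" for v unfolding \<theta>_def by (rule bij_betw_apply[OF bij_betw_inv_into[OF bij] that])
  show n2i: "h (\<theta> v) = v" if "v \<in> R3" for v unfolding \<theta>_def by (rule bij_betw_inv_into_right[OF bij that])
  obtain g where g: "homeomorphic_maps (subtopology M U) (Euclidean_space 3) h g"
    using h unfolding homeomorphic_map_maps by blast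
  have gR: "g v \<in> U" if "v \<in> R3" for v
    using continuous_map_image_subset_topspace[of "Euclidean_space 3" "subtopology M U" g] g that tU
    by (auto simp: homeomorphic_maps_def)
  have "h (g v) = v" if "v \<in> R3" for v using g that by (auto simp: homeomorphic_maps_def)
  then have g\<theta>: "g v = \<theta> v" if "v \<in> R3" for v using n1i[OF gR[OF that]] that by simp
  have "homeomorphic_map (Euclidean_space 3) (subtopology M U) g"
    using homeomorphic_maps_imp_map homeomorphic_maps_sym g by metis
  then have "homeomorphic_map (Euclidean_space 3) (subtopology M U) \<theta>"
    by (rule homeomorphic_map_eq) (use g\<theta> in auto)
  then show hm: "homeomorphic_map (top_of_set R3) (subtopology M U) \<theta>" using heq by simp
  show c: "continuous_map (top_of_set R3) M \<theta>"
    by (rule continuous_map_into_fulltopology[OF homeomorphic_imp_continuous_map[OF hm]])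
  show 4: "x \<in> S \<longleftrightarrow> h x 2 = 0" if "x \<in> U" for x
  proof
    assume "x \<in> S"
    then have "h x \<in> h ` (U \<inter> S)" using that by blast
    then show "h x 2 = 0" unfolding hS by simp
  next
    assume "h x 2 = 0"
    then have "h x \<in> h ` (U \<inter> S)" using n1[OF that] unfolding hS by simp
    then obtain z where z: "h x = h z" "z \<in> U \<inter> S" by (rule imageE)
    have "\<theta> (h z) = z" by (rule n1i) (use z in simp)
    moreover have "\<theta> (h z) = x" using n1i[OF that] z(1) by simp
    ultimately show "x \<in> S" using z(2) by simp
  qed
  show 3: "\<theta> v \<in> S \<longleftrightarrow> v 2 = 0" if v: "v \<in> R3" for v
    using 4[OF n2[OF v]] n2i[OF v] by simp
  have im: "\<theta> ` (topspace (top_of_set R3) \<inter> plane3) = topspace (subtopology M U) \<inter> (U \<inter> S)"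
    unfolding tU topspace_euclidean_subtopology
  proof
    show "\<theta> ` (R3 \<inter> plane3) \<subseteq> U \<inter> (U \<inter> S)"
      using n2 3 by auto
    show "U \<inter> (U \<inter> S) \<subseteq> \<theta> ` (R3 \<inter> plane3)"
    proof
      fix x assume "x \<in> U \<inter> (U \<inter> S)"
      then have xU: "x \<in> U" "x \<in> S" by auto
      have "h x \<in> R3 \<inter> plane3" using n1[OF xU(1)] 4[OF xU(1)] xU(2) by simp
      moreover have "x = \<theta> (h x)" using n1i[OF xU(1)] by simp
      ultimately show "x \<in> \<theta> ` (R3 \<inter> plane3)" by blast
    qed
  qed
  have sp: "subtopology (top_of_set R3) plane3 = top_of_set plane3"
    "subtopology (subtopology M U) (U \<inter> S) = subtopology (subtopology M S) (U \<inter> S)"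
    unfolding subtopology_subtopology by (intro arg_cong[where f="subtopology _"]; blast)+
  show hs: "homeomorphic_map (top_of_set plane3) (subtopology (subtopology M S) (U \<inter> S)) \<theta>"
    using homeomorphic_map_subtopologies[OF hm im] unfolding sp .
  show "openin (subtopology M S) (U \<inter> S)" using U by (simp add: openin_subtopology_Int)
  show "continuous_map (top_of_set plane3) (subtopology M S) \<theta>"
    by (rule continuous_map_into_fulltopology[OF homeomorphic_imp_continuous_map[OF hs]])
qed

section \<open>Local orientations of the surface induced from the ambient manifold\<close>

locale subset_of_Hausdorff =
  fixes M :: "'a topology" and S :: "'a set" and \<mu> :: "'a \<Rightarrow> 'a chain set"
  assumes M: "Hausdorff_space M" and S: "S \<subseteq> topspace M"
begin

text \<open>\<open>b\<close> is the local orientation of the surface at \<open>x\<close> which corresponds to the local orientation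
  \<open>\<mu> x\<close> of the ambient manifold through the chart \<open>h\<close>.\<close>
definition surface_class :: "'a set \<Rightarrow> ('a \<Rightarrow> nat \<Rightarrow> real) \<Rightarrow> 'a \<Rightarrow> 'a chain set \<Rightarrow> bool" where
  "surface_class U h x b \<longleftrightarrow> (\<exists>a b'. side_rel (top_of_set R3) upper3 lower3 {h x} a b' \<and>
     hom_induced 3 (top_of_set R3) (R3 - {h x}) M (topspace M - {x}) (inv_into U h) a = \<mu> x \<and>
     b = hom_induced 2 (top_of_set plane3) (plane3 - {h x}) (subtopology M S) (S - {x}) (inv_into U h) b')"

lemma flat_chart_local_homology_iso:
  assumes h: "flat_chart M S U h" and x: "x \<in> U \<inter> S"
  shows "hom_induced 3 (top_of_set R3) (R3 - {h x}) M (topspace M - {x}) (inv_into U h) \<in>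
      iso (relative_homology_group 3 (top_of_set R3) (R3 - {h x})) (relative_homology_group 3 M (topspace M - {x}))"
    "hom_induced 2 (top_of_set plane3) (plane3 - {h x}) (subtopology M S) (S - {x}) (inv_into U h) \<in>
      iso (relative_homology_group 2 (top_of_set plane3) (plane3 - {h x})) (relative_homology_group 2 (subtopology M S) (S - {x}))"
proof -
  note t = flat_chart_inverse[OF h]
  have hx: "h x \<in> R3" "h x 2 = 0" "inv_into U h (h x) = x" using t(6,7,11) x by auto
  have cK: "compactin (top_of_set R3) {h x}" "compactin (top_of_set plane3) {h x}"
    using hx by (simp_all add: finite_imp_compactin)
  show "hom_induced 3 (top_of_set R3) (R3 - {h x}) M (topspace M - {x}) (inv_into U h) \<in>
      iso (relative_homology_group 3 (top_of_set R3) (R3 - {h x})) (relative_homology_group 3 M (topspace M - {x}))"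
    using open_embedding_local_homology_iso[OF M flat_chart_open[OF h] t(2) cK(1), of 3] hx(3) by simp
  show "hom_induced 2 (top_of_set plane3) (plane3 - {h x}) (subtopology M S) (S - {x}) (inv_into U h) \<in>
      iso (relative_homology_group 2 (top_of_set plane3) (plane3 - {h x})) (relative_homology_group 2 (subtopology M S) (S - {x}))"
    using open_embedding_local_homology_iso[OF Hausdorff_space_subtopology[OF M] t(12) t(4) cK(2), of 2] hx(3) S
    by (simp add: inf.absorb2)
qed

text \<open>The chart induces an isomorphism in degree 3, so \<open>\<mu> x\<close> has only one
  preimage, and over it the side relation is single-valued.\<close>

lemma surface_class_unique:
  assumes h: "flat_chart M S U h"
    and x: "x \<in> U \<inter> S" and b: "surface_class U h x b" "surface_class U h x b'"
  shows "b = b'"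
proof -
  note t = flat_chart_inverse[OF h]
  have hx: "h x \<in> R3" "h x 2 = 0" using t(6,11) x by auto
  obtain \<phi> where p: "\<And>a b. side_rel (top_of_set R3) upper3 lower3 {h x} a b \<longleftrightarrow>
       a \<in> carrier (relative_homology_group 3 (top_of_set R3) (R3 - {h x})) \<and> b = \<phi> a"
    by (rule model_point[OF hx]) (rule that)
  note inj = flat_chart_local_homology_iso(1)[OF h x, unfolded iso_def bij_betw_def mem_Collect_eq, THEN conjunct2, THEN conjunct1]
  obtain a1 a2 where a: "a1 \<in> carrier (relative_homology_group 3 (top_of_set R3) (R3 - {h x}))"
      "a2 \<in> carrier (relative_homology_group 3 (top_of_set R3) (R3 - {h x}))"
      "hom_induced 3 (top_of_set R3) (R3 - {h x}) M (topspace M - {x}) (inv_into U h) a1 = \<mu> x"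
      "hom_induced 3 (top_of_set R3) (R3 - {h x}) M (topspace M - {x}) (inv_into U h) a2 = \<mu> x"
      "b = hom_induced 2 (top_of_set plane3) (plane3 - {h x}) (subtopology M S) (S - {x}) (inv_into U h) (\<phi> a1)"
      "b' = hom_induced 2 (top_of_set plane3) (plane3 - {h x}) (subtopology M S) (S - {x}) (inv_into U h) (\<phi> a2)"
    using b unfolding surface_class_def p by blast
  then have "a1 = a2" using inj_onD[OF inj _ a(1,2)] by simp
  then show ?thesis using a by simp
qed

text \<open>A generator passes through three isomorphisms: the chart in degree 3 read backwards, the
  model, and the chart in degree 2.\<close>

lemma surface_class_generator:
  assumes h: "flat_chart M S U h"
    and x: "x \<in> U \<inter> S" and \<mu>: "group_generator (relative_homology_group 3 M (topspace M - {x})) (\<mu> x)"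
  obtains b where "surface_class U h x b" "group_generator (relative_homology_group 2 (subtopology M S) (S - {x})) b"
proof -
  note t = flat_chart_inverse[OF h]
  have hx: "h x \<in> R3" "h x 2 = 0" using t(6,11) x by auto
  let ?A = "relative_homology_group 3 (top_of_set R3) (R3 - {h x})"
  let ?j = "hom_induced 3 (top_of_set R3) (R3 - {h x}) M (topspace M - {x}) (inv_into U h)"
  let ?k = "hom_induced 2 (top_of_set plane3) (plane3 - {h x}) (subtopology M S) (S - {x}) (inv_into U h)"
  note i3 = flat_chart_local_homology_iso(1)[OF h x] and i2 = flat_chart_local_homology_iso(2)[OF h x]
  obtain \<phi> where p: "\<phi> \<in> iso ?A (relative_homology_group 2 (top_of_set plane3) (plane3 - {h x}))"
    "\<And>a b. side_rel (top_of_set R3) upper3 lower3 {h x} a b \<longleftrightarrow> a \<in> carrier ?A \<and> b = \<phi> a"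
    by (rule model_point[OF hx]) (rule that)
  define a where "a = inv_into (carrier ?A) ?j (\<mu> x)"
  have ga: "group_generator ?A a"
    unfolding a_def by (rule group_generator_iso[OF group.iso_set_sym[OF group_relative_homology_group i3] _ _ \<mu>]) simp_all
  have bj: "bij_betw ?j (carrier ?A) (carrier (relative_homology_group 3 M (topspace M - {x})))"
    using i3 by (simp add: iso_def)
  have "\<mu> x \<in> carrier (relative_homology_group 3 M (topspace M - {x}))" using \<mu> by (simp add: group_generator_def)
  then have ja: "?j a = \<mu> x" unfolding a_def by (rule bij_betw_inv_into_right[OF bj])
  have "group_generator (relative_homology_group 2 (top_of_set plane3) (plane3 - {h x})) (\<phi> a)"
    by (rule group_generator_iso[OF p(1) _ _ ga]) simp_all
  then have 1: "group_generator (relative_homology_group 2 (subtopology M S) (S - {x})) (?k (\<phi> a))"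
    by (rule group_generator_iso[OF i2, rotated 2]) simp_all
  have "a \<in> carrier ?A" using ga by (simp add: group_generator_def)
  then have "side_rel (top_of_set R3) upper3 lower3 {h x} a (\<phi> a)" using p(2) by simp
  then have "surface_class U h x (?k (\<phi> a))" unfolding surface_class_def using ja by blast
  with 1 show thesis using that by blast
qed

text \<open>Both charts are compared with one small box around the point. A class computed in the
  box is carried into either model by naturality, along the inclusion for \<open>h\<close> and along
  \<open>k \<circ> \<theta>\<close> for \<open>k\<close>. Agreement of signs says that both maps
  send the upper part to the upper side and the lower part to the lower side.\<close>

lemma surface_class_transition:
  assumes h: "flat_chart M S U h" and k: "flat_chart M S V k"
    and x: "x \<in> U \<inter> V \<inter> S" and \<mu>: "\<mu> x \<in> carrier (relative_homology_group 3 M (topspace M - {x}))"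
    and T: "openin M T" "x \<in> T" "T \<subseteq> U \<inter> V" "\<And>y. y \<in> T \<Longrightarrow> sgn (h y 2) = sgn (k y 2)"
  obtains b where "surface_class U h x b" "surface_class V k x b"
proof -
  define \<theta> where "\<theta> = inv_into U h"
  define \<theta>' where "\<theta>' = inv_into V k"
  note fh = flat_chart_inverse[OF h, folded \<theta>_def] and fk = flat_chart_inverse[OF k, folded \<theta>'_def]
  note h1 = fh(6,7) and t1 = fh(8,9) and k1 = fk(6,7) and t2 = fk(8,9)
  have UM: "openin M U" "U \<subseteq> topspace M" using flat_chart_open[OF h] openin_subset by auto
  have tS: "\<theta> v \<in> S" if "v \<in> plane3" for v using fh(10)[of v] that by auto
  have tS': "\<theta>' v \<in> S" if "v \<in> plane3" for v using fk(10)[of v] that by auto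
  define y where "y = h x"
  have y: "y \<in> R3" "y 2 = 0" "\<theta> y = x" using x h1 fh(11) by (auto simp: y_def)
  have oT: "openin (top_of_set R3) (h ` T)"
  proof -
    have "h ` T = {v \<in> topspace (top_of_set R3). \<theta> v \<in> T}" using T(3) h1 t1 by force
    then show ?thesis using openin_continuous_map_preimage[OF fh(3) T(1)] by simp
  qed
  have "openin (Euclidean_space 3) (h ` T)" using oT Euclidean_space_eq_top_of_set[of 3] by simp
  moreover have "y \<in> h ` T" using T(2) by (simp add: y_def)
  ultimately obtain \<epsilon> where e: "\<epsilon> > 0" "{v \<in> R3. \<forall>i<3. \<bar>v i - y i\<bar> < \<epsilon>} \<subseteq> h ` T"
    by (rule Euclidean_space_box_nhd)
  define A where "A = {v \<in> R3. \<forall>i<3. \<bar>v i - y i\<bar> < \<epsilon>}"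
  have AR: "A \<subseteq> R3" by (auto simp: A_def)
  have yA: "y \<in> A" using y(1) e(1) by (simp add: A_def)
  have tA: "\<theta> v \<in> T" if "v \<in> A" for v
  proof -
    obtain z where "v = h z" "z \<in> T" using subsetD[OF e(2)] \<open>v \<in> A\<close> unfolding A_def by blast
    then show ?thesis using h1(2)[of z] T(3) by auto
  qed
  have oA: "openin (top_of_set R3) A"
  proof -
    have "openin (top_of_set R3) {v \<in> topspace (top_of_set R3). v i \<in> {y i - \<epsilon><..<y i + \<epsilon>}}" for i
      by (rule openin_continuous_map_preimage[of _ euclideanreal]) auto
    then have "openin (top_of_set R3) (\<Inter>i\<in>{..<3}. {v \<in> topspace (top_of_set R3). v i \<in> {y i - \<epsilon><..<y i + \<epsilon>}})"
      by (intro openin_INT2[of "{..<3}"]) (simp_all add: lessThan_empty_iff)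
    also have "(\<Inter>i\<in>{..<3}. {v \<in> topspace (top_of_set R3). v i \<in> {y i - \<epsilon><..<y i + \<epsilon>}}) = A"
    proof (rule Set.set_eqI)
      fix v
      have "v \<in> (\<Inter>i\<in>{..<3}. {v \<in> topspace (top_of_set R3). v i \<in> {y i - \<epsilon><..<y i + \<epsilon>}})
        \<longleftrightarrow> (\<forall>i<3. v \<in> R3 \<and> \<bar>v i - y i\<bar> < \<epsilon>)"
      proof -
        have "v i \<in> {y i - \<epsilon><..<y i + \<epsilon>} \<longleftrightarrow> \<bar>v i - y i\<bar> < \<epsilon>" for i by (auto simp: abs_less_iff)
        then show ?thesis
          unfolding INT_iff Ball_def lessThan_iff mem_Collect_eq topspace_euclidean_subtopology by simp
      qed
      then show "v \<in> (\<Inter>i\<in>{..<3}. {v \<in> topspace (top_of_set R3). v i \<in> {y i - \<epsilon><..<y i + \<epsilon>}}) \<longleftrightarrow> v \<in> A"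
        unfolding A_def using zero_less_numeral by blast
    qed
    finally show ?thesis .
  qed
  let ?PA = "A \<inter> {v. 0 \<le> v 2}" and ?QA = "A \<inter> {v. v 2 \<le> 0}"
  obtain \<phi> where p: "\<And>a b. side_rel (top_of_set A) ?PA ?QA {y} a b \<longleftrightarrow>
       a \<in> carrier (relative_homology_group 3 (top_of_set A) (A - {y})) \<and> b = \<phi> a"
    by (rule model_box[OF y(1,2) e(1), folded A_def]) (rule that)
  define W where "W = \<theta> ` A"
  have oW: "openin M W"
  proof -
    have "openin (subtopology M U) W"
      unfolding W_def using homeomorphic_imp_open_map[OF fh(2)] oA by (simp add: open_map_def)
    then show ?thesis using openin_trans_full[OF _ UM(1)] by simp
  qed
  have WU: "W \<subseteq> U" using t1 AR by (auto simp: W_def)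
  have hA: "homeomorphic_map (top_of_set A) (subtopology M W) \<theta>"
  proof -
    have "homeomorphic_map (subtopology (top_of_set R3) A) (subtopology (subtopology M U) W) \<theta>"
      by (rule homeomorphic_map_subtopologies[OF fh(2)]) (use AR WU UM in \<open>auto simp: W_def\<close>)
    then show ?thesis using AR WU by (simp add: subtopology_subtopology inf.absorb2)
  qed
  \<comment> \<open>By excision \<open>\<mu> x\<close> lifts to a class \<open>a\<close> of the box;
    its partner \<open>\<phi> a\<close> will give the common surface class.\<close>
  have iA: "hom_induced 3 (top_of_set A) (A - {y}) M (topspace M - {x}) \<theta> \<in>
      iso (relative_homology_group 3 (top_of_set A) (A - {y})) (relative_homology_group 3 M (topspace M - {x}))"
    using open_embedding_local_homology_iso[OF M oW hA, of "{y}" 3] yA y(3) by (simp add: finite_imp_compactin)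
  then have "\<mu> x \<in> hom_induced 3 (top_of_set A) (A - {y}) M (topspace M - {x}) \<theta> ` carrier (relative_homology_group 3 (top_of_set A) (A - {y}))"
    using \<mu> by (simp add: iso_def bij_betw_def)
  then obtain a where a: "a \<in> carrier (relative_homology_group 3 (top_of_set A) (A - {y}))"
    "hom_induced 3 (top_of_set A) (A - {y}) M (topspace M - {x}) \<theta> a = \<mu> x"
    by auto
  have rel: "side_rel (top_of_set A) ?PA ?QA {y} a (\<phi> a)" using a p by blast
  have sA: "subtopology (top_of_set A) (?PA \<inter> ?QA) = top_of_set (?PA \<inter> ?QA)"
    unfolding subtopology_subtopology by (intro arg_cong[where f="subtopology _"]) blast
  have sR: "subtopology (top_of_set R3) plane3 = top_of_set plane3"
    unfolding subtopology_subtopology by (intro arg_cong[where f="subtopology _"]) blast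
  \<comment> \<open>Here \<open>f\<close> maps the box into the model and \<open>\<tau>\<close> is
    the inverse of the chart under consideration. The conclusion names the same surface class
    whichever chart is inserted.\<close>
  have key: "surface_class V' k' x (hom_induced 2 (top_of_set (?PA \<inter> ?QA)) (?PA \<inter> ?QA - {y}) (subtopology M S) (S - {x}) \<theta> (\<phi> a))"
    if f: "continuous_map (top_of_set A) (top_of_set R3) f" and fs: "\<And>v. v \<in> A \<Longrightarrow> sgn (f v 2) = sgn (v 2)"
      and fy: "f y = k' x" and ft: "\<And>v. v \<in> A \<Longrightarrow> \<tau> (f v) = \<theta> v" and fi: "\<And>v. v \<in> A \<Longrightarrow> f v = f y \<Longrightarrow> v = y"
      and \<tau>: "continuous_map (top_of_set R3) M \<tau>" "\<And>v. v \<in> plane3 \<Longrightarrow> \<tau> v \<in> S" "inj_on \<tau> R3" and inv: "\<tau> = inv_into V' k'" for f V' k' \<tau>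
  proof -
    have fR: "f v \<in> R3" if "v \<in> A" for v using f that by (auto simp: continuous_map_def)
    have fP: "f v \<in> upper3" if "v \<in> ?PA" for v using fR[of v] fs[of v] that by (auto simp: sgn_if split: if_splits)
    have fQ: "f v \<in> lower3" if "v \<in> ?QA" for v using fR[of v] fs[of v] that by (auto simp: sgn_if split: if_splits)
    have \<tau>x: "\<tau> (k' x) = x" using ft[OF yA] fy y(3) by simp
    have k'R: "k' x \<in> R3" using fR[OF yA] fy by simp
    have n: "side_rel (top_of_set R3) upper3 lower3 {k' x}
       (hom_induced 3 (top_of_set A) (A - {y}) (top_of_set R3) (R3 - {k' x}) f a)
       (hom_induced 2 (top_of_set (?PA \<inter> ?QA)) (?PA \<inter> ?QA - {y}) (top_of_set plane3) (plane3 - {k' x}) f (\<phi> a))"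
    proof -
      have 1: "?PA \<subseteq> topspace (top_of_set A)" "?QA \<subseteq> topspace (top_of_set A)"
        "upper3 \<subseteq> topspace (top_of_set R3)" "lower3 \<subseteq> topspace (top_of_set R3)" by auto
      have 2: "f ` ?PA \<subseteq> upper3" "f ` ?QA \<subseteq> lower3" using fP fQ by blast+
      have 3: "f ` (topspace (top_of_set A) - {y}) \<subseteq> topspace (top_of_set R3) - {k' x}"
        using fR fi fy by auto
      show ?thesis
        using side_rel_natural[OF f 1(1) 2(1) 1(3) 1(2) 2(2) 1(4) 3 rel] unfolding sA sR topspace_euclidean_subtopology .
    qed
    have 3: "hom_induced 3 (top_of_set R3) (R3 - {k' x}) M (topspace M - {x}) \<tau>
        (hom_induced 3 (top_of_set A) (A - {y}) (top_of_set R3) (R3 - {k' x}) f a) = \<mu> x"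
    proof -
      have i2: "\<tau> \<in> R3 - {k' x} \<rightarrow> topspace M - {x}"
      proof
        fix v assume v: "v \<in> R3 - {k' x}"
        then have "\<tau> v \<noteq> \<tau> (k' x)" using inj_on_eq_iff[OF \<tau>(3), of v "k' x"] k'R by simp
        moreover have "\<tau> v \<in> topspace M" using continuous_map_image_subset_topspace[OF \<tau>(1)] v by auto
        ultimately show "\<tau> v \<in> topspace M - {x}" using \<tau>x by simp
      qed
      have i1: "f \<in> A - {y} \<rightarrow> R3 - {k' x}" using fR fi fy by auto
      have "hom_induced 3 (top_of_set R3) (R3 - {k' x}) M (topspace M - {x}) \<tau>
        (hom_induced 3 (top_of_set A) (A - {y}) (top_of_set R3) (R3 - {k' x}) f a)
        = hom_induced 3 (top_of_set A) (A - {y}) M (topspace M - {x}) (\<tau> \<circ> f) a"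
        by (rule hom_induced_compose'[OF f i1 \<tau>(1) i2])
      also have "\<dots> = hom_induced 3 (top_of_set A) (A - {y}) M (topspace M - {x}) \<theta> a"
        by (intro fun_cong[OF hom_induced_eq]) (simp add: ft)
      finally show ?thesis using a by simp
    qed
    have 2: "hom_induced 2 (top_of_set plane3) (plane3 - {k' x}) (subtopology M S) (S - {x}) \<tau>
        (hom_induced 2 (top_of_set (?PA \<inter> ?QA)) (?PA \<inter> ?QA - {y}) (top_of_set plane3) (plane3 - {k' x}) f (\<phi> a))
      = hom_induced 2 (top_of_set (?PA \<inter> ?QA)) (?PA \<inter> ?QA - {y}) (subtopology M S) (S - {x}) \<theta> (\<phi> a)"
    proof -
      have c1: "continuous_map (top_of_set (?PA \<inter> ?QA)) (top_of_set plane3) f"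
      proof -
        have "continuous_map (subtopology (top_of_set A) (?PA \<inter> ?QA)) (subtopology (top_of_set R3) plane3) f"
          using f fP fQ by (auto simp: continuous_map_in_subtopology intro: continuous_map_from_subtopology)
        then show ?thesis unfolding sA sR .
      qed
      have c2: "continuous_map (top_of_set plane3) (subtopology M S) \<tau>"
      proof -
        have "continuous_map (subtopology (top_of_set R3) plane3) (subtopology M S) \<tau>"
          using \<tau> by (auto simp: continuous_map_in_subtopology intro: continuous_map_from_subtopology)
        then show ?thesis unfolding sR .
      qed
      have i2: "\<tau> \<in> plane3 - {k' x} \<rightarrow> S - {x}"
      proof
        fix v assume v: "v \<in> plane3 - {k' x}"
        then have "\<tau> v \<noteq> \<tau> (k' x)" using inj_on_eq_iff[OF \<tau>(3), of v "k' x"] k'R by simp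
        then show "\<tau> v \<in> S - {x}" using \<tau>(2) \<tau>x v by simp
      qed
      have i1: "f \<in> ?PA \<inter> ?QA - {y} \<rightarrow> plane3 - {k' x}"
      proof
        fix v assume v: "v \<in> ?PA \<inter> ?QA - {y}"
        then have "f v \<in> plane3" using fP[of v] fQ[of v] by simp
        moreover have "f v \<noteq> k' x" using fi[of v] fy v by auto
        ultimately show "f v \<in> plane3 - {k' x}" by simp
      qed
      have "hom_induced 2 (top_of_set plane3) (plane3 - {k' x}) (subtopology M S) (S - {x}) \<tau>
        (hom_induced 2 (top_of_set (?PA \<inter> ?QA)) (?PA \<inter> ?QA - {y}) (top_of_set plane3) (plane3 - {k' x}) f (\<phi> a))
        = hom_induced 2 (top_of_set (?PA \<inter> ?QA)) (?PA \<inter> ?QA - {y}) (subtopology M S) (S - {x}) (\<tau> \<circ> f) (\<phi> a)"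
        by (rule hom_induced_compose'[OF c1 i1 c2 i2])
      also have "\<dots> = hom_induced 2 (top_of_set (?PA \<inter> ?QA)) (?PA \<inter> ?QA - {y}) (subtopology M S) (S - {x}) \<theta> (\<phi> a)"
        by (intro fun_cong[OF hom_induced_eq]) (simp add: ft)
      finally show ?thesis .
    qed
    show ?thesis unfolding surface_class_def inv[symmetric] using n 3 2[symmetric] by blast
  qed
  have "surface_class U h x (hom_induced 2 (top_of_set (?PA \<inter> ?QA)) (?PA \<inter> ?QA - {y}) (subtopology M S) (S - {x}) \<theta> (\<phi> a))"
  proof (rule key[where f = id and \<tau> = \<theta>])
    show "inj_on \<theta> R3" by (rule inj_on_inverseI[OF t1(2)])
    show "continuous_map (top_of_set R3) M \<theta>" by (rule fh(3))
    show "continuous_map (top_of_set A) (top_of_set R3) id" using AR by auto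
  qed (use tS y_def \<theta>_def in auto)
  moreover have kT: "\<theta>' (k (\<theta> w)) = \<theta> w" if "w \<in> A" for w
    by (rule k1(2)) (use tA[OF that] T(3) in blast)
  moreover have "surface_class V k x (hom_induced 2 (top_of_set (?PA \<inter> ?QA)) (?PA \<inter> ?QA - {y}) (subtopology M S) (S - {x}) \<theta> (\<phi> a))"
  proof (rule key[where f = "k \<circ> \<theta>" and \<tau> = \<theta>'])
    show "inj_on \<theta>' R3" by (rule inj_on_inverseI[OF t2(2)])
    show "continuous_map (top_of_set R3) M \<theta>'" by (rule fk(3))
    have "continuous_map (top_of_set A) (subtopology M V) \<theta>"
    proof -
      have "continuous_map (subtopology (top_of_set R3) A) M \<theta>"
        by (rule continuous_map_from_subtopology[OF fh(3)])
      then show ?thesis using AR tA T(3) by (auto simp: continuous_map_in_subtopology subtopology_subtopology inf.absorb2)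
    qed
    then show "continuous_map (top_of_set A) (top_of_set R3) (k \<circ> \<theta>)" by (rule continuous_map_compose[OF _ fk(1)])
    show "sgn ((k \<circ> \<theta>) v 2) = sgn (v 2)" if "v \<in> A" for v
      using T(4)[OF tA[OF that]] t1(2) AR that by auto
    show "(k \<circ> \<theta>) y = k x" using y by simp
    show "\<theta>' ((k \<circ> \<theta>) v) = \<theta> v" if "v \<in> A" for v
      using kT[OF that] by simp
    show "v = y" if "v \<in> A" "(k \<circ> \<theta>) v = (k \<circ> \<theta>) y" for v
    proof -
      have "\<theta>' (k (\<theta> v)) = \<theta>' (k (\<theta> y))" using that(2) by simp
      then have "\<theta> v = \<theta> y" unfolding kT[OF that(1)] kT[OF yA] .
      then have "h (\<theta> v) = h (\<theta> y)" by simp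
      moreover have "h (\<theta> v) = v" by (rule t1(2)) (use that(1) AR in blast)
      moreover have "h (\<theta> y) = y" by (rule t1(2)[OF y(1)])
      ultimately show ?thesis by simp
    qed
  qed (use tS' \<theta>'_def in auto)
  ultimately show thesis using that by blast
qed

text \<open>The construction is carried out over a square \<open>K\<close> instead of a point. The
  resulting class restricts to the surface class at every point of \<open>W\<close>, since the side
  relation is natural under the shrinking of \<open>K\<close>.\<close>

lemma surface_class_local:
  assumes h: "flat_chart M S U h"
    and x: "x \<in> U \<inter> S" and U1: "openin M U1" "x \<in> U1"
    and \<mu>U: "\<mu>U \<in> carrier (relative_homology_group 3 M (topspace M - U1))"
    and \<mu>: "\<And>z. z \<in> U1 \<Longrightarrow> hom_induced 3 M (topspace M - U1) M (topspace M - {z}) id \<mu>U = \<mu> z"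
  obtains W \<nu> where "openin (subtopology M S) W" "x \<in> W" "W \<subseteq> U"
    "\<nu> \<in> carrier (relative_homology_group 2 (subtopology M S) (S - W))"
    "\<And>z. z \<in> W \<Longrightarrow> surface_class U h z (hom_induced 2 (subtopology M S) (S - W) (subtopology M S) (S - {z}) id \<nu>)"
proof -
  define \<theta> where "\<theta> = inv_into U h"
  note fh = flat_chart_inverse[OF h, folded \<theta>_def]
  note h1 = fh(6,7) and t1 = fh(8,9) and c\<theta> = fh(3) and hU = fh(2)
  have UM: "openin M U" "U \<subseteq> topspace M" using flat_chart_open[OF h] openin_subset by auto
  have tS: "\<theta> v \<in> S" if "v \<in> plane3" for v using fh(10)[of v] that by auto
  have hS: "h z 2 = 0" if "z \<in> U \<inter> S" for z using fh(11)[of z] that by auto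
  have inj: "inj_on \<theta> R3" by (rule inj_on_inverseI[OF t1(2)])
  define y where "y = h x"
  have y: "y \<in> R3" "y 2 = 0" "\<theta> y = x" using x h1 hS by (auto simp: y_def)
  have "openin (top_of_set R3) {v \<in> topspace (top_of_set R3). \<theta> v \<in> U1}"
    by (rule openin_continuous_map_preimage[OF c\<theta> U1(1)])
  then have "openin (Euclidean_space 3) {v \<in> R3. \<theta> v \<in> U1}" using Euclidean_space_eq_top_of_set[of 3] by simp
  moreover have "y \<in> {v \<in> R3. \<theta> v \<in> U1}" using y U1 by simp
  ultimately obtain \<epsilon> where e: "\<epsilon> > 0" "{v \<in> R3. \<forall>i<3. \<bar>v i - y i\<bar> < \<epsilon>} \<subseteq> {v \<in> R3. \<theta> v \<in> U1}"
    by (rule Euclidean_space_box_nhd)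
  \<comment> \<open>Half the radius keeps the closed square inside the box that maps into
    \<open>U1\<close>; \<open>W\<close> is the open part of its image in the surface.\<close>
  define K where "K = plane_square y (\<epsilon> / 2)"
  define W where "W = {z \<in> U \<inter> S. \<forall>i<2. \<bar>h z i - y i\<bar> < \<epsilon> / 2}"
  have KP: "K \<subseteq> plane3" by (auto simp: K_def plane_square_def)
  have KR: "K \<subseteq> R3" using KP by auto
  have KU1: "\<theta> ` K \<subseteq> U1"
  proof -
    have "\<forall>i<3. \<bar>v i - y i\<bar> < \<epsilon>" if "v \<in> K" for v
      using that e(1) y(2) by (auto simp: K_def plane_square_def numeral_3_eq_3 less_Suc_eq)
        (simp add: numeral_2_eq_2)
    then show ?thesis using e(2) KR by blast
  qed
  have hK: "h z \<in> K" if "z \<in> W" for z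
  proof -
    have z: "z \<in> U" "z \<in> S" "\<bar>h z 0 - y 0\<bar> < \<epsilon> / 2" "\<bar>h z 1 - y 1\<bar> < \<epsilon> / 2"
      using that by (simp_all add: W_def)
    then show ?thesis using h1(1)[OF z(1)] hS[of z] by (simp add: K_def plane_square_def)
  qed
  have KS: "\<theta> ` K \<subseteq> S" using KP tS by blast
  have oW: "openin (subtopology M S) W"
  proof -
    note ch = fh(1)
    have ci: "continuous_map (subtopology M U) euclideanreal (\<lambda>z. h z i)" for i
    proof -
      have "continuous_map (top_of_set R3) euclideanreal (\<lambda>v. v i)" by simp
      from continuous_map_compose[OF ch this] show ?thesis by (simp add: o_def)
    qed
    have "openin (subtopology M U) {z \<in> topspace (subtopology M U). h z i \<in> {y i - \<epsilon>/2<..<y i + \<epsilon>/2}}" for i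
      by (rule openin_continuous_map_preimage[OF ci]) auto
    from openin_Int[OF this[of 0] this[of 1]]
    have "openin M ({z \<in> topspace (subtopology M U). h z 0 \<in> {y 0 - \<epsilon>/2<..<y 0 + \<epsilon>/2}} \<inter>
       {z \<in> topspace (subtopology M U). h z 1 \<in> {y 1 - \<epsilon>/2<..<y 1 + \<epsilon>/2}})" (is "openin M ?G")
      by (rule openin_trans_full[OF _ UM(1)])
    then have "openin (subtopology M S) (?G \<inter> S)" by (simp add: openin_subtopology_Int)
    also have "?G \<inter> S = W"
    proof -
      have two: "(\<forall>i<2. P i) \<longleftrightarrow> P 0 \<and> P 1" for P :: "nat \<Rightarrow> bool"
        by (auto simp: numeral_2_eq_2 less_Suc_eq)
      have tU: "topspace (subtopology M U) = U" using UM(2) by auto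
      have ab: "\<bar>a - b\<bar> < e \<longleftrightarrow> a \<in> {b - e<..<b + e}" for a b e :: real
        by (auto simp: abs_less_iff)
      show ?thesis unfolding W_def two tU ab by blast
    qed
    finally show ?thesis .
  qed
  have xW: "x \<in> W" using x e(1) by (simp add: W_def y_def)
  have cK: "compactin (top_of_set R3) K"
    using compactin_plane_square[of y "\<epsilon>/2"] by (simp add: K_def flip: Euclidean_space_eq_top_of_set)
  obtain \<phi> where p: "\<And>a b. side_rel (top_of_set R3) upper3 lower3 K a b \<longleftrightarrow>
       a \<in> carrier (relative_homology_group 3 (top_of_set R3) (R3 - K)) \<and> b = \<phi> a"
  proof (rule model_R3[OF y(1,2), of "\<epsilon>/2", folded K_def])
    show "0 \<le> \<epsilon> / 2" using e(1) by simp
  qed (rule that)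
  \<comment> \<open>The local orientation restricted to the compact image of \<open>K\<close>, where
    it can be pulled back through the chart.\<close>
  define a1 where "a1 = hom_induced 3 M (topspace M - U1) M (topspace M - \<theta> ` K) id \<mu>U"
  have "a1 \<in> carrier (relative_homology_group 3 M (topspace M - \<theta> ` K))"
    unfolding a1_def by (rule hom_induced_carrier)
  then have "a1 \<in> hom_induced 3 (top_of_set R3) (R3 - K) M (topspace M - \<theta> ` K) \<theta> ` carrier (relative_homology_group 3 (top_of_set R3) (R3 - K))"
    using open_embedding_local_homology_iso[OF M UM(1) hU cK, of 3] by (simp add: iso_def bij_betw_def)
  then obtain a where a: "a \<in> carrier (relative_homology_group 3 (top_of_set R3) (R3 - K))"
    "hom_induced 3 (top_of_set R3) (R3 - K) M (topspace M - \<theta> ` K) \<theta> a = a1"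
    by auto
  have rel: "side_rel (top_of_set R3) upper3 lower3 K a (\<phi> a)" using a p by blast
  define \<nu> where "\<nu> = hom_induced 2 (top_of_set plane3) (plane3 - K) (subtopology M S) (S - W) \<theta> (\<phi> a)"
  note cP = fh(5)
  have "surface_class U h z (hom_induced 2 (subtopology M S) (S - W) (subtopology M S) (S - {z}) id \<nu>)" if z: "z \<in> W" for z
  proof -
    have zU: "z \<in> U" using z by (auto simp: W_def)
    have hz: "h z \<in> K" "h z \<in> R3" "\<theta> (h z) = z" using hK[OF z] h1 zU by auto
    have zU1: "z \<in> U1" using hz KU1 by force
    have id1: "continuous_map (top_of_set R3) (top_of_set R3) id" by auto
    have id2: "continuous_map (top_of_set plane3) (top_of_set plane3) id" by auto
    have i1: "id \<in> R3 - K \<rightarrow> R3 - {h z}" using hz by auto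
    have i2: "\<theta> \<in> R3 - {h z} \<rightarrow> topspace M - {z}"
    proof
      fix v assume v: "v \<in> R3 - {h z}"
      then have "\<theta> v \<noteq> z" using t1(2)[of v] by auto
      moreover have "\<theta> v \<in> topspace M" using t1(1)[of v] UM v by auto
      ultimately show "\<theta> v \<in> topspace M - {z}" by simp
    qed
    have i3: "\<theta> \<in> R3 - K \<rightarrow> topspace M - \<theta> ` K"
    proof
      fix v assume v: "v \<in> R3 - K"
      then have "\<theta> v \<notin> \<theta> ` K" using inj_on_image_mem_iff[OF inj _ KR, of v] by simp
      moreover have "\<theta> v \<in> topspace M" using t1(1)[of v] UM v by auto
      ultimately show "\<theta> v \<in> topspace M - \<theta> ` K" by simp
    qed
    have "z \<in> \<theta> ` K" using hz(1,3) by (metis imageI)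
    then have i4: "id \<in> topspace M - \<theta> ` K \<rightarrow> topspace M - {z}" by auto
    have i5: "id \<in> topspace M - U1 \<rightarrow> topspace M - \<theta> ` K" using KU1 by auto
    have i6: "id \<in> plane3 - K \<rightarrow> plane3 - {h z}" using hz by auto
    have i7: "\<theta> \<in> plane3 - {h z} \<rightarrow> S - {z}"
    proof
      fix v assume v: "v \<in> plane3 - {h z}"
      then have "\<theta> v \<noteq> z" using t1(2)[of v] by auto
      moreover have "\<theta> v \<in> S" using tS v by simp
      ultimately show "\<theta> v \<in> S - {z}" by simp
    qed
    have i8: "\<theta> \<in> plane3 - K \<rightarrow> S - W"
    proof
      fix v assume v: "v \<in> plane3 - K"
      have "\<theta> v \<notin> W" using hK[of "\<theta> v"] t1(2)[of v] v by auto
      then show "\<theta> v \<in> S - W" using v tS by auto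
    qed
    have i9: "id \<in> S - W \<rightarrow> S - {z}" using z by auto
    have r: "side_rel (top_of_set R3) upper3 lower3 {h z}
     (hom_induced 3 (top_of_set R3) (R3 - K) (top_of_set R3) (R3 - {h z}) id a)
     (hom_induced 2 (top_of_set plane3) (plane3 - K) (top_of_set plane3) (plane3 - {h z}) id (\<phi> a))"
      by (rule side_rel_inclusion[OF _ rel]) (use hz in auto)
    have "hom_induced 3 (top_of_set R3) (R3 - {h z}) M (topspace M - {z}) \<theta>
        (hom_induced 3 (top_of_set R3) (R3 - K) (top_of_set R3) (R3 - {h z}) id a)
      = hom_induced 3 (top_of_set R3) (R3 - K) M (topspace M - {z}) (\<theta> \<circ> id) a"
      by (rule hom_induced_compose'[OF id1 i1 c\<theta> i2])
    also have "\<dots> = hom_induced 3 (top_of_set R3) (R3 - K) M (topspace M - {z}) (id \<circ> \<theta>) a" by simp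
    also have "\<dots> = hom_induced 3 M (topspace M - \<theta> ` K) M (topspace M - {z}) id a1"
      unfolding a(2)[symmetric] by (rule hom_induced_compose'[OF c\<theta> i3 continuous_map_id i4, symmetric])
    also have "\<dots> = hom_induced 3 M (topspace M - U1) M (topspace M - {z}) (id \<circ> id) \<mu>U"
      unfolding a1_def by (rule hom_induced_compose'[OF continuous_map_id i5 continuous_map_id i4])
    also have "\<dots> = \<mu> z" using \<mu>[OF zU1] by simp
    finally have e3: "hom_induced 3 (top_of_set R3) (R3 - {h z}) M (topspace M - {z}) \<theta>
        (hom_induced 3 (top_of_set R3) (R3 - K) (top_of_set R3) (R3 - {h z}) id a) = \<mu> z" .
    have "hom_induced 2 (top_of_set plane3) (plane3 - {h z}) (subtopology M S) (S - {z}) \<theta>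
        (hom_induced 2 (top_of_set plane3) (plane3 - K) (top_of_set plane3) (plane3 - {h z}) id (\<phi> a))
      = hom_induced 2 (top_of_set plane3) (plane3 - K) (subtopology M S) (S - {z}) (\<theta> \<circ> id) (\<phi> a)"
      by (rule hom_induced_compose'[OF id2 i6 cP i7])
    also have "\<dots> = hom_induced 2 (top_of_set plane3) (plane3 - K) (subtopology M S) (S - {z}) (id \<circ> \<theta>) (\<phi> a)" by simp
    also have "\<dots> = hom_induced 2 (subtopology M S) (S - W) (subtopology M S) (S - {z}) id \<nu>"
      unfolding \<nu>_def by (rule hom_induced_compose'[OF cP i8 continuous_map_id i9, symmetric])
    finally show ?thesis unfolding surface_class_def \<theta>_def[symmetric] using r e3 by metis
  qed
  moreover have "\<nu> \<in> carrier (relative_homology_group 2 (subtopology M S) (S - W))"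
    unfolding \<nu>_def by (rule hom_induced_carrier)
  moreover have "W \<subseteq> U" by (auto simp: W_def)
  ultimately show thesis using that oW xW by blast
qed

end

text \<open>Charts with matching sides induce the same surface class at a point, so the classes read
  off in arbitrarily chosen charts \<open>p x\<close> form a local orientation. Near a given point
  they may all be computed in one chart, where \<open>surface_class_local\<close> provides
  consistency.\<close>

lemma two_sided_imp_orientable:
  assumes M: "Hausdorff_space M" and ori: "orientable 3 M" and S: "S \<subseteq> topspace M"
    and \<C>: "\<And>U h. (U, h) \<in> \<C> \<Longrightarrow> flat_chart M S U h"
    and cover: "\<And>x. x \<in> S \<Longrightarrow> \<exists>U h. (U, h) \<in> \<C> \<and> x \<in> U"
    and sides: "\<And>U h V k x. \<lbrakk>(U, h) \<in> \<C>; (V, k) \<in> \<C>; x \<in> U \<inter> V \<inter> S\<rbrakk> \<Longrightarrow>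
      \<exists>T. openin M T \<and> x \<in> T \<and> T \<subseteq> U \<inter> V \<and> (\<forall>y\<in>T. sgn (h y 2) = sgn (k y 2))"
  shows "orientable 2 (subtopology M S)"
proof -
  obtain \<mu> where m: "\<forall>x\<in>topspace M. group_generator (relative_homology_group 3 M (topspace M - {x})) (\<mu> x)"
    "\<forall>x\<in>topspace M. \<exists>U \<mu>U. openin M U \<and> x \<in> U \<and>
             \<mu>U \<in> carrier (relative_homology_group 3 M (topspace M - U)) \<and>
             (\<forall>y\<in>U. hom_induced 3 M (topspace M - U) M (topspace M - {y}) id \<mu>U = \<mu> y)"
    using ori unfolding orientable_def of_nat_numeral by (elim exE conjE) (rule that)
  note \<mu> = bspec[OF m(1)] and \<mu>U = bspec[OF m(2)]
  interpret subset_of_Hausdorff M S \<mu> using M S by unfold_locales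
  have "\<exists>p. \<forall>x\<in>S. p x \<in> \<C> \<and> x \<in> fst (p x)" using cover by (intro bchoice) fastforce
  then obtain p where p: "\<And>x. x \<in> S \<Longrightarrow> p x \<in> \<C>" "\<And>x. x \<in> S \<Longrightarrow> x \<in> fst (p x)" by blast
  have "\<exists>\<nu>. \<forall>x\<in>S. surface_class (fst (p x)) (snd (p x)) x (\<nu> x) \<and>
     group_generator (relative_homology_group 2 (subtopology M S) (S - {x})) (\<nu> x)"
  proof (intro bchoice ballI)
    fix x assume x: "x \<in> S"
    have "flat_chart M S (fst (p x)) (snd (p x))" using \<C> p(1)[OF x] by (cases "p x") auto
    from surface_class_generator[OF this, of x] x p(2)[OF x] \<mu>[of x] S
    show "\<exists>b. surface_class (fst (p x)) (snd (p x)) x b \<and> group_generator (relative_homology_group 2 (subtopology M S) (S - {x})) b"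
      by blast
  qed
  then obtain \<nu> where \<nu>: "\<And>x. x \<in> S \<Longrightarrow> surface_class (fst (p x)) (snd (p x)) x (\<nu> x)"
    "\<And>x. x \<in> S \<Longrightarrow> group_generator (relative_homology_group 2 (subtopology M S) (S - {x})) (\<nu> x)" by blast
  have eq: "b = \<nu> x" if Uh: "(U, h) \<in> \<C>" and x: "x \<in> U \<inter> S" and b: "surface_class U h x b" for U h x b
  proof -
    let ?V = "fst (p x)" and ?k = "snd (p x)"
    have Vk: "(?V, ?k) \<in> \<C>" and xV: "x \<in> U \<inter> ?V \<inter> S" using p x by auto
    obtain T where T: "openin M T" "x \<in> T" "T \<subseteq> U \<inter> ?V" "\<And>y. y \<in> T \<Longrightarrow> sgn (h y 2) = sgn (?k y 2)"
      using sides[OF Uh Vk xV] by blast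
    have "\<mu> x \<in> carrier (relative_homology_group 3 M (topspace M - {x}))"
      using \<mu>[of x] x S by (auto simp: group_generator_def)
    then obtain b' where b': "surface_class U h x b'" "surface_class ?V ?k x b'"
      using surface_class_transition[OF \<C>[OF Uh] \<C>[OF Vk] xV _ T] by blast
    have "b = b'" using surface_class_unique[OF \<C>[OF Uh] x b b'(1)] .
    moreover have "b' = \<nu> x"
      by (rule surface_class_unique[OF \<C>[OF Vk] _ b'(2) \<nu>(1)]) (use xV in auto)
    ultimately show ?thesis by simp
  qed
  have tS: "topspace (subtopology M S) = S" using S by auto
  have "\<exists>W \<nu>W. openin (subtopology M S) W \<and> x \<in> W \<and>
      \<nu>W \<in> carrier (relative_homology_group 2 (subtopology M S) (S - W)) \<and>
      (\<forall>y\<in>W. hom_induced 2 (subtopology M S) (S - W) (subtopology M S) (S - {y}) id \<nu>W = \<nu> y)" if x: "x \<in> S" for x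
  proof -
    obtain U h where Uh: "(U, h) \<in> \<C>" and xU: "x \<in> U \<inter> S" using cover[OF x] x by blast
    obtain U1 \<mu>1 where U1: "openin M U1" "x \<in> U1" "\<mu>1 \<in> carrier (relative_homology_group 3 M (topspace M - U1))"
      "\<And>y. y \<in> U1 \<Longrightarrow> hom_induced 3 M (topspace M - U1) M (topspace M - {y}) id \<mu>1 = \<mu> y"
      using \<mu>U[of x] x S by blast
    obtain W \<nu>W where W: "openin (subtopology M S) W" "x \<in> W" "W \<subseteq> U"
      "\<nu>W \<in> carrier (relative_homology_group 2 (subtopology M S) (S - W))"
      "\<And>z. z \<in> W \<Longrightarrow> surface_class U h z (hom_induced 2 (subtopology M S) (S - W) (subtopology M S) (S - {z}) id \<nu>W)"
      using surface_class_local[OF \<C>[OF Uh] xU U1] by blast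
    have "W \<subseteq> S" using openin_subset[OF W(1)] tS by simp
    then have "hom_induced 2 (subtopology M S) (S - W) (subtopology M S) (S - {y}) id \<nu>W = \<nu> y" if "y \<in> W" for y
      using eq[OF Uh _ W(5)[OF that]] W(3) that by auto
    with W show ?thesis by blast
  qed
  then show ?thesis unfolding orientable_def tS of_nat_numeral using \<nu>(2) by (intro exI[of _ \<nu>] conjI ballI) simp_all
qed

section \<open>Potentials of 1-cocycles and the first Betti number\<close>

definition locally_constant :: "'a topology \<Rightarrow> ('a \<Rightarrow> 'b) \<Rightarrow> bool" where
  "locally_constant X f \<longleftrightarrow> (\<forall>x\<in>topspace X. \<exists>T. openin X T \<and> x \<in> T \<and> (\<forall>y\<in>T. f y = f x))"

lemma locally_constant_imp_constant:
  assumes X: "connected_space X" and f: "locally_constant X f" and xy: "x \<in> topspace X" "y \<in> topspace X"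
  shows "f x = f y"
proof (rule ccontr)
  assume ne: "f x \<noteq> f y"
  have op: "openin X {z \<in> topspace X. Q (f z)}" for Q
  proof (subst openin_subopen, intro ballI)
    fix z assume z: "z \<in> {z \<in> topspace X. Q (f z)}"
    then obtain T where T: "openin X T" "z \<in> T" "\<forall>y\<in>T. f y = f z"
      using f unfolding locally_constant_def by blast
    moreover have "T \<subseteq> {z \<in> topspace X. Q (f z)}"
    proof
      fix w assume w: "w \<in> T"
      then have "f w = f z" using T(3) by blast
      then show "w \<in> {z \<in> topspace X. Q (f z)}" using z w openin_subset[OF T(1)] by auto
    qed
    ultimately show "\<exists>T. openin X T \<and> z \<in> T \<and> T \<subseteq> {z \<in> topspace X. Q (f z)}" by blast
  qed
  have "\<exists>E1 E2. openin X E1 \<and> openin X E2 \<and> topspace X \<subseteq> E1 \<union> E2 \<and> E1 \<inter> E2 = {} \<and> E1 \<noteq> {} \<and> E2 \<noteq> {}"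
  proof (intro exI conjI)
    show "openin X {z \<in> topspace X. f z = f x}" "openin X {z \<in> topspace X. f z \<noteq> f x}"
      by (rule op)+
    show "{z \<in> topspace X. f z = f x} \<noteq> {}" using xy(1) by blast
    show "{z \<in> topspace X. f z \<noteq> f x} \<noteq> {}" using xy(2) ne[symmetric] by blast
  qed blast+
  with X show False unfolding connected_space_def by contradiction
qed

text \<open>An atlas of potentials is a \<open>1\<close>-cocycle presented by local primitives: the functions
  \<open>F\<close> need not be continuous, but on overlaps they differ by locally constant functions.\<close>
definition potential_atlas :: "'a topology \<Rightarrow> ('a set \<times> ('a \<Rightarrow> real)) set \<Rightarrow> bool" where
  "potential_atlas Y \<P> \<longleftrightarrow> (\<forall>U F. (U,F) \<in> \<P> \<longrightarrow> openin Y U) \<and> (\<forall>x\<in>topspace Y. \<exists>U F. (U,F) \<in> \<P> \<and> x \<in> U) \<and>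
     (\<forall>U F V H x. (U,F) \<in> \<P> \<longrightarrow> (V,H) \<in> \<P> \<longrightarrow> x \<in> U \<longrightarrow> x \<in> V \<longrightarrow>
        (\<exists>T. openin Y T \<and> x \<in> T \<and> T \<subseteq> U \<inter> V \<and> (\<forall>y\<in>T. F y - H y = F x - H x)))"

text \<open>\<open>G\<close> is a global primitive of the cocycle pulled back along \<open>\<kappa>\<close>.\<close>
definition is_potential ::
  "('a set \<times> ('a \<Rightarrow> real)) set \<Rightarrow> 'c topology \<Rightarrow> ('c \<Rightarrow> 'a) \<Rightarrow> ('c \<Rightarrow> real) \<Rightarrow> bool" where
  "is_potential \<P> Z \<kappa> G \<longleftrightarrow> (\<forall>z\<in>topspace Z. \<exists>U F T. (U,F) \<in> \<P> \<and> openin Z T \<and> z \<in> T \<and> \<kappa> ` T \<subseteq> U \<and>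
     (\<forall>w\<in>T. F (\<kappa> w) - G w = F (\<kappa> z) - G z))"

lemma is_potentialI:
  assumes "\<And>z. z \<in> topspace Z \<Longrightarrow> \<exists>U F T. (U,F) \<in> \<P> \<and> openin Z T \<and> z \<in> T \<and> \<kappa> ` T \<subseteq> U \<and>
     (\<forall>w\<in>T. F (\<kappa> w) - G w = F (\<kappa> z) - G z)"
  shows "is_potential \<P> Z \<kappa> G"
  unfolding is_potential_def by (rule ballI, rule assms)

lemma is_potentialD:
  assumes "is_potential \<P> Z \<kappa> G" "z \<in> topspace Z"
  obtains U F T where "(U,F) \<in> \<P>" "openin Z T" "z \<in> T" "\<kappa> ` T \<subseteq> U"
    "\<And>w. w \<in> T \<Longrightarrow> F (\<kappa> w) - G w = F (\<kappa> z) - G z"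
proof -
  from bspec[OF assms(1)[unfolded is_potential_def] assms(2)]
  show thesis by (elim exE conjE) (rule that, assumption+, erule bspec)
qed

lemma potential_atlasD:
  assumes "potential_atlas Y \<P>"
  shows "\<And>U F. (U,F) \<in> \<P> \<Longrightarrow> openin Y U"
    and "\<And>x. x \<in> topspace Y \<Longrightarrow> \<exists>U F. (U,F) \<in> \<P> \<and> x \<in> U"
    and "\<And>U F V H x. \<lbrakk>(U,F) \<in> \<P>; (V,H) \<in> \<P>; x \<in> U; x \<in> V\<rbrakk> \<Longrightarrow>
       \<exists>T. openin Y T \<and> x \<in> T \<and> T \<subseteq> U \<inter> V \<and> (\<forall>y\<in>T. F y - H y = F x - H x)"
proof -
  note A = assms[unfolded potential_atlas_def]
  show "\<And>U F. (U,F) \<in> \<P> \<Longrightarrow> openin Y U" using A[THEN conjunct1] by blast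
  show "\<And>x. x \<in> topspace Y \<Longrightarrow> \<exists>U F. (U,F) \<in> \<P> \<and> x \<in> U" using A[THEN conjunct2, THEN conjunct1] by blast
  show "\<And>U F V H x. \<lbrakk>(U,F) \<in> \<P>; (V,H) \<in> \<P>; x \<in> U; x \<in> V\<rbrakk> \<Longrightarrow>
       \<exists>T. openin Y T \<and> x \<in> T \<and> T \<subseteq> U \<inter> V \<and> (\<forall>y\<in>T. F y - H y = F x - H x)"
    using A[THEN conjunct2, THEN conjunct2] by simp
qed

text \<open>The chart witnessing the definition may be an unsuitable one. On overlaps charts differ
  by locally constant functions, so every chart around the point does as well.\<close>

lemma is_potential_any_chart:
  assumes \<P>: "potential_atlas Y \<P>" and \<kappa>: "continuous_map Z Y \<kappa>" and G: "is_potential \<P> Z \<kappa> G"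
    and z: "z \<in> topspace Z" and UF: "(U,F) \<in> \<P>" "\<kappa> z \<in> U"
  obtains T where "openin Z T" "z \<in> T" "\<kappa> ` T \<subseteq> U" "\<And>w. w \<in> T \<Longrightarrow> F (\<kappa> w) - G w = F (\<kappa> z) - G z"
proof -
  obtain V H T where T: "(V,H) \<in> \<P>" "openin Z T" "z \<in> T" "\<kappa> ` T \<subseteq> V"
    "\<And>w. w \<in> T \<Longrightarrow> H (\<kappa> w) - G w = H (\<kappa> z) - G z" by (rule is_potentialD[OF G z]) (rule that)
  have "\<kappa> z \<in> V" using T by blast
  then obtain W where W: "openin Y W" "\<kappa> z \<in> W" "W \<subseteq> U \<inter> V" "\<forall>y\<in>W. F y - H y = F (\<kappa> z) - H (\<kappa> z)"
    using potential_atlasD(3)[OF \<P> UF(1) T(1) UF(2)] by blast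
  let ?T = "T \<inter> {w \<in> topspace Z. \<kappa> w \<in> W}"
  show thesis
  proof (rule that[of ?T])
    show "openin Z ?T" using T(2) openin_continuous_map_preimage[OF \<kappa> W(1)] by (rule openin_Int)
    show "z \<in> ?T" using T(3) z W(2) by simp
    show "\<kappa> ` ?T \<subseteq> U" using W(3) by auto
    fix w assume w: "w \<in> ?T"
    then have "F (\<kappa> w) - H (\<kappa> w) = F (\<kappa> z) - H (\<kappa> z)" using W(4) by simp
    moreover have "H (\<kappa> w) - G w = H (\<kappa> z) - G z" using T(5) w by simp
    ultimately show "F (\<kappa> w) - G w = F (\<kappa> z) - G z" by linarith
  qed
qed

text \<open>Both primitives are compared with the same chart. On connected sets this gives
  uniqueness up to a constant.\<close>

lemma is_potential_diff_locally_constant: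
  assumes \<P>: "potential_atlas Y \<P>" and \<kappa>: "continuous_map Z Y \<kappa>"
    and G: "is_potential \<P> Z \<kappa> G" and H: "is_potential \<P> Z \<kappa> H"
  shows "locally_constant Z (\<lambda>z. G z - H z)"
  unfolding locally_constant_def
proof
  fix z assume z: "z \<in> topspace Z"
  obtain U F T where T: "(U,F) \<in> \<P>" "openin Z T" "z \<in> T" "\<kappa> ` T \<subseteq> U"
    "\<And>w. w \<in> T \<Longrightarrow> F (\<kappa> w) - G w = F (\<kappa> z) - G z" by (rule is_potentialD[OF G z]) (rule that)
  have "\<kappa> z \<in> U" using T by blast
  from is_potential_any_chart[OF \<P> \<kappa> H z T(1) this]
  obtain T' where T': "openin Z T'" "z \<in> T'" "\<And>w. w \<in> T' \<Longrightarrow> F (\<kappa> w) - H w = F (\<kappa> z) - H z" by metis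
  show "\<exists>T. openin Z T \<and> z \<in> T \<and> (\<forall>y\<in>T. G y - H y = G z - H z)"
  proof (intro exI conjI ballI)
    show "openin Z (T \<inter> T')" using T(2) T'(1) by (rule openin_Int)
    show "z \<in> T \<inter> T'" using T(3) T'(2) by simp
    fix w assume "w \<in> T \<inter> T'"
    then show "G w - H w = G z - H z" using T(5)[of w] T'(3)[of w] by simp
  qed
qed

lemma is_potential_compose:
  assumes G: "is_potential \<P> Z \<kappa> G" and \<theta>: "continuous_map Z' Z \<theta>"
    and eq: "\<And>z. z \<in> topspace Z' \<Longrightarrow> \<kappa> (\<theta> z) = \<kappa>' z" "\<And>z. z \<in> topspace Z' \<Longrightarrow> G (\<theta> z) = G' z"
  shows "is_potential \<P> Z' \<kappa>' G'"
proof (rule is_potentialI)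
  fix z assume z: "z \<in> topspace Z'"
  have "\<theta> z \<in> topspace Z" using \<theta> z by (auto simp: continuous_map_def)
  from is_potentialD[OF G this]
  obtain U F T where T: "(U,F) \<in> \<P>" "openin Z T" "\<theta> z \<in> T" "\<kappa> ` T \<subseteq> U"
    "\<And>w. w \<in> T \<Longrightarrow> F (\<kappa> w) - G w = F (\<kappa> (\<theta> z)) - G (\<theta> z)" by metis
  let ?T = "{w \<in> topspace Z'. \<theta> w \<in> T}"
  show "\<exists>U F T. (U,F) \<in> \<P> \<and> openin Z' T \<and> z \<in> T \<and> \<kappa>' ` T \<subseteq> U \<and>
     (\<forall>w\<in>T. F (\<kappa>' w) - G' w = F (\<kappa>' z) - G' z)"
  proof (intro exI conjI ballI)
    show "(U,F) \<in> \<P>" by (rule T(1))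
    show "openin Z' ?T" by (rule openin_continuous_map_preimage[OF \<theta> T(2)])
    show "z \<in> ?T" using T(3) z by simp
    show "\<kappa>' ` ?T \<subseteq> U"
    proof
      fix u assume "u \<in> \<kappa>' ` ?T"
      then obtain w where w: "u = \<kappa>' w" "w \<in> topspace Z'" "\<theta> w \<in> T" by blast
      then show "u \<in> U" using T(4) eq(1)[OF w(2)] by auto
    qed
    fix w assume w: "w \<in> ?T"
    then show "F (\<kappa>' w) - G' w = F (\<kappa>' z) - G' z"
      using T(5)[of "\<theta> w"] z eq(1)[of w] eq(1)[of z] eq(2)[of w] eq(2)[of z] by simp
  qed
qed

lemma is_potential_in_chart:
  assumes "(U,F) \<in> \<P>" "\<kappa> ` topspace Z \<subseteq> U"
  shows "is_potential \<P> Z \<kappa> (F \<circ> \<kappa>)"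
proof (rule is_potentialI)
  fix z assume "z \<in> topspace Z"
  then show "\<exists>U' F' T. (U',F') \<in> \<P> \<and> openin Z T \<and> z \<in> T \<and> \<kappa> ` T \<subseteq> U' \<and>
     (\<forall>w\<in>T. F' (\<kappa> w) - (F \<circ> \<kappa>) w = F' (\<kappa> z) - (F \<circ> \<kappa>) z)"
    using assms by (intro exI[of _ U] exI[of _ F] exI[of _ "topspace Z"]) simp
qed

lemma is_potential_shift: "is_potential \<P> Z \<kappa> G \<Longrightarrow> is_potential \<P> Z \<kappa> (\<lambda>z. G z + c)"
  unfolding is_potential_def by simp

text \<open>On the connected overlap the primitives differ by a constant, which is absorbed into one
  of them. Closed pieces work because a point outside a piece has a neighbourhood that misses
  it.\<close>

lemma potential_glue:
  fixes \<kappa> :: "'c::topological_space \<Rightarrow> 'a"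
  assumes \<P>: "potential_atlas Y \<P>" and \<kappa>: "continuous_map euclidean Y \<kappa>"
    and AB: "closed A" "closed B" "connected (A \<inter> B)" "A \<inter> B \<noteq> {}"
    and GA: "is_potential \<P> (top_of_set A) \<kappa> GA" and GB: "is_potential \<P> (top_of_set B) \<kappa> GB"
  shows "\<exists>G. is_potential \<P> (top_of_set (A \<union> B)) \<kappa> G"
proof -
  obtain p where p: "p \<in> A" "p \<in> B" using AB by blast
  define c where "c = GA p - GB p"
  define H where "H z = GB z + c" for z
  have H: "is_potential \<P> (top_of_set B) \<kappa> H" unfolding H_def by (rule is_potential_shift[OF GB])
  have \<kappa>': "continuous_map (top_of_set D) Y \<kappa>" for D using \<kappa> by (rule continuous_map_from_subtopology)
  have inc: "continuous_map (top_of_set (A \<inter> B)) (top_of_set A) id" "continuous_map (top_of_set (A \<inter> B)) (top_of_set B) id" by auto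
  have lc: "locally_constant (top_of_set (A \<inter> B)) (\<lambda>z. GA z - H z)"
    by (rule is_potential_diff_locally_constant[OF \<P> \<kappa>' is_potential_compose[OF GA inc(1)] is_potential_compose[OF H inc(2)]]) simp_all
  have eq: "GA z = H z" if "z \<in> A \<inter> B" for z
  proof -
    have "connected_space (top_of_set (A \<inter> B))"
      using AB(3) by (simp add: connectedin_def flip: connectedin_iff_connected)
    from locally_constant_imp_constant[OF this lc, of z p] that p
    show ?thesis by (simp add: H_def c_def)
  qed
  define G where "G z = (if z \<in> A then GA z else H z)" for z
  have GA': "G z = GA z" if "z \<in> A" for z using that by (simp add: G_def)
  have GH': "G z = H z" if "z \<in> B" for z using that eq by (simp add: G_def)
  have "is_potential \<P> (top_of_set (A \<union> B)) \<kappa> G"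
  proof (rule is_potentialI)
    fix z assume "z \<in> topspace (top_of_set (A \<union> B))"
    then have z: "z \<in> A \<union> B" by simp
    have "\<kappa> z \<in> topspace Y" using \<kappa> by (auto simp: continuous_map_def)
    then obtain U F where UF: "(U,F) \<in> \<P>" "\<kappa> z \<in> U" using potential_atlasD(2)[OF \<P>] by blast
    have loc: "\<exists>T. open T \<and> z \<in> T \<and> (\<forall>w\<in>T \<inter> D. \<kappa> w \<in> U \<and> F (\<kappa> w) - g w = F (\<kappa> z) - g z)"
      if D: "closed D" and g: "is_potential \<P> (top_of_set D) \<kappa> g" for D g
    proof (cases "z \<in> D")
      case True
      then obtain T where T: "openin (top_of_set D) T" "z \<in> T" "\<kappa> ` T \<subseteq> U" "\<And>w. w \<in> T \<Longrightarrow> F (\<kappa> w) - g w = F (\<kappa> z) - g z"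
        using is_potential_any_chart[OF \<P> \<kappa>' g _ UF] by (metis topspace_euclidean_subtopology)
      then obtain O' where "open O'" "T = D \<inter> O'" unfolding openin_open by blast
      then show ?thesis using T(2,3,4) by (intro exI[of _ O'] conjI ballI) blast+
    next
      case False
      then show ?thesis using D by (intro exI[of _ "- D"]) auto
    qed
    obtain T1 where T1: "open T1" "z \<in> T1" "\<And>w. w \<in> T1 \<inter> A \<Longrightarrow> \<kappa> w \<in> U \<and> F (\<kappa> w) - GA w = F (\<kappa> z) - GA z"
      using loc[OF AB(1) GA] by blast
    obtain T2 where T2: "open T2" "z \<in> T2" "\<And>w. w \<in> T2 \<inter> B \<Longrightarrow> \<kappa> w \<in> U \<and> F (\<kappa> w) - H w = F (\<kappa> z) - H z"
      using loc[OF AB(2) H] by blast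
    \<comment> \<open>Removing each piece that does not contain \<open>z\<close> ensures that points
      of \<open>O'\<close> lie only in pieces containing \<open>z\<close>.\<close>
    define O' where "O' = T1 \<inter> T2 \<inter> (if z \<in> A then UNIV else - A) \<inter> (if z \<in> B then UNIV else - B)"
    have O': "open O'" "z \<in> O'" using T1(1,2) T2(1,2) AB(1,2) by (auto simp: O'_def intro!: open_Int)
    have "\<kappa> w \<in> U \<and> F (\<kappa> w) - G w = F (\<kappa> z) - G z" if w: "w \<in> (A \<union> B) \<inter> O'" for w
    proof (cases "w \<in> A")
      case True
      then have "z \<in> A" using w by (auto simp: O'_def split: if_splits)
      then show ?thesis using T1(3)[of w] w True GA' by (auto simp: O'_def)
    next
      case False
      then have "w \<in> B" using w by blast
      then have "z \<in> B" using w by (auto simp: O'_def split: if_splits)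
      then show ?thesis using T2(3)[of w] w \<open>w \<in> B\<close> GH' by (auto simp: O'_def)
    qed
    note cond = this
    show "\<exists>U F T. (U,F) \<in> \<P> \<and> openin (top_of_set (A \<union> B)) T \<and> z \<in> T \<and> \<kappa> ` T \<subseteq> U \<and>
     (\<forall>w\<in>T. F (\<kappa> w) - G w = F (\<kappa> z) - G z)"
    proof (intro exI conjI ballI)
      show "(U,F) \<in> \<P>" by (rule UF(1))
      show "openin (top_of_set (A \<union> B)) ((A \<union> B) \<inter> O')" using O'(1) by (auto simp: openin_open)
      show "z \<in> (A \<union> B) \<inter> O'" using z O'(2) by simp
      show "\<kappa> ` ((A \<union> B) \<inter> O') \<subseteq> U" using cond by blast
      fix w assume "w \<in> (A \<union> B) \<inter> O'"
      then show "F (\<kappa> w) - G w = F (\<kappa> z) - G z" using cond by blast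
    qed
  qed
  then show ?thesis by blast
qed

lemma potential_mono:
  assumes "is_potential \<P> (top_of_set A) \<kappa> G" "B \<subseteq> A"
  shows "is_potential \<P> (top_of_set B) \<kappa> G"
proof -
  have "continuous_map (top_of_set B) (top_of_set A) id" using assms(2) by auto
  from is_potential_compose[OF assms(1) this] show ?thesis by simp
qed

text \<open>Local primitives are joined by bisection in one coordinate after the other: along a thin
  vertical strip, then across strips. Adjacent rectangles meet in a segment, hence in a connected
  set.\<close>

lemma potential_on_square:
  fixes \<kappa> :: "real \<times> real \<Rightarrow> 'a"
  assumes \<P>: "potential_atlas Y \<P>" and \<kappa>: "continuous_map euclidean Y \<kappa>"
  shows "\<exists>G. is_potential \<P> (top_of_set ({0..1} \<times> {0..1})) \<kappa> G"
proof -
  define H where "H A \<longleftrightarrow> (\<exists>G. is_potential \<P> (top_of_set A) \<kappa> G)" for A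
  have mono: "H B" if "H A" "B \<subseteq> A" for A B using potential_mono that unfolding H_def by blast
  have glue: "H (A \<union> B)" if "H A" "H B" "closed A" "closed B" "connected (A \<inter> B)" "A \<inter> B \<noteq> {}" for A B
    using potential_glue[OF \<P> \<kappa> that(3-6)] that(1,2) unfolding H_def by blast
  have loc: "\<exists>e>0. H ({x - e..x + e} \<times> {y - e..y + e})" for x y
  proof -
    have "\<kappa> (x,y) \<in> topspace Y" using \<kappa> by (auto simp: continuous_map_def)
    then obtain U F where UF: "(U,F) \<in> \<P>" "\<kappa> (x,y) \<in> U" using potential_atlasD(2)[OF \<P>] by blast
    have "openin Y U" using potential_atlasD(1)[OF \<P> UF(1)] .
    from openin_continuous_map_preimage[OF \<kappa> this] have "open {z. \<kappa> z \<in> U}" by simp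
    moreover have "(x,y) \<in> {z. \<kappa> z \<in> U}" using UF by simp
    ultimately obtain A B where AB: "open A" "open B" "(x,y) \<in> A \<times> B" "A \<times> B \<subseteq> {z. \<kappa> z \<in> U}"
      by (rule open_prod_elim)
    obtain a where a: "a > 0" "cball x a \<subseteq> A" using AB(1,3) open_contains_cball by blast
    obtain b where b: "b > 0" "cball y b \<subseteq> B" using AB(2,3) open_contains_cball by blast
    define e where "e = min a b"
    have "{x - e..x + e} \<subseteq> A" using a(2) by (force simp: e_def cball_def dist_real_def)
    moreover have "{y - e..y + e} \<subseteq> B" using b(2) by (force simp: e_def cball_def dist_real_def)
    ultimately have "\<kappa> ` topspace (top_of_set ({x - e..x + e} \<times> {y - e..y + e})) \<subseteq> U" using AB(4) by auto
    from is_potential_in_chart[OF UF(1) this] have "H ({x - e..x + e} \<times> {y - e..y + e})" unfolding H_def by blast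
    moreover have "e > 0" using a b by (simp add: e_def)
    ultimately show ?thesis by blast
  qed
  have strip: "\<exists>\<delta>>0. H ({x - \<delta>..x + \<delta>} \<times> {0..1})" for x
  proof -
    \<comment> \<open>The width is quantified inside the property, so that gluing two rectangles may
      pass to the smaller width.\<close>
    let ?Q = "\<lambda>c d. \<exists>\<delta>>0. H ({x - \<delta>..x + \<delta>} \<times> {c..d})"
    have "?Q 0 1"
    proof (rule Bolzano[where P = ?Q])
      fix a b c :: real assume Q: "?Q a b" "?Q b c" and le: "a \<le> b" "b \<le> c"
      then obtain d1 d2 where d: "d1 > 0" "d2 > 0" "H ({x - d1..x + d1} \<times> {a..b})" "H ({x - d2..x + d2} \<times> {b..c})" by blast
      define d where "d = min d1 d2"
      have dd: "d > 0" "d \<le> d1" "d \<le> d2" using d by (auto simp: d_def)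
      have 1: "H ({x - d..x + d} \<times> {a..b})" by (rule mono[OF d(3)]) (use dd in auto)
      have 2: "H ({x - d..x + d} \<times> {b..c})" by (rule mono[OF d(4)]) (use dd in auto)
      have i: "({x - d..x + d} \<times> {a..b}) \<inter> ({x - d..x + d} \<times> {b..c}) = {x - d..x + d} \<times> {b}" using le by auto
      have u: "({x - d..x + d} \<times> {a..b}) \<union> ({x - d..x + d} \<times> {b..c}) = {x - d..x + d} \<times> {a..c}" using le by auto
      have "H ({x - d..x + d} \<times> {a..c})"
        using glue[OF 1 2] unfolding i u using dd(1) by (auto intro!: closed_Times connected_Times)
      then show "?Q a c" using dd by blast
    next
      fix y :: real
      obtain e where e: "e > 0" "H ({x - e..x + e} \<times> {y - e..y + e})" using loc by blast
      have "?Q a b" if "a \<le> y \<and> y \<le> b \<and> b - a < e" for a b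
      proof -
        have "H ({x - e..x + e} \<times> {a..b})" by (rule mono[OF e(2)]) (use that in auto)
        then show ?thesis using e(1) by blast
      qed
      then show "\<exists>d>0. \<forall>a b. a \<le> y \<and> y \<le> b \<and> b - a < d \<longrightarrow> ?Q a b" using e(1) by blast
    qed simp
    then show ?thesis .
  qed
  have "H ({0..1} \<times> {0..1})"
  proof (rule Bolzano[where P = "\<lambda>a b. H ({a..b} \<times> {0..1})"])
    fix a b c :: real assume Q: "H ({a..b} \<times> {0..1})" "H ({b..c} \<times> {0..1})" and le: "a \<le> b" "b \<le> c"
    have i: "({a..b} \<times> {0..1::real}) \<inter> ({b..c} \<times> {0..1}) = {b} \<times> {0..1}" using le by auto
    have u: "({a..b} \<times> {0..1::real}) \<union> ({b..c} \<times> {0..1}) = {a..c} \<times> {0..1}" using le by auto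
    show "H ({a..c} \<times> {0..1})"
      using glue[OF Q] unfolding i u by (auto intro!: closed_Times connected_Times)
  next
    fix x :: real
    obtain e where e: "e > 0" "H ({x - e..x + e} \<times> {0..1})" using strip by blast
    have "H ({a..b} \<times> {0..1})" if "a \<le> x \<and> x \<le> b \<and> b - a < e" for a b
      by (rule mono[OF e(2)]) (use that in auto)
    then show "\<exists>d>0. \<forall>a b. a \<le> x \<and> x \<le> b \<and> b - a < d \<longrightarrow> H ({a..b} \<times> {0..1})" using e(1) by blast
  qed simp
  then show ?thesis unfolding H_def .
qed

section \<open>Integration over singular simplices\<close>

abbreviation simplex_top :: "nat \<Rightarrow> (nat \<Rightarrow> real) topology" where
  "simplex_top p \<equiv> subtopology (powertop_real UNIV) (standard_simplex p)"

lemma simplex_top_eq: "simplex_top p = top_of_set (standard_simplex p)"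
  by (simp add: euclidean_product_topology)

definition simplex_vertex :: "nat \<Rightarrow> nat \<Rightarrow> real" where
  "simplex_vertex i = (\<lambda>j. if j = i then 1 else 0)"

lemma simplex_vertex_in: "i \<le> p \<Longrightarrow> simplex_vertex i \<in> standard_simplex p"
  by (simp add: simplex_vertex_def)

lemma in_standard_simplex_1: "x \<in> standard_simplex 1 \<longleftrightarrow> 0 \<le> x 1 \<and> x 1 \<le> 1 \<and> x 0 = 1 - x 1 \<and> (\<forall>i>1. x i = 0)"
proof -
  have *: "(\<forall>i. P i) \<longleftrightarrow> P 0 \<and> P 1 \<and> (\<forall>i>1. P i)" for P :: "nat \<Rightarrow> bool"
    by (metis One_nat_def less_one linorder_neqE_nat)
  show ?thesis unfolding standard_simplex_def mem_Collect_eq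
    by (subst *) auto
qed

lemma in_standard_simplex_2:
  "x \<in> standard_simplex 2 \<longleftrightarrow> 0 \<le> x 1 \<and> 0 \<le> x 2 \<and> x 1 + x 2 \<le> 1 \<and> x 0 = 1 - x 1 - x 2 \<and> (\<forall>i>2. x i = 0)"
proof -
  have *: "(\<forall>i. P i) \<longleftrightarrow> P 0 \<and> P 1 \<and> P 2 \<and> (\<forall>i>2. P i)" for P :: "nat \<Rightarrow> bool"
    by (metis One_nat_def Suc_1 less_one linorder_neqE_nat less_2_cases)
  have s: "(\<Sum>i\<le>2. x i) = x 0 + x 1 + x 2" by (simp add: numeral_2_eq_2)
  show ?thesis unfolding standard_simplex_def mem_Collect_eq s
    by (subst *) auto
qed

text \<open>The simplex is a retract of the square: a primitive for
  \<open>\<sigma> \<circ> r\<close> on the square, pulled back along \<open>i\<close>, is one for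
  \<open>\<sigma>\<close>.\<close>

lemma potential_via_square:
  fixes r :: "real \<times> real \<Rightarrow> nat \<Rightarrow> real" and i :: "(nat \<Rightarrow> real) \<Rightarrow> real \<times> real"
  assumes \<P>: "potential_atlas Y \<P>" and \<sigma>: "singular_simplex p Y \<sigma>"
    and r: "continuous_on UNIV r" "range r \<subseteq> standard_simplex p"
    and i: "continuous_on (standard_simplex p) i" "i ` standard_simplex p \<subseteq> {0..1} \<times> {0..1}"
    and ri: "\<And>x. x \<in> standard_simplex p \<Longrightarrow> r (i x) = x"
  shows "\<exists>G. is_potential \<P> (simplex_top p) \<sigma> G"
proof -
  have s: "continuous_map (top_of_set (standard_simplex p)) Y \<sigma>"
    using \<sigma> by (simp add: singular_simplex_def euclidean_product_topology)
  have "continuous_map (euclidean :: (real \<times> real) topology) (top_of_set (standard_simplex p)) r"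
    using r by (auto simp: continuous_map_in_subtopology)
  from potential_on_square[OF \<P> continuous_map_compose[OF this s]]
  obtain G where G: "is_potential \<P> (top_of_set ({0..1} \<times> {0..1})) (\<sigma> \<circ> r) G" by blast
  have "continuous_map (top_of_set (standard_simplex p)) (top_of_set ({0..1} \<times> {0..1})) i" using i by auto
  from is_potential_compose[OF G this, of \<sigma> "G \<circ> i"] ri
  show ?thesis unfolding simplex_top_eq by auto
qed

lemma simplex2_potential:
  assumes \<P>: "potential_atlas Y \<P>" and \<sigma>: "singular_simplex 2 Y \<sigma>"
  shows "\<exists>G. is_potential \<P> (simplex_top 2) \<sigma> G"
proof (rule potential_via_square[OF \<P> \<sigma>])
  \<comment> \<open>Clamping the first coordinate to the unit interval and then the second to what
    the first leaves retracts the plane onto the triangle.\<close>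
  let ?u = "\<lambda>z::real \<times> real. max 0 (min 1 (fst z))"
  let ?v = "\<lambda>z::real \<times> real. max 0 (min (1 - ?u z) (snd z))"
  let ?r = "\<lambda>z::real \<times> real. \<lambda>k::nat. if k = 0 then 1 - ?u z - ?v z else if k = 1 then ?u z else if k = 2 then ?v z else 0"
  let ?i = "\<lambda>x::nat \<Rightarrow> real. (x 1, x 2)"
  show "continuous_on UNIV ?r"
  proof (rule continuous_on_coordinatewise_then_product)
    fix k show "continuous_on UNIV (\<lambda>z. ?r z k)"
      by (cases "k = 0"; cases "k = 1"; cases "k = 2") (auto intro!: continuous_intros)
  qed
  show "range ?r \<subseteq> standard_simplex 2" unfolding image_subset_iff in_standard_simplex_2 by auto
  show "continuous_on (standard_simplex 2) ?i" by (intro continuous_intros continuous_on_coordinate)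
  show "?i ` standard_simplex 2 \<subseteq> {0..1} \<times> {0..1}"
  proof (rule image_subsetI)
    fix x assume "x \<in> standard_simplex 2"
    then show "?i x \<in> {0..1} \<times> {0..1}" unfolding in_standard_simplex_2 by auto
  qed
  fix x assume x: "x \<in> standard_simplex 2"
  show "?r (?i x) = x"
  proof
    fix k :: nat
    consider "k = 0" | "k = 1" | "k = 2" | "k > 2" by linarith
    then show "?r (?i x) k = x k" using x unfolding in_standard_simplex_2 by cases auto
  qed
qed

text \<open>The choice is harmless: primitives over the connected 1-simplex differ by constants,
  which cancel between the endpoints.\<close>

definition potential_integral :: "('a set \<times> ('a \<Rightarrow> real)) set \<Rightarrow> ((nat \<Rightarrow> real) \<Rightarrow> 'a) \<Rightarrow> real" where
  "potential_integral \<P> \<sigma> = (let G = (SOME G. is_potential \<P> (simplex_top 1) \<sigma> G)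
     in G (simplex_vertex 1) - G (simplex_vertex 0))"

lemma potential_integral_eq:
  assumes \<P>: "potential_atlas Y \<P>" and \<sigma>: "singular_simplex 1 Y \<sigma>" and G: "is_potential \<P> (simplex_top 1) \<sigma> G"
  shows "potential_integral \<P> \<sigma> = G (simplex_vertex 1) - G (simplex_vertex 0)"
proof -
  define H where "H = (SOME G. is_potential \<P> (simplex_top 1) \<sigma> G)"
  have H: "is_potential \<P> (simplex_top 1) \<sigma> H" unfolding H_def by (rule someI[where P = "is_potential \<P> (simplex_top 1) \<sigma>", OF G])
  have c: "continuous_map (simplex_top 1) Y \<sigma>" using \<sigma> by (simp add: singular_simplex_def)
  have con: "connected_space (simplex_top 1)" using connectedin_standard_simplex by (simp add: connectedin_def)
  have v: "simplex_vertex 0 \<in> topspace (simplex_top 1)" "simplex_vertex 1 \<in> topspace (simplex_top 1)"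
    by (simp_all add: simplex_vertex_in)
  have "H (simplex_vertex 0) - G (simplex_vertex 0) = H (simplex_vertex 1) - G (simplex_vertex 1)"
    using locally_constant_imp_constant[OF con is_potential_diff_locally_constant[OF \<P> c H G] v] .
  then show ?thesis unfolding potential_integral_def Let_def H_def[symmetric] by linarith
qed

definition linear_extension :: "('b \<Rightarrow> real) \<Rightarrow> ('b \<Rightarrow>\<^sub>0 int) \<Rightarrow> real" where
  "linear_extension f c = (\<Sum>\<sigma>\<in>Poly_Mapping.keys c. of_int (Poly_Mapping.lookup c \<sigma>) * f \<sigma>)"

lemma linear_extension_superset:
  "finite A \<Longrightarrow> Poly_Mapping.keys c \<subseteq> A \<Longrightarrow>
    linear_extension f c = (\<Sum>\<sigma>\<in>A. of_int (Poly_Mapping.lookup c \<sigma>) * f \<sigma>)"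
  unfolding linear_extension_def by (intro sum.mono_neutral_left) (auto simp: in_keys_iff)

lemma linear_extension_add: "linear_extension f (c + d) = linear_extension f c + linear_extension f d"
proof -
  let ?A = "Poly_Mapping.keys c \<union> Poly_Mapping.keys d"
  have "Poly_Mapping.keys (c + d) \<subseteq> ?A" by (rule keys_add)
  then show ?thesis
    by (simp add: linear_extension_superset[of ?A] lookup_add distrib_right sum.distrib)
qed

lemma linear_extension_cmul: "linear_extension f (frag_cmul k c) = of_int k * linear_extension f c"
proof -
  have "Poly_Mapping.keys (frag_cmul k c) \<subseteq> Poly_Mapping.keys c" by (rule keys_cmul)
  then show ?thesis
    by (simp add: linear_extension_superset[of "Poly_Mapping.keys c"] sum_distrib_left mult.assoc)
qed

lemma linear_extension_minus: "linear_extension f (- c) = - linear_extension f c"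
  using linear_extension_cmul[of f "-1" c] by simp

lemma linear_extension_diff: "linear_extension f (c - d) = linear_extension f c - linear_extension f d"
  using linear_extension_add[of f c "- d"] by (simp add: linear_extension_minus)

lemma linear_extension_of [simp]: "linear_extension f (frag_of \<sigma>) = f \<sigma>"
  by (simp add: linear_extension_def)

lemma chain_boundary_2_of:
  "chain_boundary 2 (frag_of \<tau>) = frag_of (singular_face 2 0 \<tau>) - frag_of (singular_face 2 1 \<tau>) + frag_of (singular_face 2 2 \<tau>)"
proof -
  have "{..2::nat} = {0, 1, 2}" by auto
  then show ?thesis by (simp add: chain_boundary_of)
qed

lemma simplical_face_vertex:
  "simplical_face k (simplex_vertex j) = simplex_vertex (if j < k then j else Suc j)"
  by (auto simp: simplical_face_def simplex_vertex_def fun_eq_iff)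

text \<open>Stokes: one primitive on the triangle restricts to all faces, so the three integrals are
  differences of vertex values and cancel.\<close>

lemma potential_integral_boundary:
  assumes \<P>: "potential_atlas Y \<P>" and d: "singular_chain 2 Y d"
  shows "linear_extension (potential_integral \<P>) (chain_boundary 2 d) = 0"
  using d unfolding singular_chain_def
proof (induction d rule: frag_induction)
  case zero
  then show ?case by (simp add: linear_extension_def)
next
  case (one \<tau>)
  then have \<tau>: "singular_simplex 2 Y \<tau>" by simp
  obtain G where G: "is_potential \<P> (simplex_top 2) \<tau> G" using simplex2_potential[OF \<P> \<tau>] by blast
  have face: "potential_integral \<P> (singular_face 2 k \<tau>) =
     G (simplical_face k (simplex_vertex 1)) - G (simplical_face k (simplex_vertex 0))" if k: "k \<le> 2" for k
  proof -
    have s: "singular_simplex 1 Y (singular_face 2 k \<tau>)"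
      using singular_simplex_singular_face[OF \<tau>, of k] k by simp
    have sf: "simplical_face k x \<in> standard_simplex 2" if "x \<in> standard_simplex 1" for x
      using simplical_face_in_standard_simplex[of 2 k x] k that by simp
    have "continuous_map (simplex_top 1) (simplex_top 2) (simplical_face k)"
    proof -
      have "continuous_on UNIV (simplical_face k :: (nat \<Rightarrow> real) \<Rightarrow> _)"
      proof (rule continuous_on_coordinatewise_then_product)
        fix i show "continuous_on UNIV (\<lambda>x::nat \<Rightarrow> real. simplical_face k x i)"
          unfolding simplical_face_def
          by (cases "i < k"; cases "i = k") (auto intro: continuous_on_coordinate)
      qed
      then show ?thesis
        unfolding simplex_top_eq using sf by (auto intro: continuous_on_subset)
    qed
    from is_potential_compose[OF G this, of "singular_face 2 k \<tau>" "G \<circ> simplical_face k"]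
    have "is_potential \<P> (simplex_top 1) (singular_face 2 k \<tau>) (G \<circ> simplical_face k)"
      by (simp add: singular_face_def)
    from potential_integral_eq[OF \<P> s this] show ?thesis by simp
  qed
  show ?case
    unfolding chain_boundary_2_of linear_extension_add linear_extension_diff linear_extension_of
    by (simp add: face simplical_face_vertex)
next
  case (diff a b)
  then show ?case by (simp add: chain_boundary_diff linear_extension_diff)
qed

section \<open>Paths as singular 1-simplices\<close>

definition segment_simplex :: "(real \<Rightarrow> 'a) \<Rightarrow> real \<Rightarrow> real \<Rightarrow> (nat \<Rightarrow> real) \<Rightarrow> 'a" where
  "segment_simplex g u v = restrict (\<lambda>x. g (x 0 * u + x 1 * v)) (standard_simplex 1)"

definition point_simplex :: "'a \<Rightarrow> (nat \<Rightarrow> real) \<Rightarrow> 'a" where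
  "point_simplex a = restrict (\<lambda>x. a) (standard_simplex 0)"

lemma convex_01: "\<lbrakk>u \<in> {0..1}; v \<in> {0..1}; x \<in> standard_simplex 1\<rbrakk> \<Longrightarrow> x 0 * u + x 1 * v \<in> {0..1::real}"
  unfolding in_standard_simplex_1 using convex_bound_le[of u 1 v "x 0" "x 1"] by auto

lemma singular_simplex_segment:
  assumes g: "pathin X g" and uv: "u \<in> {0..1}" "v \<in> {0..1}"
  shows "singular_simplex 1 X (segment_simplex g u v)"
proof -
  have "continuous_map (simplex_top 1) (top_of_set {0..1}) (\<lambda>x. x 0 * u + x 1 * v)"
    unfolding simplex_top_eq using convex_01[OF uv]
    by (auto simp: continuous_map_in_subtopology intro!: continuous_intros continuous_on_coordinate)
  from continuous_map_compose[OF this g[unfolded pathin_def]]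
  have "continuous_map (simplex_top 1) X (segment_simplex g u v)"
    by (rule continuous_map_eq) (simp add: segment_simplex_def)
  then show ?thesis by (simp add: singular_simplex_def segment_simplex_def)
qed

lemma standard_simplex_0_eq: "standard_simplex 0 = {simplex_vertex 0}"
  by (simp add: standard_simplex_0 simplex_vertex_def)

lemma chain_boundary_1_of:
  "chain_boundary 1 (frag_of \<sigma>) = frag_of (point_simplex (\<sigma> (simplex_vertex 1))) - frag_of (point_simplex (\<sigma> (simplex_vertex 0)))"
proof -
  have f: "singular_face 1 k \<sigma> = point_simplex (\<sigma> (simplex_vertex (if k = 0 then 1 else 0)))" for k
    by (rule ext) (auto simp: singular_face_def point_simplex_def standard_simplex_0_eq simplical_face_vertex restrict_def)
  have "{..1::nat} = {0, 1}" by auto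
  then have "chain_boundary 1 (frag_of \<sigma>) = frag_of (singular_face 1 0 \<sigma>) - frag_of (singular_face 1 1 \<sigma>)"
    by (simp add: chain_boundary_of)
  then show ?thesis unfolding f by simp
qed

lemma segment_simplex_vertices:
  "segment_simplex g u v (simplex_vertex 0) = g u" "segment_simplex g u v (simplex_vertex 1) = g v"
proof -
  have "simplex_vertex 0 \<in> standard_simplex 1" "simplex_vertex 1 \<in> standard_simplex 1" by (simp_all add: simplex_vertex_in)
  then show "segment_simplex g u v (simplex_vertex 0) = g u" "segment_simplex g u v (simplex_vertex 1) = g v"
    unfolding segment_simplex_def by (simp_all add: simplex_vertex_def)
qed

lemma chain_boundary_segment:
  "chain_boundary 1 (frag_of (segment_simplex g u v)) = frag_of (point_simplex (g v)) - frag_of (point_simplex (g u))"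
  unfolding chain_boundary_1_of segment_simplex_vertices ..

text \<open>Lets statements proved for paths be applied to all generators of the 1-chains.\<close>

lemma simplex_eq_segment:
  assumes \<sigma>: "singular_simplex 1 X \<sigma>"
  obtains g where "pathin X g" "\<sigma> = segment_simplex g 0 1"
proof -
  define e where "e t = (\<lambda>i::nat. if i = 0 then 1 - t else if i = 1 then t else (0::real))" for t
  have eS: "e t \<in> standard_simplex 1" if "t \<in> {0..1}" for t using that unfolding in_standard_simplex_1 e_def by auto
  have "continuous_on S e" for S
  proof (rule continuous_on_coordinatewise_then_product)
    fix i show "continuous_on S (\<lambda>t. e t i)" unfolding e_def by (cases "i = 0"; cases "i = 1") (auto intro!: continuous_intros)
  qed
  then have ce: "continuous_map (top_of_set {0..1}) (simplex_top 1) e"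
    unfolding simplex_top_eq using eS by (auto simp: continuous_map_in_subtopology)
  have cs: "continuous_map (simplex_top 1) X \<sigma>" and ext: "\<sigma> \<in> extensional (standard_simplex 1)"
    using \<sigma> by (simp_all add: singular_simplex_def)
  have p: "pathin X (\<sigma> \<circ> e)" unfolding pathin_def by (rule continuous_map_compose[OF ce cs])
  have "\<sigma> = segment_simplex (\<sigma> \<circ> e) 0 1"
  proof (rule extensionalityI[OF ext])
    show "segment_simplex (\<sigma> \<circ> e) 0 1 \<in> extensional (standard_simplex 1)" by (simp add: segment_simplex_def)
    fix x assume x: "x \<in> standard_simplex 1"
    have "e (x 1) = x"
    proof
      fix i :: nat
      consider "i = 0" | "i = 1" | "i > 1" by linarith
      then show "e (x 1) i = x i" using x unfolding in_standard_simplex_1 e_def by cases auto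
    qed
    then show "\<sigma> x = segment_simplex (\<sigma> \<circ> e) 0 1 x" using x by (simp add: segment_simplex_def)
  qed
  with p show thesis by (rule that)
qed

text \<open>A degenerate triangle inside a single path; it expresses that cutting a path in two
  changes it only by a boundary.\<close>

lemma segment_triangle:
  assumes g: "pathin X g" and uvw: "u \<in> {0..1}" "v \<in> {0..1}" "w \<in> {0..1}"
  obtains d where "singular_chain 2 X d"
    "chain_boundary 2 d = frag_of (segment_simplex g v w) - frag_of (segment_simplex g u w) + frag_of (segment_simplex g u v)"
proof -
  define \<tau> where "\<tau> = restrict (\<lambda>x. g (x 0 * u + x 1 * v + x 2 * w)) (standard_simplex 2)"
  have c01: "x 0 * u + x 1 * v + x 2 * w \<in> {0..1}" if "x \<in> standard_simplex 2" for x
  proof -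
    have x: "0 \<le> x 0" "0 \<le> x 1" "0 \<le> x 2" "x 0 + x 1 + x 2 = 1" using that unfolding in_standard_simplex_2 by auto
    have "x 0 * u \<le> x 0" "x 1 * v \<le> x 1" "x 2 * w \<le> x 2" using x uvw by (auto intro: mult_left_le)
    moreover have "0 \<le> x 0 * u" "0 \<le> x 1 * v" "0 \<le> x 2 * w" using x uvw by auto
    ultimately show ?thesis unfolding atLeastAtMost_iff using x(4) by linarith
  qed
  have "continuous_map (simplex_top 2) (top_of_set {0..1}) (\<lambda>x. x 0 * u + x 1 * v + x 2 * w)"
    unfolding simplex_top_eq using c01
    by (auto simp: continuous_map_in_subtopology intro!: continuous_intros continuous_on_coordinate)
  from continuous_map_compose[OF this g[unfolded pathin_def]]
  have "continuous_map (simplex_top 2) X \<tau>"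
    by (rule continuous_map_eq) (simp add: \<tau>_def)
  then have s: "singular_chain 2 X (frag_of \<tau>)" by (simp add: singular_chain_of singular_simplex_def \<tau>_def)
  have sf: "simplical_face k x \<in> standard_simplex 2" if "x \<in> standard_simplex 1" "k \<le> 2" for k x
    using simplical_face_in_standard_simplex[of 2 k x] that by simp
  have f: "singular_face 2 k \<tau> = restrict (\<lambda>x. g (simplical_face k x 0 * u + simplical_face k x 1 * v + simplical_face k x 2 * w)) (standard_simplex 1)"
    if k: "k \<le> 2" for k
  proof -
    have "2 - Suc 0 = 1" by simp
    then show ?thesis unfolding singular_face_def using sf[OF _ k]
      by (intro ext) (simp only: restrict_def comp_apply \<tau>_def if_True split: if_split, blast)
  qed
  have "singular_face 2 0 \<tau> = segment_simplex g v w" "singular_face 2 1 \<tau> = segment_simplex g u w" "singular_face 2 2 \<tau> = segment_simplex g u v"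
    unfolding segment_simplex_def by (simp_all add: f simplical_face_def)
  note f = this
  show thesis by (rule that[OF s]) (simp only: chain_boundary_2_of f)
qed

text \<open>The power is evaluated in the free abelian group of chains, restricted to the subgroup
  of cycles and passed to the quotient by boundaries.\<close>

lemma homology_class_pow:
  assumes z: "singular_relcycle 1 Y {} z"
  shows "homologous_rel_set 1 Y {} z [^]\<^bsub>homology_group 1 Y\<^esub> (k::int) = homologous_rel_set 1 Y {} (frag_cmul k z)"
proof -
  have c: "z \<in> carrier (relcycle_group 1 Y {})" using z by simp
  have "z \<in> carrier (subgroup_generated (free_Abelian_group (singular_simplex_set 1 Y)) (singular_relcycle_set 1 Y {}))"
    using c by (simp add: chain_group_def relcycle_group_def)
  moreover have "z \<in> carrier (free_Abelian_group (singular_simplex_set 1 Y))"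
    using z by (simp add: singular_cycle singular_chain_def free_Abelian_group_def)
  ultimately have "z [^]\<^bsub>relcycle_group 1 Y {}\<^esub> k = frag_cmul k z"
    by (simp add: relcycle_group_def chain_group_def group.int_pow_subgroup_generated)
  moreover have "(\<lambda>a. homologous_rel_set 1 Y {} a) z [^]\<^bsub>relcycle_group 1 Y {} Mod singular_relboundary_set 1 Y {}\<^esub> k
     = homologous_rel_set 1 Y {} (z [^]\<^bsub>relcycle_group 1 Y {}\<^esub> k)"
    using normal.FactGroup_int_pow[OF normal_subgroup_singular_relboundary_relcycle c, of k]
    unfolding right_coset_singular_relboundary by simp
  ultimately show ?thesis by (simp add: relative_homology_group_def)
qed

text \<open>A class of infinite order is by itself an independent set, so the supremum in
  \<open>free_rank\<close> is at least 1.\<close>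

lemma betti_1_pos:
  assumes z: "singular_relcycle 1 Y {} z"
    and inf: "\<And>k. k \<noteq> 0 \<Longrightarrow> \<not> singular_relboundary 1 Y {} (frag_cmul k z)"
  shows "betti 1 Y > 0"
proof -
  let ?G = "homology_group 1 Y"
  interpret G: comm_group ?G by (rule abelian_homology_group)
  define a where "a = homologous_rel_set 1 Y {} z"
  have a: "a \<in> carrier ?G" unfolding a_def using z carrier_relative_homology_group[of 1 Y "{}"] by auto
  have ind: "k = 0" if "a [^]\<^bsub>?G\<^esub> (k::int) = \<one>\<^bsub>?G\<^esub>" for k
  proof (rule ccontr)
    assume "k \<noteq> 0"
    have "homologous_rel_set 1 Y {} (frag_cmul k z) = singular_relboundary_set 1 Y {}"
      using that one_relative_homology_group[of 1 Y "{}"] unfolding a_def homology_class_pow[OF z] by simp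
    then have "singular_relboundary 1 Y {} (frag_cmul k z)" by (simp only: homologous_rel_set_eq_relboundary)
    with inf[OF \<open>k \<noteq> 0\<close>] show False ..
  qed
  have "enat 1 \<in> {enat (card A) | A. A \<subseteq> carrier ?G \<and> finite A \<and>
      (\<forall>k. finprod ?G (\<lambda>a. a [^]\<^bsub>?G\<^esub> (k a :: int)) A = \<one>\<^bsub>?G\<^esub> \<longrightarrow> (\<forall>a\<in>A. k a = 0))}"
    unfolding mem_Collect_eq
  proof (intro exI[of _ "{a}"] conjI allI impI ballI)
    fix k :: "_ \<Rightarrow> int" and b
    assume "finprod ?G (\<lambda>a. a [^]\<^bsub>?G\<^esub> k a) {a} = \<one>\<^bsub>?G\<^esub>" "b \<in> {a}"
    then show "k b = 0" using ind[of "k a"] a by (simp add: G.finprod_singleton_swap)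
  qed (use a in auto)
  then have "enat 1 \<le> free_rank ?G" unfolding free_rank_def by (rule Sup_upper)
  then show ?thesis unfolding betti_def by (simp add: order_less_le_trans[of _ "enat 1"] zero_enat_def)
qed

text \<open>If the rank is not positive, every cycle has a nonzero multiple that bounds. Integrals
  are real numbers, so they vanish on the cycle itself, and integration from a base point does not
  depend on the path.\<close>

lemma potential_exists:
  assumes \<P>: "potential_atlas Y \<P>" and pc: "path_connected_space Y" and lpc: "locally_path_connected_space Y"
    and b: "\<not> betti 1 Y > 0"
  shows "\<exists>\<Psi>. is_potential \<P> Y id \<Psi>"
proof (cases "topspace Y = {}")
  case True then show ?thesis by (simp add: is_potential_def)
next
  case False
  then obtain y0 where y0: "y0 \<in> topspace Y" by blast
  let ?\<psi> = "linear_extension (potential_integral \<P>)"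
  have cyc: "?\<psi> z = 0" if z: "singular_relcycle 1 Y {} z" for z
  proof -
    obtain k where k: "k \<noteq> 0" "singular_relboundary 1 Y {} (frag_cmul k z)" using betti_1_pos[OF z] b by blast
    then obtain d where d: "singular_chain 2 Y d" "chain_boundary 2 d = frag_cmul k z"
      unfolding singular_boundary by (auto simp: numeral_2_eq_2)
    have "of_int k * ?\<psi> z = 0"
      using potential_integral_boundary[OF \<P> d(1)] unfolding d(2) linear_extension_cmul .
    then show ?thesis using k by simp
  qed
  have "\<exists>g. pathin Y g \<and> g 0 = y0 \<and> g 1 = y" if "y \<in> topspace Y" for y
    using pc y0 that unfolding path_connected_space_def by blast
  then obtain p where p: "\<And>y. y \<in> topspace Y \<Longrightarrow> pathin Y (p y) \<and> p y 0 = y0 \<and> p y 1 = y" by metis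
  have pY: "g 0 \<in> topspace Y" "g 1 \<in> topspace Y" if "pathin Y g" for g
    using that unfolding pathin_def continuous_map_def by auto
  define \<Psi> where "\<Psi> y = potential_integral \<P> (segment_simplex (p y) 0 1)" for y
  have I: "potential_integral \<P> (segment_simplex g 0 1) = \<Psi> (g 1) - \<Psi> (g 0)" if g: "pathin Y g" for g
  proof -
    let ?s = "\<lambda>g. frag_of (segment_simplex g 0 1)"
    have s: "singular_chain 1 Y (?s g)" if "pathin Y g" for g
      using singular_simplex_segment[OF that, of 0 1] by (simp add: singular_chain_of)
    \<comment> \<open>The path \<open>g\<close> closed up by the chosen paths from \<open>y0\<close>
      to its endpoints.\<close>
    let ?z = "?s (p (g 0)) + ?s g - ?s (p (g 1))"
    have "chain_boundary 1 ?z = 0"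
      using p[OF pY(1)[OF g]] p[OF pY(2)[OF g]]
      by (simp only: chain_boundary_add chain_boundary_diff chain_boundary_segment) simp
    moreover have "singular_chain 1 Y ?z"
      using s g p[OF pY(1)[OF g]] p[OF pY(2)[OF g]] by (intro singular_chain_add singular_chain_diff) auto
    ultimately have "singular_relcycle 1 Y {} ?z" unfolding singular_cycle by simp
    from cyc[OF this] show ?thesis
      unfolding linear_extension_add linear_extension_diff linear_extension_of \<Psi>_def by simp
  qed
  have "is_potential \<P> Y id \<Psi>"
  proof (rule is_potentialI)
    fix y assume y: "y \<in> topspace Y"
    obtain U F where UF: "(U,F) \<in> \<P>" "y \<in> U" using potential_atlasD(2)[OF \<P> y] by blast
    have "openin Y U" by (rule potential_atlasD(1)[OF \<P> UF(1)])
    then obtain T where T: "openin Y T" "path_connectedin Y T" "y \<in> T" "T \<subseteq> U"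
      using lpc UF(2) unfolding locally_path_connected_space by meson
    have "F w - \<Psi> w = F y - \<Psi> y" if w: "w \<in> T" for w
    proof -
      have "topspace (subtopology Y T) = T" using openin_subset[OF T(1)] by auto
      then obtain g where g: "pathin (subtopology Y T) g" "g 0 = y" "g 1 = w"
        using T(2,3) w unfolding path_connectedin_def path_connected_space_def by metis
      have gY: "pathin Y g" and gT: "g ` {0..1} \<subseteq> T" using g(1) unfolding pathin_subtopology by auto
      have s: "singular_simplex 1 Y (segment_simplex g 0 1)" by (rule singular_simplex_segment[OF gY]) auto
      have "segment_simplex g 0 1 ` topspace (simplex_top 1) \<subseteq> U"
      proof
        fix u assume "u \<in> segment_simplex g 0 1 ` topspace (simplex_top 1)"
        then obtain x where x: "x \<in> standard_simplex 1" "u = segment_simplex g 0 1 x" by auto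
        then have "x 1 \<in> {0..1}" unfolding in_standard_simplex_1 by simp
        then have "g (x 1) \<in> U" using gT T(4) by blast
        moreover have "u = g (x 1)" using x by (simp add: segment_simplex_def)
        ultimately show "u \<in> U" by simp
      qed
      from potential_integral_eq[OF \<P> s is_potential_in_chart[OF UF(1) this]]
      have "potential_integral \<P> (segment_simplex g 0 1) = F w - F y"
        by (simp only: comp_apply segment_simplex_vertices g)
      with I[OF gY] g show ?thesis by simp
    qed
    then show "\<exists>U F T. (U,F) \<in> \<P> \<and> openin Y T \<and> y \<in> T \<and> id ` T \<subseteq> U \<and> (\<forall>w\<in>T. F (id w) - \<Psi> w = F (id y) - \<Psi> y)"
      using UF(1) T by (metis id_apply image_id)
  qed
  then show ?thesis by blast
qed

section \<open>Double covers\<close>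

text \<open>Truth values serve as the group of order 2, with equality as its operation, so
  \<open>compat\<close> is the cocycle condition for local trivializations. The functions
  \<open>b\<close> themselves may be discontinuous.\<close>

locale double_cover_atlas =
  fixes X :: "'a topology" and \<B> :: "('a set \<times> ('a \<Rightarrow> bool)) set"
  assumes openin_chart: "(U,b) \<in> \<B> \<Longrightarrow> openin X U"
    and cover: "x \<in> topspace X \<Longrightarrow> \<exists>U b. (U,b) \<in> \<B> \<and> x \<in> U"
    and compat: "\<lbrakk>(U,b) \<in> \<B>; (V,c) \<in> \<B>; x \<in> U; x \<in> V\<rbrakk> \<Longrightarrow>
      \<exists>T. openin X T \<and> x \<in> T \<and> T \<subseteq> U \<inter> V \<and> (\<forall>y\<in>T. (b y = c y) = (b x = c x))"
begin

definition sheet :: "('a \<Rightarrow> bool) \<Rightarrow> bool \<Rightarrow> 'a set \<Rightarrow> ('a \<times> bool) set" where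
  "sheet b c T = (\<lambda>y. (y, b y = c)) ` T"

text \<open>The label \<open>b y = (b x = e)\<close> is the one that puts a point over
  \<open>y\<close> on the same sheet of the chart \<open>b\<close> as \<open>(x,e)\<close>. The
  condition is asked of every chart so that it can be used in any of them; \<open>compat\<close>
  enters when sheets are shown to be open.\<close>

definition cover_open :: "('a \<times> bool) set \<Rightarrow> bool" where
  "cover_open W \<longleftrightarrow> W \<subseteq> topspace X \<times> UNIV \<and>
     (\<forall>x e U b. (x,e) \<in> W \<longrightarrow> (U,b) \<in> \<B> \<longrightarrow> x \<in> U \<longrightarrow>
        (\<exists>T. openin X T \<and> x \<in> T \<and> T \<subseteq> U \<and> (\<forall>y\<in>T. (y, b y = (b x = e)) \<in> W)))"

lemma cover_openI:
  assumes "W \<subseteq> topspace X \<times> UNIV"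
    and "\<And>x e U b. \<lbrakk>(x,e) \<in> W; (U,b) \<in> \<B>; x \<in> U\<rbrakk> \<Longrightarrow>
        \<exists>T. openin X T \<and> x \<in> T \<and> T \<subseteq> U \<and> (\<forall>y\<in>T. (y, b y = (b x = e)) \<in> W)"
  shows "cover_open W"
  unfolding cover_open_def using assms(1) by (intro conjI allI impI assms(2))

lemma cover_open_subset: "cover_open W \<Longrightarrow> W \<subseteq> topspace X \<times> UNIV"
  unfolding cover_open_def by (rule conjunct1)

lemma cover_openD:
  "\<lbrakk>cover_open W; (x,e) \<in> W; (U,b) \<in> \<B>; x \<in> U\<rbrakk> \<Longrightarrow>
    \<exists>T. openin X T \<and> x \<in> T \<and> T \<subseteq> U \<and> (\<forall>y\<in>T. (y, b y = (b x = e)) \<in> W)"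
  unfolding cover_open_def by (drule conjunct2) (elim allE impE, assumption+)

definition N :: "('a \<times> bool) topology" where "N = topology cover_open"

lemma openin_N: "openin N = cover_open"
proof -
  have "istopology cover_open"
    unfolding istopology_def
  proof (intro conjI allI impI)
    fix V W assume V: "cover_open V" and W: "cover_open W"
    show "cover_open (V \<inter> W)"
    proof (rule cover_openI)
      show "V \<inter> W \<subseteq> topspace X \<times> UNIV" using cover_open_subset[OF V] by blast
      fix x e U b assume *: "(x,e) \<in> V \<inter> W" "(U,b) \<in> \<B>" "x \<in> U"
      obtain T1 where T1: "openin X T1" "x \<in> T1" "T1 \<subseteq> U" "\<forall>y\<in>T1. (y, b y = (b x = e)) \<in> V"
        using cover_openD[OF V IntD1[OF *(1)] *(2,3)] by (elim exE conjE)
      obtain T2 where T2: "openin X T2" "x \<in> T2" "T2 \<subseteq> U" "\<forall>y\<in>T2. (y, b y = (b x = e)) \<in> W"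
        using cover_openD[OF W IntD2[OF *(1)] *(2,3)] by (elim exE conjE)
      show "\<exists>T. openin X T \<and> x \<in> T \<and> T \<subseteq> U \<and> (\<forall>y\<in>T. (y, b y = (b x = e)) \<in> V \<inter> W)"
      proof (intro exI conjI ballI)
        show "openin X (T1 \<inter> T2)" using T1(1) T2(1) by (rule openin_Int)
        show "x \<in> T1 \<inter> T2" using T1(2) T2(2) by (rule IntI)
        show "T1 \<inter> T2 \<subseteq> U" using T1(3) by blast
        fix y assume "y \<in> T1 \<inter> T2"
        then show "(y, b y = (b x = e)) \<in> V \<inter> W" using T1(4) T2(4) by blast
      qed
    qed
  next
    fix K assume K: "\<forall>S\<in>K. cover_open S"
    show "cover_open (\<Union>K)"
    proof (rule cover_openI)
      show "\<Union>K \<subseteq> topspace X \<times> UNIV" using K cover_open_subset by (intro Union_least) blast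
      fix x e U b assume *: "(x,e) \<in> \<Union>K" "(U,b) \<in> \<B>" "x \<in> U"
      obtain V where V: "V \<in> K" "(x,e) \<in> V" using *(1) by (rule UnionE)
      obtain T1 where T1: "openin X T1" "x \<in> T1" "T1 \<subseteq> U" "\<forall>y\<in>T1. (y, b y = (b x = e)) \<in> V"
        using cover_openD[OF bspec[OF K V(1)] V(2) *(2,3)] by (elim exE conjE)
      show "\<exists>T. openin X T \<and> x \<in> T \<and> T \<subseteq> U \<and> (\<forall>y\<in>T. (y, b y = (b x = e)) \<in> \<Union>K)"
      proof (intro exI conjI ballI)
        fix y assume "y \<in> T1"
        with T1(4) have "(y, b y = (b x = e)) \<in> V" by (rule bspec)
        then show "(y, b y = (b x = e)) \<in> \<Union>K" using V(1) by (intro UnionI)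
      qed (rule T1)+
    qed
  qed
  then show ?thesis unfolding N_def by (rule topology_inverse')
qed

lemma openin_ND:
  assumes "openin N W" "(x,e) \<in> W" "(U,b) \<in> \<B>" "x \<in> U"
  obtains T where "openin X T" "x \<in> T" "T \<subseteq> U" "\<And>y. y \<in> T \<Longrightarrow> (y, b y = (b x = e)) \<in> W"
  using cover_openD[OF assms(1)[unfolded openin_N] assms(2-4)] by (elim exE conjE) (rule that, assumption+, erule bspec)

lemma openin_N_vimage:
  assumes "openin X O'" shows "openin N (O' \<times> UNIV)"
  unfolding openin_N
proof (rule cover_openI)
  show "O' \<times> UNIV \<subseteq> topspace X \<times> UNIV" using openin_subset[OF assms] by blast
  fix x e U b assume "(x,e) \<in> O' \<times> (UNIV :: bool set)" "(U,b) \<in> \<B>" "x \<in> U"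
  then show "\<exists>T. openin X T \<and> x \<in> T \<and> T \<subseteq> U \<and> (\<forall>y\<in>T. (y, b y = (b x = e)) \<in> O' \<times> UNIV)"
    using assms openin_chart by (intro exI[of _ "O' \<inter> U"]) auto
qed

lemma topspace_N: "topspace N = topspace X \<times> UNIV"
proof
  show "topspace N \<subseteq> topspace X \<times> UNIV"
    using openin_topspace[of N] unfolding openin_N by (rule cover_open_subset)
  show "topspace X \<times> UNIV \<subseteq> topspace N"
    by (rule openin_subset[OF openin_N_vimage[OF openin_topspace]])
qed

lemma continuous_map_fst_N: "continuous_map N X fst"
proof (rule continuous_map_alt[THEN iffD2], intro conjI allI impI)
  fix V assume V: "openin X V"
  have "fst -` V \<inter> topspace N = V \<times> UNIV" using openin_subset[OF V] by (auto simp: topspace_N)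
  then show "openin N (fst -` V \<inter> topspace N)" using openin_N_vimage[OF V] by simp
qed (auto simp: topspace_N)

text \<open>A sheet is cut out by one chart but must be tested in all. On \<open>O'\<close> the
  comparison of the two charts is constant, so both cut out the same sheet there.\<close>

lemma openin_sheet:
  assumes Ub: "(U,b) \<in> \<B>" and T: "openin X T" "T \<subseteq> U"
  shows "openin N (sheet b c T)"
  unfolding openin_N
proof (rule cover_openI)
  show "sheet b c T \<subseteq> topspace X \<times> UNIV" using openin_subset[OF T(1)] by (auto simp: sheet_def)
  fix x e V d assume *: "(x,e) \<in> sheet b c T" "(V,d) \<in> \<B>" "x \<in> V"
  then have x: "x \<in> T" "e = (b x = c)" by (auto simp: sheet_def)
  have "x \<in> U" using x T by blast
  from compat[OF Ub *(2) this *(3)] obtain O' where O': "openin X O'" "x \<in> O'" "O' \<subseteq> U \<inter> V" "\<forall>y\<in>O'. (b y = d y) = (b x = d x)" by blast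
  show "\<exists>T'. openin X T' \<and> x \<in> T' \<and> T' \<subseteq> V \<and> (\<forall>y\<in>T'. (y, d y = (d x = e)) \<in> sheet b c T)"
  proof (intro exI[of _ "T \<inter> O'"] conjI ballI)
    show "openin X (T \<inter> O')" using T O' by blast
    fix y assume y: "y \<in> T \<inter> O'"
    then have "(b y = d y) = (b x = d x)" using O'(4) by blast
    then have "(d y = (d x = e)) = (b y = c)" using x(2) by blast
    then show "(y, d y = (d x = e)) \<in> sheet b c T" using y by (auto simp: sheet_def)
  qed (use x O' in auto)
qed

lemma continuous_map_section:
  assumes Ub: "(U,b) \<in> \<B>"
  shows "continuous_map (subtopology X U) N (\<lambda>y. (y, b y = c))"
proof (rule continuous_map_alt[THEN iffD2], intro conjI allI impI)
  have UX: "U \<subseteq> topspace X" using openin_subset[OF openin_chart[OF Ub]] .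
  show "(\<lambda>y. (y, b y = c)) \<in> topspace (subtopology X U) \<rightarrow> topspace N" by (auto simp: topspace_N)
  fix W assume W: "openin N W"
  have "openin X {y \<in> U. (y, b y = c) \<in> W}"
  proof (subst openin_subopen, intro ballI)
    fix x assume x: "x \<in> {y \<in> U. (y, b y = c) \<in> W}"
    then obtain T where T: "openin X T" "x \<in> T" "T \<subseteq> U" "\<And>y. y \<in> T \<Longrightarrow> (y, b y = (b x = (b x = c))) \<in> W"
      using openin_ND[OF W _ Ub, of x "b x = c"] by blast
    have "(b x = (b x = c)) = c" by blast
    with T show "\<exists>T. openin X T \<and> x \<in> T \<and> T \<subseteq> {y \<in> U. (y, b y = c) \<in> W}"
      by (intro exI[of _ T]) auto
  qed
  moreover have "(\<lambda>y. (y, b y = c)) -` W \<inter> topspace (subtopology X U) = {y \<in> U. (y, b y = c) \<in> W}"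
    using UX by auto
  ultimately show "openin (subtopology X U) ((\<lambda>y. (y, b y = c)) -` W \<inter> topspace (subtopology X U))"
    using openin_open_subtopology[OF openin_chart[OF Ub]] by auto
qed

lemma double_covering_N: "double_covering N fst X"
  unfolding double_covering_def covering_map_def
proof (intro conjI ballI)
  show "continuous_map N X fst" by (rule continuous_map_fst_N)
  show "fst ` topspace N = topspace X" by (auto simp: topspace_N)
  fix x assume x: "x \<in> topspace X"
  have "{y \<in> topspace N. fst y = x} = {(x,True), (x,False)}" using x by (auto simp: topspace_N)
  then show "card {y \<in> topspace N. fst y = x} = 2" by simp
  obtain U b where Ub: "(U,b) \<in> \<B>" "x \<in> U" using cover[OF x] by blast
  have UX: "U \<subseteq> topspace X" using openin_subset[OF openin_chart[OF Ub(1)]] .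
  have homeo: "homeomorphic_map (subtopology N (sheet b c U)) (subtopology X U) fst" for c
  proof -
    have "homeomorphic_maps (subtopology N (sheet b c U)) (subtopology X U) fst (\<lambda>y. (y, b y = c))"
      unfolding homeomorphic_maps_def
    proof (intro conjI ballI)
      show "continuous_map (subtopology N (sheet b c U)) (subtopology X U) fst"
        using continuous_map_from_subtopology[OF continuous_map_fst_N]
        by (auto simp: continuous_map_in_subtopology sheet_def)
      show "continuous_map (subtopology X U) (subtopology N (sheet b c U)) (\<lambda>y. (y, b y = c))"
        using continuous_map_section[OF Ub(1)] by (auto simp: continuous_map_in_subtopology sheet_def)
    qed (auto simp: sheet_def)
    then show ?thesis by (rule homeomorphic_maps_imp_map)
  qed
  show "\<exists>T. x \<in> T \<and> openin X T \<and> (\<exists>v. \<Union>v = topspace N \<inter> fst -` T \<and> (\<forall>u\<in>v. openin N u) \<and> pairwise disjnt v \<and>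
             (\<forall>u\<in>v. homeomorphic_map (subtopology N u) (subtopology X T) fst))"
  proof (intro exI[of _ U] exI[of _ "{sheet b True U, sheet b False U}"] conjI ballI)
    show "\<Union>{sheet b True U, sheet b False U} = topspace N \<inter> fst -` U"
      using UX by (auto simp: sheet_def topspace_N image_iff)
    show "openin N u" if "u \<in> {sheet b True U, sheet b False U}" for u
      using that openin_sheet[OF Ub(1) openin_chart[OF Ub(1)] order_refl] by blast
    show "pairwise disjnt {sheet b True U, sheet b False U}"
      by (auto simp: pairwise_def disjnt_def sheet_def)
    show "homeomorphic_map (subtopology N u) (subtopology X U) fst" if "u \<in> {sheet b True U, sheet b False U}" for u
      using that homeo by blast
  qed (use Ub openin_chart in auto)
qed

text \<open>A sheet over a path-connected set is its image under a continuous section.\<close>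

lemma locally_path_connected_N:
  assumes lpc: "locally_path_connected_space X"
  shows "locally_path_connected_space N"
  unfolding locally_path_connected_space
proof (intro allI impI)
  fix W z assume W: "openin N W \<and> z \<in> W"
  obtain x e where z: "z = (x,e)" by fastforce
  have "x \<in> topspace X" using W z openin_subset[of N W] by (auto simp: topspace_N)
  then obtain U b where Ub: "(U,b) \<in> \<B>" "x \<in> U" using cover by blast
  obtain T where T: "openin X T" "x \<in> T" "T \<subseteq> U" "\<And>y. y \<in> T \<Longrightarrow> (y, b y = (b x = e)) \<in> W"
    using openin_ND[of W x e U b] W z Ub by blast
  obtain T' where T': "openin X T'" "path_connectedin X T'" "x \<in> T'" "T' \<subseteq> T"
    using lpc T(1,2) unfolding locally_path_connected_space by meson
  let ?V = "sheet b (b x = e) T'"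
  have TU: "T' \<subseteq> U" using T'(4) T(3) by blast
  have 1: "openin N ?V" by (rule openin_sheet[OF Ub(1) T'(1) TU])
  have "path_connectedin (subtopology X U) T'" using T'(2) TU by (simp add: path_connectedin_subtopology)
  then have 2: "path_connectedin N ?V"
    unfolding sheet_def by (rule path_connectedin_continuous_map_image[OF continuous_map_section[OF Ub(1)]])
  have "(b x = (b x = e)) = e" by blast
  then have 3: "z \<in> ?V" unfolding sheet_def z using T'(3) by (intro image_eqI[of _ _ x]) simp_all
  have 4: "?V \<subseteq> W" using T(4) T'(4) unfolding sheet_def by blast
  show "\<exists>V. openin N V \<and> path_connectedin N V \<and> z \<in> V \<and> V \<subseteq> W" using 1 2 3 4 by blast
qed

text \<open>Membership in a clopen part \<open>E1\<close> is constant along local sheets, so whether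
  \<open>E1\<close> separates the two points of a fibre is constant over \<open>X\<close>. If it
  never does, \<open>E1\<close> is a union of fibres and \<open>X\<close> would be disconnected; if
  it always does, \<open>E1\<close> picks one point of every fibre and trivializes the cover,
  against \<open>triv\<close>.\<close>

lemma connected_N:
  assumes X: "connected_space X"
    and triv: "\<And>\<rho>. \<not> (\<forall>U b x. (U,b) \<in> \<B> \<longrightarrow> x \<in> U \<longrightarrow>
      (\<exists>T. openin X T \<and> x \<in> T \<and> T \<subseteq> U \<and> (\<forall>y\<in>T. (\<rho> y = b y) = (\<rho> x = b x))))"
  shows "connected_space N"
proof (rule ccontr)
  assume "\<not> connected_space N"
  then obtain E1 E2 where E: "openin N E1" "openin N E2" "topspace N \<subseteq> E1 \<union> E2" "E1 \<inter> E2 = {}" "E1 \<noteq> {}" "E2 \<noteq> {}"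
    unfolding connected_space_def not_not by (elim exE conjE) (rule that)
  \<comment> \<open>Openness of \<open>E1\<close> carries membership along the sheet, openness of
    \<open>E2\<close> carries non-membership; intersecting two neighbourhoods treats both labels at
    once.\<close>
  have loc: "\<exists>T. openin X T \<and> x \<in> T \<and> T \<subseteq> U \<and> (\<forall>y\<in>T. \<forall>e. ((y, b y = (b x = e)) \<in> E1) = ((x,e) \<in> E1))"
    if Ub: "(U,b) \<in> \<B>" and x: "x \<in> U" for U b x
  proof -
    have one: "\<exists>T. openin X T \<and> x \<in> T \<and> T \<subseteq> U \<and> (\<forall>y\<in>T. ((y, b y = (b x = e)) \<in> E1) = ((x,e) \<in> E1))" for e
    proof (cases "(x,e) \<in> E1")
      case True
      obtain T where T: "openin X T" "x \<in> T" "T \<subseteq> U" "\<And>y. y \<in> T \<Longrightarrow> (y, b y = (b x = e)) \<in> E1"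
        by (rule openin_ND[OF E(1) True Ub x]) (rule that)
      then show ?thesis using True by (intro exI[of _ T] conjI ballI) simp_all
    next
      case False
      have "x \<in> topspace X" using openin_subset[OF openin_chart[OF Ub]] x by blast
      then have xE: "(x,e) \<in> E2" using E(3) False by (auto simp: topspace_N)
      obtain T where T: "openin X T" "x \<in> T" "T \<subseteq> U" "\<And>y. y \<in> T \<Longrightarrow> (y, b y = (b x = e)) \<in> E2"
        by (rule openin_ND[OF E(2) xE Ub x]) (rule that)
      have "(y, b y = (b x = e)) \<notin> E1" if "y \<in> T" for y using T(4)[OF that] E(4) by blast
      then show ?thesis using False T by (intro exI[of _ T] conjI ballI) simp_all
    qed
    obtain T1 where T1: "openin X T1" "x \<in> T1" "T1 \<subseteq> U" "\<forall>y\<in>T1. ((y, b y = (b x = True)) \<in> E1) = ((x,True) \<in> E1)"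
      using one[of True] by (elim exE conjE)
    obtain T2 where T2: "openin X T2" "x \<in> T2" "T2 \<subseteq> U" "\<forall>y\<in>T2. ((y, b y = (b x = False)) \<in> E1) = ((x,False) \<in> E1)"
      using one[of False] by (elim exE conjE)
    show ?thesis
    proof (intro exI conjI ballI allI)
      show "openin X (T1 \<inter> T2)" using T1(1) T2(1) by (rule openin_Int)
      show "x \<in> T1 \<inter> T2" using T1(2) T2(2) by (rule IntI)
      show "T1 \<inter> T2 \<subseteq> U" using T1(3) by blast
      fix y e assume y: "y \<in> T1 \<inter> T2"
      show "((y, b y = (b x = e)) \<in> E1) = ((x,e) \<in> E1)"
        using bspec[OF T1(4) IntD1[OF y]] bspec[OF T2(4) IntD2[OF y]] by (cases e) simp_all
    qed
  qed
  define u where "u x = (((x,True) \<in> E1) = ((x,False) \<in> E1))" for x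
  have lift: "locally_constant X f" if f: "\<And>U b x y. \<lbrakk>(U,b) \<in> \<B>; x \<in> U; y \<in> U; \<And>e. ((y, b y = (b x = e)) \<in> E1) = ((x,e) \<in> E1)\<rbrakk> \<Longrightarrow> f y = f x"
    for f :: "'a \<Rightarrow> bool"
    unfolding locally_constant_def
  proof
    fix x assume "x \<in> topspace X"
    then obtain U b where Ub: "(U,b) \<in> \<B>" "x \<in> U" using cover by blast
    obtain T where T: "openin X T" "x \<in> T" "T \<subseteq> U" "\<forall>y\<in>T. \<forall>e. ((y, b y = (b x = e)) \<in> E1) = ((x,e) \<in> E1)"
      using loc[OF Ub] by (elim exE conjE)
    have "f y = f x" if "y \<in> T" for y
    proof (rule f[OF Ub])
      show "y \<in> U" using T(3) that by blast
      show "((y, b y = (b x = e)) \<in> E1) = ((x,e) \<in> E1)" for e using T(4) that by blast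
    qed
    then show "\<exists>T. openin X T \<and> x \<in> T \<and> (\<forall>y\<in>T. f y = f x)" using T(1,2) by (intro exI[of _ T] conjI ballI)
  qed
  have u_eq: "u y = u x" if e: "\<And>e. ((y, b y = (b x = e)) \<in> E1) = ((x,e) \<in> E1)" for b x y
    using e[of True] e[of False] unfolding u_def by (cases "b y"; cases "b x") auto
  have u: "locally_constant X u" by (rule lift) (rule u_eq)
  obtain x0 e0 where x0: "(x0,e0) \<in> E1" using E(5) by auto
  obtain x1 e1 where x1: "(x1,e1) \<in> E2" using E(6) by auto
  have x01: "x0 \<in> topspace X" "x1 \<in> topspace X"
    using openin_subset[OF E(1)] openin_subset[OF E(2)] x0 x1 by (auto simp: topspace_N)
  have uc: "u x = u x0" if "x \<in> topspace X" for x
    using locally_constant_imp_constant[OF X u that x01(1)] .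
  show False
  proof (cases "u x0")
    case True
    then have ux: "((x,True) \<in> E1) = ((x,False) \<in> E1)" if "x \<in> topspace X" for x using uc[OF that] by (simp add: u_def)
    \<comment> \<open>In this case \<open>E1\<close> is a union of fibres, and \<open>v\<close>
      describes its image in \<open>X\<close>.\<close>
    define v where "v x = ((x,True) \<in> E1 \<and> (x,False) \<in> E1)" for x
    have v_eq: "v y = v x" if e: "\<And>e. ((y, b y = (b x = e)) \<in> E1) = ((x,e) \<in> E1)" for b x y
      using e[of True] e[of False] unfolding v_def by (cases "b y"; cases "b x") auto
    have "locally_constant X v" by (rule lift) (rule v_eq)
    from locally_constant_imp_constant[OF X this x01] have "v x0 = v x1" .
    moreover have "v x0" using x0 ux[OF x01(1)] unfolding v_def by (cases e0) auto
    moreover have "\<not> v x1"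
    proof
      assume "v x1"
      then have "(x1,e1) \<in> E1" unfolding v_def by (cases e1) auto
      then show False using x1 E(4) by blast
    qed
    ultimately show False by simp
  next
    case False
    then have ux: "((x,True) \<in> E1) = ((x,False) \<notin> E1)" if "x \<in> topspace X" for x using uc[OF that] by (auto simp: u_def)
    \<comment> \<open>Now \<open>E1\<close> is the graph of a section; \<open>\<rho>\<close> tells
      whether it takes the label True.\<close>
    define \<rho> where "\<rho> x = ((x,True) \<in> E1)" for x
    have "\<forall>U b x. (U,b) \<in> \<B> \<longrightarrow> x \<in> U \<longrightarrow>
      (\<exists>T. openin X T \<and> x \<in> T \<and> T \<subseteq> U \<and> (\<forall>y\<in>T. (\<rho> y = b y) = (\<rho> x = b x)))"
    proof (intro allI impI)
      fix U b x assume Ub: "(U,b) \<in> \<B>" "x \<in> U"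
      obtain T where T: "openin X T" "x \<in> T" "T \<subseteq> U" "\<forall>y\<in>T. \<forall>e. ((y, b y = (b x = e)) \<in> E1) = ((x,e) \<in> E1)"
        using loc[OF Ub] by (elim exE conjE)
      have "(\<rho> y = b y) = (\<rho> x = b x)" if y: "y \<in> T" for y
      proof -
        have "y \<in> topspace X" using openin_subset[OF T(1)] y by blast
        from ux[OF this] T(4)[rule_format, OF y, of True]
        show ?thesis unfolding \<rho>_def by (cases "b y"; cases "b x") auto
      qed
      then show "\<exists>T. openin X T \<and> x \<in> T \<and> T \<subseteq> U \<and> (\<forall>y\<in>T. (\<rho> y = b y) = (\<rho> x = b x))"
        using T(1-3) by (intro exI[of _ T] conjI ballI)
    qed
    with triv show False by blast
  qed
qed

end

text \<open>In a triple \<open>(U,s,a)\<close> the function \<open>s\<close> is the side of \<open>S\<close>, vanishing on \<open>S\<close>, and \<open>a\<close> is a local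
  trivialization of the cover of \<open>\<alpha>\<close>; by \<open>a_S\<close> these agree along \<open>S\<close>, where \<open>\<alpha>\<close> is trivial.\<close>
locale sided_atlas =
  fixes X :: "'a topology" and S :: "'a set" and \<P> :: "('a set \<times> ('a \<Rightarrow> real) \<times> ('a \<Rightarrow> real)) set"
  assumes connX: "connected_space X" and SX: "S \<subseteq> topspace X" and connS: "connectedin X S" and Sne: "S \<noteq> {}"
    and op: "(U,s,a) \<in> \<P> \<Longrightarrow> openin X U" and conn: "(U,s,a) \<in> \<P> \<Longrightarrow> connectedin X U"
    and cov: "x \<in> topspace X \<Longrightarrow> \<exists>U s a. (U,s,a) \<in> \<P> \<and> x \<in> U"
    and aval: "\<lbrakk>(U,s,a) \<in> \<P>; x \<in> U\<rbrakk> \<Longrightarrow> a x = 1 \<or> a x = -1"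
    and sS: "\<lbrakk>(U,s,a) \<in> \<P>; x \<in> U; x \<in> S\<rbrakk> \<Longrightarrow> s x = 0"
    and sN: "\<lbrakk>(U,s,a) \<in> \<P>; x \<in> U; x \<notin> S\<rbrakk> \<Longrightarrow> s x = 1 \<or> s x = -1"
    and a_compat: "\<lbrakk>(U,s,a) \<in> \<P>; (V,t,c) \<in> \<P>; x \<in> U; x \<in> V\<rbrakk> \<Longrightarrow>
      \<exists>T. openin X T \<and> x \<in> T \<and> T \<subseteq> U \<inter> V \<and> (\<forall>y\<in>T. a y * c y = a x * c x)"
    and a_S: "\<lbrakk>(U,s,a) \<in> \<P>; (V,t,c) \<in> \<P>; x \<in> U; x \<in> V; x \<in> S\<rbrakk> \<Longrightarrow> a x = c x"
    and s_off: "\<lbrakk>(U,s,a) \<in> \<P>; x \<in> U; x \<notin> S\<rbrakk> \<Longrightarrow> \<exists>T. openin X T \<and> x \<in> T \<and> T \<subseteq> U \<and> (\<forall>y\<in>T. s y = s x)"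
    and s_compat: "\<lbrakk>(U,s,a) \<in> \<P>; (V,t,c) \<in> \<P>; x \<in> U; x \<in> V; x \<in> S\<rbrakk> \<Longrightarrow>
      \<exists>q T. (q = 1 \<or> q = -1) \<and> openin X T \<and> x \<in> T \<and> T \<subseteq> U \<inter> V \<and> (\<forall>y\<in>T. s y = q * t y)"
    and thin: "\<lbrakk>openin X T; x \<in> T; x \<in> S\<rbrakk> \<Longrightarrow> \<exists>y\<in>T. y \<notin> S"
begin

definition side_sign :: "('a \<Rightarrow> real) \<Rightarrow> ('a \<Rightarrow> real) \<Rightarrow> 'a \<Rightarrow> real \<Rightarrow> bool" where
  "side_sign s t x q \<longleftrightarrow> (q = 1 \<or> q = -1) \<and> (\<exists>T. openin X T \<and> x \<in> T \<and> (\<forall>y\<in>T. s y = q * t y))"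

text \<open>A side of \<open>S\<close> is chosen arbitrarily at each of its points; \<open>transition\<close> records whether
  the positive side of a chart agrees with it.\<close>
definition preferred_side :: "'a \<Rightarrow> 'a \<Rightarrow> real" where
  "preferred_side x = (SOME s. \<exists>U a. (U,s,a) \<in> \<P> \<and> x \<in> U)"

definition transition :: "('a \<Rightarrow> real) \<Rightarrow> ('a \<Rightarrow> real) \<Rightarrow> 'a \<Rightarrow> real" where
  "transition s a y = a y * (if y \<in> S then (SOME q. side_sign s (preferred_side y) y q) else s y)"

lemma preferred_side: "x \<in> topspace X \<Longrightarrow> \<exists>U a. (U,preferred_side x,a) \<in> \<P> \<and> x \<in> U"
proof -
  assume "x \<in> topspace X"
  from cov[OF this] have "\<exists>s U a. (U,s,a) \<in> \<P> \<and> x \<in> U" by blast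
  from someI_ex[OF this] show ?thesis unfolding preferred_side_def .
qed

lemma side_sign_ex:
  assumes p: "(U,s,a) \<in> \<P>" "x \<in> U" "x \<in> S"
  shows "side_sign s (preferred_side x) x (SOME q. side_sign s (preferred_side x) x q)"
proof (rule someI_ex)
  obtain V c where V: "(V,preferred_side x,c) \<in> \<P>" "x \<in> V" using preferred_side p(3) SX by blast
  from s_compat[OF p(1) V(1) p(2) V(2) p(3)]
  show "\<exists>q. side_sign s (preferred_side x) x q" unfolding side_sign_def by blast
qed

lemma transition_val: "\<lbrakk>(U,s,a) \<in> \<P>; x \<in> U\<rbrakk> \<Longrightarrow> transition s a x = 1 \<or> transition s a x = -1"
  using aval[of U s a x] sN[of U s a x] side_sign_ex[of U s a x] unfolding transition_def side_sign_def
  by (cases "x \<in> S") auto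

lemma transition_square: "\<lbrakk>(U,s,a) \<in> \<P>; x \<in> U\<rbrakk> \<Longrightarrow> transition s a x * transition s a x = 1"
  using transition_val by fastforce

text \<open>The sign relating two charts at \<open>S\<close> equals the product of their signs
  relative to the preferred side. It can be read off at points outside \<open>S\<close>, where side
  functions are nonzero and which \<open>thin\<close> provides arbitrarily near. The factors
  \<open>a\<close> and \<open>c\<close> cancel because they agree on \<open>S\<close> and their
  product is locally constant.\<close>

lemma transition_at_S:
  assumes p: "(U,s,a) \<in> \<P>" "(V,t,c) \<in> \<P>" and x: "x \<in> U" "x \<in> V" "x \<in> S"
  obtains T q where "q = 1 \<or> q = -1" "openin X T" "x \<in> T" "T \<subseteq> U \<inter> V"
    "\<And>y. y \<in> T \<Longrightarrow> s y = q * t y" "\<And>y. y \<in> T \<Longrightarrow> transition s a y * transition t c y = q"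
proof -
  obtain q T1 where T1: "q = 1 \<or> q = -1" "openin X T1" "x \<in> T1" "T1 \<subseteq> U \<inter> V" "\<forall>y\<in>T1. s y = q * t y"
    using s_compat[OF p x] by (elim exE conjE)
  obtain T2 where T2: "openin X T2" "x \<in> T2" "T2 \<subseteq> U \<inter> V" "\<forall>y\<in>T2. a y * c y = a x * c x"
    using a_compat[OF p x(1,2)] by (elim exE conjE)
  have qq: "q * q = 1" using T1(1) by auto
  have "a x * c x = 1" using a_S[OF p x] aval[OF p(2) x(2)] by auto
  then have ac: "a y * c y = 1" if "y \<in> T2" for y using bspec[OF T2(4) that] by simp
  have "transition s a y * transition t c y = q" if y: "y \<in> T1 \<inter> T2" for y
  proof -
    have yU: "y \<in> U" "y \<in> V" using y T1(4) by auto
    have st: "s y = q * t y" by (rule bspec[OF T1(5)]) (use y in simp)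
    have acy: "a y * c y = 1" using ac y by simp
    show ?thesis
    proof (cases "y \<in> S")
      case False
      have "t y * t y = 1" using sN[OF p(2) yU(2) False] by auto
      then have "(a y * s y) * (c y * t y) = q" using st acy
        by (metis (no_types, opaque_lifting) mult.assoc mult.commute mult.left_neutral)
      then show ?thesis using False by (simp add: transition_def)
    next
      case True
      define qs qt where "qs = (SOME q. side_sign s (preferred_side y) y q)" and "qt = (SOME q. side_sign t (preferred_side y) y q)"
      have s: "side_sign s (preferred_side y) y qs" and t: "side_sign t (preferred_side y) y qt"
        unfolding qs_def qt_def using side_sign_ex[OF p(1) yU(1) True] side_sign_ex[OF p(2) yU(2) True] by blast+
      obtain R1 where R1: "openin X R1" "y \<in> R1" "\<forall>z\<in>R1. s z = qs * preferred_side y z"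
        using s unfolding side_sign_def by blast
      obtain R2 where R2: "openin X R2" "y \<in> R2" "\<forall>z\<in>R2. t z = qt * preferred_side y z"
        using t unfolding side_sign_def by blast
      have "openin X (T1 \<inter> (R1 \<inter> R2))" using T1(2) R1(1) R2(1) by blast
      \<comment> \<open>A point off \<open>S\<close> at which all three sign relations hold at
        once.\<close>
      then obtain z where z: "z \<in> T1" "z \<in> R1" "z \<in> R2" "z \<notin> S" using thin[of "T1 \<inter> (R1 \<inter> R2)" y] y R1(2) R2(2) True by blast
      have "z \<in> V" using z T1(4) by blast
      then have "t z \<noteq> 0" using sN[OF p(2) _ z(4)] by force
      moreover have "s z = q * t z" "s z = qs * preferred_side y z" "t z = qt * preferred_side y z"
        using T1(5) R1(3) R2(3) z by blast+
      ultimately have "qs = q * qt" by auto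
      moreover have "qt * qt = 1" using t unfolding side_sign_def by auto
      ultimately have "qs * qt = q" by simp
      then have "(a y * qs) * (c y * qt) = q" using acy
        by (metis (no_types, opaque_lifting) mult.assoc mult.commute mult.left_neutral)
      then show ?thesis using True by (simp add: transition_def qs_def qt_def)
    qed
  qed
  moreover have "openin X (T1 \<inter> T2)" using T1(2) T2(1) by (rule openin_Int)
  moreover have "s y = q * t y" if "y \<in> T1 \<inter> T2" for y using T1(5) that by blast
  ultimately show thesis using that[of q "T1 \<inter> T2"] T1(1,3,4) T2(2) by blast
qed

lemma transition_off_S:
  assumes p: "(U,s,a) \<in> \<P>" "(V,t,c) \<in> \<P>" and x: "x \<in> U" "x \<in> V" "x \<notin> S"
  obtains T where "openin X T" "x \<in> T" "T \<subseteq> U \<inter> V" "\<And>y. y \<in> T \<Longrightarrow> y \<notin> S"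
    "\<And>y. y \<in> T \<Longrightarrow> s y = s x" "\<And>y. y \<in> T \<Longrightarrow> t y = t x"
    "\<And>y. y \<in> T \<Longrightarrow> transition s a y * transition t c y = transition s a x * transition t c x"
proof -
  obtain T1 where T1: "openin X T1" "x \<in> T1" "T1 \<subseteq> U" "\<forall>y\<in>T1. s y = s x" using s_off[OF p(1) x(1,3)] by (elim exE conjE)
  obtain T2 where T2: "openin X T2" "x \<in> T2" "T2 \<subseteq> V" "\<forall>y\<in>T2. t y = t x" using s_off[OF p(2) x(2,3)] by (elim exE conjE)
  obtain T3 where T3: "openin X T3" "x \<in> T3" "T3 \<subseteq> U \<inter> V" "\<forall>y\<in>T3. a y * c y = a x * c x"
    using a_compat[OF p x(1,2)] by (elim exE conjE)
  let ?T = "T1 \<inter> (T2 \<inter> T3)"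
  have sT: "s y = s x" "t y = t x" "a y * c y = a x * c x" if "y \<in> ?T" for y
    using bspec[OF T1(4), of y] bspec[OF T2(4), of y] bspec[OF T3(4), of y] that by auto
  have nS: "y \<notin> S" if "y \<in> ?T" for y
  proof
    assume "y \<in> S"
    then have "s y = 0" using sS[OF p(1), of y] that T1(3) by blast
    then show False using sT(1)[OF that] sN[OF p(1) x(1,3)] by auto
  qed
  have "transition s a y * transition t c y = transition s a x * transition t c x" if "y \<in> ?T" for y
  proof -
    have "transition s a y * transition t c y = (a y * c y) * (s y * t y)"
      using nS[OF that] by (simp add: transition_def)
    also have "\<dots> = (a x * c x) * (s x * t x)" unfolding sT[OF that] ..
    finally show ?thesis using x(3) by (simp add: transition_def)
  qed
  moreover have "openin X ?T" using T1(1) T2(1) T3(1) by blast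
  ultimately show thesis using that[of ?T] sT(1,2) nS T1(2) T2(2) T3(2,3) by blast
qed

text \<open>The first conclusion makes the signs of \<open>transition\<close> a double cover atlas;
  the second is the cocycle condition for the lifted side functions. At a point of \<open>S\<close>
  the latter holds because \<open>s\<close> and \<open>t\<close> differ by exactly the sign of the
  cover, which relies on the character being trivial along \<open>S\<close>. Off \<open>S\<close>
  all terms are locally constant.\<close>

lemma transition_compat:
  assumes p: "(U,s,a) \<in> \<P>" "(V,t,c) \<in> \<P>" and x: "x \<in> U" "x \<in> V"
  obtains T where "openin X T" "x \<in> T" "T \<subseteq> U \<inter> V"
    "\<And>y. y \<in> T \<Longrightarrow> transition s a y * transition t c y = transition s a x * transition t c x"
    "\<And>y. y \<in> T \<Longrightarrow> s y - transition s a y * transition t c y * t y = s x - transition s a x * transition t c x * t x"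
proof (cases "x \<in> S")
  case True
  obtain T q where T: "q = 1 \<or> q = -1" "openin X T" "x \<in> T" "T \<subseteq> U \<inter> V"
    "\<And>y. y \<in> T \<Longrightarrow> s y = q * t y" "\<And>y. y \<in> T \<Longrightarrow> transition s a y * transition t c y = q"
    by (rule transition_at_S[OF p x True]) (rule that)
  have "transition s a y * transition t c y = transition s a x * transition t c x" if "y \<in> T" for y
    unfolding T(6)[OF that] T(6)[OF T(3)] ..
  moreover have "s y - transition s a y * transition t c y * t y = s x - transition s a x * transition t c x * t x" if "y \<in> T" for y
    unfolding T(6)[OF that] T(6)[OF T(3)] T(5)[OF that] T(5)[OF T(3)] by simp
  ultimately show thesis using that[OF T(2-4)] by blast
next
  case False
  obtain T where T: "openin X T" "x \<in> T" "T \<subseteq> U \<inter> V" "\<And>y. y \<in> T \<Longrightarrow> y \<notin> S"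
    "\<And>y. y \<in> T \<Longrightarrow> s y = s x" "\<And>y. y \<in> T \<Longrightarrow> t y = t x"
    "\<And>y. y \<in> T \<Longrightarrow> transition s a y * transition t c y = transition s a x * transition t c x"
    by (rule transition_off_S[OF p x False]) (rule that)
  have "s y - transition s a y * transition t c y * t y = s x - transition s a x * transition t c x * t x" if "y \<in> T" for y
    unfolding T(5)[OF that] T(6)[OF that] T(7)[OF that] ..
  with T(7) show thesis using that[OF T(1-3)] by blast
qed

end

section \<open>The double cover and its cocycle\<close>

context sided_atlas begin

definition cover_charts :: "('a set \<times> ('a \<Rightarrow> bool)) set" where
  "cover_charts = {(U, \<lambda>y. transition s a y > 0) | U s a. (U,s,a) \<in> \<P>}"

lemma cover_chartI: "(U,s,a) \<in> \<P> \<Longrightarrow> (U, \<lambda>y. transition s a y > 0) \<in> cover_charts"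
  unfolding cover_charts_def mem_Collect_eq by (intro exI conjI) (rule refl, assumption)

lemma cover_chartE:
  assumes "(U,b) \<in> cover_charts"
  obtains s a where "(U,s,a) \<in> \<P>" "b = (\<lambda>y. transition s a y > 0)"
  using assms unfolding cover_charts_def mem_Collect_eq prod.inject by (elim exE conjE) (rule that, simp_all)

lemma sign_eq_iff: "\<lbrakk>p = 1 \<or> p = -1; q = 1 \<or> q = -1\<rbrakk> \<Longrightarrow> (p > 0) = (q > 0) \<longleftrightarrow> p * q = (1::real)"
  by auto

sublocale double_cover_atlas X cover_charts
proof
  fix U b assume "(U,b) \<in> cover_charts"
  then show "openin X U" by (rule cover_chartE) (rule op)
next
  fix x assume "x \<in> topspace X"
  then obtain U s a where "(U,s,a) \<in> \<P>" "x \<in> U" using cov by blast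
  then show "\<exists>U b. (U,b) \<in> cover_charts \<and> x \<in> U" using cover_chartI by (intro exI conjI)
next
  fix U b V c x assume *: "(U,b) \<in> cover_charts" "(V,c) \<in> cover_charts" "x \<in> U" "x \<in> V"
  obtain s a where p1: "(U,s,a) \<in> \<P>" and b1: "b = (\<lambda>y. transition s a y > 0)" using *(1) by (rule cover_chartE)
  obtain t d where p2: "(V,t,d) \<in> \<P>" and b2: "c = (\<lambda>y. transition t d y > 0)" using *(2) by (rule cover_chartE)
  note p = p1 p2 and b = b1 b2
  obtain T where T: "openin X T" "x \<in> T" "T \<subseteq> U \<inter> V"
    "\<And>y. y \<in> T \<Longrightarrow> transition s a y * transition t d y = transition s a x * transition t d x"
    by (rule transition_compat[OF p *(3,4)]) (rule that)
  have "(b y = c y) = (b x = c x)" if y: "y \<in> T" for y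
  proof -
    have "y \<in> U" "y \<in> V" using y T(3) by auto
    then show ?thesis
      unfolding b using sign_eq_iff[OF transition_val[OF p(1)] transition_val[OF p(2)]] T(4)[OF y] *(3,4) by simp
  qed
  then show "\<exists>T. openin X T \<and> x \<in> T \<and> T \<subseteq> U \<inter> V \<and> (\<forall>y\<in>T. (b y = c y) = (b x = c x))"
    using T(1-3) by (intro exI[of _ T] conjI ballI)
qed

definition sheet_sign :: "bool \<Rightarrow> real" where "sheet_sign e = (if e then 1 else -1)"

text \<open>Turns the Boolean rule for following a sheet into multiplication of signs.\<close>

lemma sheet_sign_section:
  assumes "(U,s,a) \<in> \<P>" "x \<in> U" "y \<in> U"
  shows "sheet_sign ((transition s a y > 0) = ((transition s a x > 0) = e)) = sheet_sign e * transition s a x * transition s a y"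
  using transition_val[OF assms(1,2)] transition_val[OF assms(1,3)] by (cases e) (auto simp: sheet_sign_def)

text \<open>On the sheet through \<open>(x,e)\<close> this is \<open>\<plusminus>s\<close>: the preimage of \<open>S\<close> is two-sided in the cover,
  because the sheets over a point of \<open>S\<close> correspond to the two local sides of \<open>S\<close>.\<close>
definition cover_potential :: "('a \<Rightarrow> real) \<Rightarrow> ('a \<Rightarrow> real) \<Rightarrow> 'a \<times> bool \<Rightarrow> real" where
  "cover_potential s a z = sheet_sign (snd z) * transition s a (fst z) * s (fst z)"

definition cover_potentials :: "(('a \<times> bool) set \<times> ('a \<times> bool \<Rightarrow> real)) set" where
  "cover_potentials = {(U \<times> UNIV, cover_potential s a) | U s a. (U,s,a) \<in> \<P>}"

lemma cover_potentialsI: "(U,s,a) \<in> \<P> \<Longrightarrow> (U \<times> UNIV, cover_potential s a) \<in> cover_potentials"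
  unfolding cover_potentials_def mem_Collect_eq by (intro exI conjI) (rule refl, assumption)

lemma cover_potentialsE:
  assumes "(W,F) \<in> cover_potentials"
  obtains U s a where "W = U \<times> UNIV" "F = cover_potential s a" "(U,s,a) \<in> \<P>"
  using assms unfolding cover_potentials_def mem_Collect_eq prod.inject by (elim exE conjE) (rule that)

text \<open>Along a sheet the difference of two lifted side functions is a fixed sign times the
  difference controlled by \<open>transition_compat\<close>.\<close>

lemma potential_atlas_N: "potential_atlas N cover_potentials"
  unfolding potential_atlas_def
proof (intro conjI allI impI ballI)
  fix U F assume "(U,F) \<in> cover_potentials"
  then show "openin N U" by (rule cover_potentialsE) (simp add: openin_N_vimage op)
next
  fix z assume "z \<in> topspace N"
  then have "fst z \<in> topspace X" by (auto simp: topspace_N)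
  then obtain U s a where "(U,s,a) \<in> \<P>" "fst z \<in> U" using cov by blast
  then show "\<exists>U F. (U,F) \<in> cover_potentials \<and> z \<in> U"
    using cover_potentialsI by (intro exI[of _ "U \<times> UNIV"] exI[of _ "cover_potential s a"]) (cases z, simp)
next
  fix U' F V' H z assume *: "(U',F) \<in> cover_potentials" "(V',H) \<in> cover_potentials" "z \<in> U'" "z \<in> V'"
  obtain x e where z: "z = (x,e)" by fastforce
  obtain U s a where U: "U' = U \<times> UNIV" "F = cover_potential s a" "(U,s,a) \<in> \<P>" using *(1) by (rule cover_potentialsE)
  obtain V t c where V: "V' = V \<times> UNIV" "H = cover_potential t c" "(V,t,c) \<in> \<P>" using *(2) by (rule cover_potentialsE)
  have xUV: "x \<in> U" "x \<in> V" using * U V z by auto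
  obtain T where T: "openin X T" "x \<in> T" "T \<subseteq> U \<inter> V"
    "\<And>y. y \<in> T \<Longrightarrow> s y - transition s a y * transition t c y * t y = s x - transition s a x * transition t c x * t x"
    by (rule transition_compat[OF U(3) V(3) xUV]) (rule that)
  let ?b = "\<lambda>y. transition s a y > 0"
  let ?W = "sheet ?b (?b x = e) T"
  have eq: "F (y, e') - H (y, e') = sheet_sign e * transition s a x * (s y - transition s a y * transition t c y * t y)"
    if y: "y \<in> T" and e': "e' = (?b y = (?b x = e))" for y e'
  proof -
    have yU: "y \<in> U" using y T(3) by blast
    have sq: "transition s a y * transition s a y = 1" by (rule transition_square[OF U(3) yU])
    have se: "sheet_sign e' = sheet_sign e * transition s a x * transition s a y"
      unfolding e' by (rule sheet_sign_section[OF U(3) xUV(1) yU])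
    have "F (y, e') = sheet_sign e * transition s a x * (transition s a y * transition s a y) * s y"
      unfolding U(2) cover_potential_def fst_conv snd_conv se by (simp add: mult.assoc)
    moreover have "H (y, e') = sheet_sign e * transition s a x * (transition s a y * transition t c y * t y)"
      unfolding V(2) cover_potential_def fst_conv snd_conv se by (simp add: mult.assoc)
    ultimately show ?thesis unfolding sq by (simp add: right_diff_distrib)
  qed
  show "\<exists>T. openin N T \<and> z \<in> T \<and> T \<subseteq> U' \<inter> V' \<and> (\<forall>y\<in>T. F y - H y = F z - H z)"
  proof (intro exI conjI ballI)
    show "openin N ?W" by (rule openin_sheet[OF cover_chartI[OF U(3)] T(1)]) (use T(3) in blast)
    have "e = (?b x = (?b x = e))" by blast
    then show "z \<in> ?W" unfolding sheet_def z using T(2) by (intro image_eqI[of _ _ x]) simp_all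
    show "?W \<subseteq> U' \<inter> V'" using T(3) U(1) V(1) by (auto simp: sheet_def)
    fix w assume "w \<in> ?W"
    then obtain y where y: "y \<in> T" "w = (y, ?b y = (?b x = e))" unfolding sheet_def by blast
    have 1: "F w - H w = sheet_sign e * transition s a x * (s y - transition s a y * transition t c y * t y)"
      unfolding y(2) by (rule eq[OF y(1) refl])
    have 2: "F z - H z = sheet_sign e * transition s a x * (s x - transition s a x * transition t c x * t x)"
      unfolding z by (rule eq[OF T(2)]) blast
    show "F w - H w = F z - H z" unfolding 1 2 T(4)[OF y(1)] ..
  qed
qed

text \<open>Exchanging the labels reverses the sign of \<open>cover_potential\<close>, so half the
  difference of \<open>\<Psi>\<close> over a fibre is odd under the deck transformation and still a
  primitive. Multiplying it by \<open>transition\<close> gives its value on a sheet of the chart,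
  comparable with \<open>s\<close>.\<close>

lemma potential_antisymmetrized:
  assumes \<Psi>: "is_potential cover_potentials N id \<Psi>" and p: "(U,s,a) \<in> \<P>"
  defines "\<Phi> \<equiv> \<lambda>x. (\<Psi> (x,True) - \<Psi> (x,False)) / 2"
  shows "locally_constant (subtopology X U) (\<lambda>x. transition s a x * \<Phi> x - s x)"
  unfolding locally_constant_def
proof
  fix x assume "x \<in> topspace (subtopology X U)"
  then have x: "x \<in> U" "x \<in> topspace X" by auto
  let ?b = "\<lambda>y. transition s a y > 0"
  let ?\<beta> = "transition s a"
  have pc: "(U \<times> UNIV, cover_potential s a) \<in> cover_potentials" using p by (rule cover_potentialsI)
  have one: "\<exists>T. openin X T \<and> x \<in> T \<and> T \<subseteq> U \<and>
     (\<forall>y\<in>T. \<Psi> (y, ?b y = (?b x = e)) = sheet_sign e * ?\<beta> x * (s y - s x) + \<Psi> (x,e))" for e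
  proof -
    have xe: "(x,e) \<in> topspace N" "id (x,e) \<in> U \<times> UNIV" using x by (auto simp: topspace_N)
    obtain W where W: "openin N W" "(x,e) \<in> W"
      "\<And>w. w \<in> W \<Longrightarrow> cover_potential s a (id w) - \<Psi> w = cover_potential s a (id (x,e)) - \<Psi> (x,e)"
      by (rule is_potential_any_chart[OF potential_atlas_N continuous_map_id \<Psi> xe(1) pc xe(2)]) (rule that)
    obtain T where T: "openin X T" "x \<in> T" "T \<subseteq> U" "\<And>y. y \<in> T \<Longrightarrow> (y, ?b y = (?b x = e)) \<in> W"
      by (rule openin_ND[OF W(1,2) cover_chartI[OF p] x(1)]) (rule that)
    have "\<Psi> (y, ?b y = (?b x = e)) = sheet_sign e * ?\<beta> x * (s y - s x) + \<Psi> (x,e)" if y: "y \<in> T" for y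
    proof -
      have yU: "y \<in> U" using y T(3) by blast
      have "cover_potential s a (y, ?b y = (?b x = e)) = sheet_sign e * ?\<beta> x * (?\<beta> y * ?\<beta> y) * s y"
        unfolding cover_potential_def fst_conv snd_conv sheet_sign_section[OF p x(1) yU] by (simp add: mult.assoc)
      then have "cover_potential s a (y, ?b y = (?b x = e)) = sheet_sign e * ?\<beta> x * s y"
        unfolding transition_square[OF p yU] by simp
      moreover have "cover_potential s a (x,e) = sheet_sign e * ?\<beta> x * s x" by (simp add: cover_potential_def)
      ultimately show ?thesis using W(3)[OF T(4)[OF y]] by (simp add: right_diff_distrib)
    qed
    then show ?thesis using T(1-3) by (intro exI[of _ T] conjI ballI)
  qed
  obtain T1 where T1: "openin X T1" "x \<in> T1" "T1 \<subseteq> U"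
    "\<forall>y\<in>T1. \<Psi> (y, ?b y = (?b x = True)) = sheet_sign True * ?\<beta> x * (s y - s x) + \<Psi> (x,True)"
    using one[of True] by (elim exE conjE)
  obtain T2 where T2: "openin X T2" "x \<in> T2" "T2 \<subseteq> U"
    "\<forall>y\<in>T2. \<Psi> (y, ?b y = (?b x = False)) = sheet_sign False * ?\<beta> x * (s y - s x) + \<Psi> (x,False)"
    using one[of False] by (elim exE conjE)
  show "\<exists>T. openin (subtopology X U) T \<and> x \<in> T \<and> (\<forall>y\<in>T. ?\<beta> y * \<Phi> y - s y = ?\<beta> x * \<Phi> x - s x)"
  proof (intro exI conjI ballI)
    show "openin (subtopology X U) (T1 \<inter> T2)"
      using T1(1,3) T2(1) op[OF p] by (auto simp: openin_open_subtopology)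
    show "x \<in> T1 \<inter> T2" using T1(2) T2(2) by simp
    fix y assume y: "y \<in> T1 \<inter> T2"
    have yU: "y \<in> U" using y T1(3) by blast
    have 1: "\<Psi> (y, ?b y = ?b x) = ?\<beta> x * (s y - s x) + \<Psi> (x,True)"
      using T1(4) y by (simp add: sheet_sign_def)
    have 2: "\<Psi> (y, ?b y = (\<not> ?b x)) = - ?\<beta> x * (s y - s x) + \<Psi> (x,False)"
      using T2(4) y by (simp add: sheet_sign_def)
    \<comment> \<open>Following the sheets from \<open>x\<close> to \<open>y\<close> exchanges the
      labels exactly when the two signs of \<open>transition\<close> differ.\<close>
    consider "?\<beta> x = 1" "?\<beta> y = 1" | "?\<beta> x = 1" "?\<beta> y = -1" | "?\<beta> x = -1" "?\<beta> y = 1" | "?\<beta> x = -1" "?\<beta> y = -1"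
      using transition_val[OF p x(1)] transition_val[OF p yU] by blast
    then show "?\<beta> y * \<Phi> y - s y = ?\<beta> x * \<Phi> x - s x"
      using 1 2 unfolding \<Phi>_def by cases (simp_all add: field_simps)
  qed
qed

text \<open>On a connected chart \<open>transition s a x * \<Phi> x\<close> is \<open>s x\<close>
  plus a constant \<open>d\<close>. The sign of \<open>d\<close> depends on the chart, but
  \<open>\<bar>d\<bar>\<close> is the value of \<open>\<bar>\<Phi>\<bar>\<close> on
  \<open>S\<close>; as \<open>S\<close> is connected, all charts meeting it share this number
  \<open>D\<close>.\<close>

lemma no_potential:
  assumes \<Psi>: "is_potential cover_potentials N id \<Psi>"
    and nontriv: "\<And>\<rho>. \<not> ((\<forall>x\<in>topspace X. \<rho> x = 1 \<or> \<rho> x = (-1::real)) \<and> (\<forall>U s a x. (U,s,a) \<in> \<P> \<longrightarrow> x \<in> U \<longrightarrow>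
      (\<exists>T. openin X T \<and> x \<in> T \<and> T \<subseteq> U \<and> (\<forall>y\<in>T. \<rho> y * a y = \<rho> x * a x))))"
    and one_sided: "\<And>\<tau>. \<not> ((\<forall>p\<in>\<P>. \<tau> p = 1 \<or> \<tau> p = (-1::real)) \<and> (\<forall>U s a V t c x. (U,s,a) \<in> \<P> \<longrightarrow> (V,t,c) \<in> \<P> \<longrightarrow> x \<in> U \<longrightarrow> x \<in> V \<longrightarrow> x \<in> S \<longrightarrow>
      (\<exists>T. openin X T \<and> x \<in> T \<and> T \<subseteq> U \<inter> V \<and> (\<forall>y\<in>T. \<tau> (U,s,a) * s y = \<tau> (V,t,c) * t y))))"
  shows False
proof -
  define \<Phi> where "\<Phi> x = (\<Psi> (x,True) - \<Psi> (x,False)) / 2" for x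
  have "\<exists>d. \<forall>x\<in>U. transition s a x * \<Phi> x - s x = d" if p: "(U,s,a) \<in> \<P>" for U s a
  proof (cases "U = {}")
    case False
    then obtain x0 where x0: "x0 \<in> U" by blast
    have UX: "topspace (subtopology X U) = U" using openin_subset[OF op[OF p]] by auto
    have "connected_space (subtopology X U)" using conn[OF p] by (simp add: connectedin_def)
    from locally_constant_imp_constant[OF this potential_antisymmetrized[OF \<Psi> p], folded \<Phi>_def, unfolded UX]
    show ?thesis using x0 by blast
  qed simp
  then have "\<exists>d. \<forall>p\<in>\<P>. \<forall>x\<in>fst p. transition (fst (snd p)) (snd (snd p)) x * \<Phi> x - fst (snd p) x = d p"
    by (intro bchoice) auto
  then obtain d where d0: "\<forall>p\<in>\<P>. \<forall>x\<in>fst p. transition (fst (snd p)) (snd (snd p)) x * \<Phi> x - fst (snd p) x = d p" ..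
  have d: "transition s a x * \<Phi> x = s x + d (U,s,a)" if "(U,s,a) \<in> \<P>" "x \<in> U" for U s a x
    using bspec[OF bspec[OF d0 that(1)], of x] that(2) by simp
  have abs\<Phi>: "\<bar>\<Phi> x\<bar> = \<bar>s x + d (U,s,a)\<bar>" if p: "(U,s,a) \<in> \<P>" "x \<in> U" for U s a x
    using d[OF p] transition_val[OF p] by auto
  obtain x0 where x0: "x0 \<in> S" using Sne by blast
  define D where "D = \<bar>\<Phi> x0\<bar>"
  have "\<bar>\<Phi> x\<bar> = D" if x: "x \<in> S" for x
  proof -
    have TS: "topspace (subtopology X S) = S" using SX by auto
    have "locally_constant (subtopology X S) (\<lambda>x. \<bar>\<Phi> x\<bar>)"
      unfolding locally_constant_def TS
    proof
      fix y assume y: "y \<in> S"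
      then obtain U s a where p: "(U,s,a) \<in> \<P>" "y \<in> U" using cov SX by blast
      show "\<exists>T. openin (subtopology X S) T \<and> y \<in> T \<and> (\<forall>z\<in>T. \<bar>\<Phi> z\<bar> = \<bar>\<Phi> y\<bar>)"
      proof (intro exI conjI ballI)
        show "openin (subtopology X S) (U \<inter> S)" using op[OF p(1)] by (simp add: openin_subtopology_Int)
        show "y \<in> U \<inter> S" using y p by simp
        fix z assume z: "z \<in> U \<inter> S"
        then have zz: "z \<in> U" "z \<in> S" by auto
        show "\<bar>\<Phi> z\<bar> = \<bar>\<Phi> y\<bar>"
          unfolding abs\<Phi>[OF p(1) zz(1)] abs\<Phi>[OF p] sS[OF p(1) zz] sS[OF p y] ..
      qed
    qed
    moreover have "connected_space (subtopology X S)" using connS by (simp add: connectedin_def)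
    ultimately show ?thesis using locally_constant_imp_constant[of "subtopology X S" "\<lambda>x. \<bar>\<Phi> x\<bar>" x x0] x x0 unfolding TS D_def by simp
  qed
  then have dS: "\<bar>d (U,s,a)\<bar> = D" if "(U,s,a) \<in> \<P>" "x \<in> U" "x \<in> S" for U s a x
    using abs\<Phi>[OF that(1,2)] sS[OF that] that(3) by simp
  show False
  proof (cases "D < 1")
    case True
    \<comment> \<open>With \<open>\<bar>d\<bar> < 1\<close> the number \<open>s y + d\<close> has
      the sign of \<open>s y\<close>. Off \<open>S\<close> the transition sign is
      \<open>a y * s y\<close>, so the factors \<open>s y\<close> cancel and \<open>a y\<close> is
      left.\<close>
    have sgnS: "sgn (\<Phi> y) = a y" if p: "(U,s,a) \<in> \<P>" "x \<in> U" "x \<in> S" and y: "y \<in> U" "y \<notin> S" for U s a x y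
    proof -
      have t: "transition s a y = a y * s y" using y(2) by (simp add: transition_def)
      have "\<bar>d (U,s,a)\<bar> < 1" using dS[OF p] True by simp
      moreover have "a y * s y * \<Phi> y = s y + d (U,s,a)" using d[OF p(1) y(1)] unfolding t .
      ultimately show ?thesis
        using aval[OF p(1) y(1)] sN[OF p(1) y] by (auto simp: sgn_if)
    qed
    \<comment> \<open>Charts away from \<open>S\<close> might contain a zero of
      \<open>\<Phi>\<close>, where its sign is useless. Such zeros form an open and closed set
      avoiding \<open>S\<close>, which is empty because \<open>X\<close> is connected.\<close>
    define Z where "Z x \<longleftrightarrow> x \<notin> S \<and> \<Phi> x = 0" for x
    have "locally_constant X Z"
      unfolding locally_constant_def
    proof
      fix x assume "x \<in> topspace X"
      then obtain U s a where p: "(U,s,a) \<in> \<P>" "x \<in> U" using cov by blast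
      show "\<exists>T. openin X T \<and> x \<in> T \<and> (\<forall>y\<in>T. Z y = Z x)"
      proof (cases "x \<in> S")
        case True
        have "\<not> Z y" if y: "y \<in> U" for y
        proof
          assume "Z y"
          then have z: "y \<notin> S" "\<Phi> y = 0" by (simp_all add: Z_def)
          then have "a y = 0" using sgnS[OF p True y z(1)] by simp
          then show False using aval[OF p(1) y] by auto
        qed
        then show ?thesis using op[OF p(1)] p(2) by (intro exI[of _ U]) simp
      next
        case False
        obtain T where T: "openin X T" "x \<in> T" "T \<subseteq> U \<inter> U" "\<And>y. y \<in> T \<Longrightarrow> y \<notin> S" "\<And>y. y \<in> T \<Longrightarrow> s y = s x"
          by (rule transition_off_S[OF p(1) p(1) p(2) p(2) False]) (rule that)
        have "Z y = Z x" if y: "y \<in> T" for y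
        proof -
          have yU: "y \<in> U" using y T(3) by blast
          have "\<bar>\<Phi> y\<bar> = \<bar>\<Phi> x\<bar>" unfolding abs\<Phi>[OF p(1) yU] abs\<Phi>[OF p] T(5)[OF y] ..
          then show ?thesis using T(4)[OF y] False by (auto simp: Z_def)
        qed
        then show ?thesis using T(1,2) by (intro exI[of _ T] conjI ballI)
      qed
    qed
    from locally_constant_imp_constant[OF connX this] have Zc: "\<not> Z x" if "x \<in> topspace X" for x
      using that x0 SX by (metis Z_def subsetD)
    \<comment> \<open>On \<open>S\<close> itself \<open>\<Phi>\<close> may vanish, so its sign is
      replaced there by the value common to all trivializations \<open>a\<close>.\<close>
    define aS where "aS x = (SOME r. \<exists>U s a. (U,s,a) \<in> \<P> \<and> x \<in> U \<and> r = a x)" for x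
    have aS: "aS x = a x" if p: "(U,s,a) \<in> \<P>" "x \<in> U" "x \<in> S" for U s a x
    proof -
      have "\<exists>r U s a. (U,s,a) \<in> \<P> \<and> x \<in> U \<and> r = a x" using p by blast
      from someI_ex[OF this] obtain V t c where "(V,t,c) \<in> \<P>" "x \<in> V" "aS x = c x" unfolding aS_def by blast
      then show ?thesis using a_S[OF p(1) _ p(2) _ p(3)] by simp
    qed
    define \<rho> where "\<rho> x = (if x \<in> S then aS x else sgn (\<Phi> x))" for x
    have "\<rho> x = 1 \<or> \<rho> x = -1" if x: "x \<in> topspace X" for x
    proof (cases "x \<in> S")
      case True
      obtain U s a where p: "(U,s,a) \<in> \<P>" "x \<in> U" using cov x by blast
      show ?thesis using aS[OF p True] aval[OF p] True by (simp add: \<rho>_def)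
    next
      case False
      then show ?thesis using Zc[OF x] by (auto simp: \<rho>_def Z_def sgn_if)
    qed
    moreover have "\<exists>T. openin X T \<and> x \<in> T \<and> T \<subseteq> U \<and> (\<forall>y\<in>T. \<rho> y * a y = \<rho> x * a x)"
      if p: "(U,s,a) \<in> \<P>" "x \<in> U" for U s a x
    proof (cases "x \<in> S")
      case True
      have "\<rho> y * a y = 1" if y: "y \<in> U" for y
      proof -
        have "\<rho> y = a y" using aS[OF p(1) y] sgnS[OF p True y] by (simp add: \<rho>_def)
        then show ?thesis using aval[OF p(1) y] by auto
      qed
      then show ?thesis using op[OF p(1)] p(2) by (intro exI[of _ U]) simp
    next
      case False
      obtain T where T: "openin X T" "x \<in> T" "T \<subseteq> U \<inter> U" "\<And>y. y \<in> T \<Longrightarrow> y \<notin> S" "\<And>y. y \<in> T \<Longrightarrow> s y = s x"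
        by (rule transition_off_S[OF p(1) p(1) p(2) p(2) False]) (rule that)
      \<comment> \<open>The right-hand side does not depend on \<open>y\<close>, because
        \<open>s\<close> is constant near a point off \<open>S\<close> and \<open>d\<close> on the
        chart.\<close>
      have *: "\<rho> y * a y = s x * sgn (s x + d (U,s,a))" if y: "y \<in> T" for y
      proof -
        have yU: "y \<in> U" using y T(3) by blast
        have yS: "y \<notin> S" by (rule T(4)[OF y])
        have e: "a y * s x * \<Phi> y = s x + d (U,s,a)"
          using d[OF p(1) yU] yS T(5)[OF y] by (simp add: transition_def)
        have "sgn (a y) * sgn (s x) * sgn (\<Phi> y) = sgn (s x + d (U,s,a))" unfolding e[symmetric] sgn_mult ..
        then show ?thesis
          using aval[OF p(1) yU] sN[OF p False] yS by (auto simp: \<rho>_def)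
      qed
      have "\<rho> y * a y = \<rho> x * a x" if "y \<in> T" for y unfolding *[OF that] *[OF T(2)] ..
      moreover have "T \<subseteq> U" using T(3) by blast
      ultimately show ?thesis using T(1,2) by (intro exI[of _ T] conjI ballI)
    qed
    ultimately show False using nontriv[of \<rho>] by blast
  next
    case False
    \<comment> \<open>For \<open>\<bar>d\<bar> = D \<ge> 1\<close> and \<open>s\<close> among -1, 0
      and 1, \<open>\<bar>s + d\<bar> - \<bar>d\<bar>\<close> is \<open>s\<close> times the sign of
      \<open>d\<close>. The left side is \<open>\<bar>\<Phi>\<bar> - D\<close>, the same function in
      every chart, so these signs choose a side of \<open>S\<close> coherently.\<close>
    define \<tau> where "\<tau> p = (if d p \<ge> 0 then 1 else (-1::real))" for p
    have key: "\<tau> (U,s,a) * s y = \<bar>\<Phi> y\<bar> - D" if p: "(U,s,a) \<in> \<P>" "x \<in> U" "x \<in> S" and y: "y \<in> U" for U s a x y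
    proof -
      have "\<bar>d (U,s,a)\<bar> = D" by (rule dS[OF p])
      moreover have "s y = 0 \<or> s y = 1 \<or> s y = -1" using sS[OF p(1) y] sN[OF p(1) y] by blast
      ultimately show ?thesis unfolding abs\<Phi>[OF p(1) y] \<tau>_def using False by auto
    qed
    have "\<tau> p = 1 \<or> \<tau> p = -1" for p by (simp add: \<tau>_def)
    moreover have "\<exists>T. openin X T \<and> x \<in> T \<and> T \<subseteq> U \<inter> V \<and> (\<forall>y\<in>T. \<tau> (U,s,a) * s y = \<tau> (V,t,c) * t y)"
      if p: "(U,s,a) \<in> \<P>" "(V,t,c) \<in> \<P>" "x \<in> U" "x \<in> V" "x \<in> S" for U s a V t c x
    proof (intro exI conjI ballI)
      show "openin X (U \<inter> V)" using op[OF p(1)] op[OF p(2)] by (rule openin_Int)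
      fix y assume "y \<in> U \<inter> V"
      then show "\<tau> (U,s,a) * s y = \<tau> (V,t,c) * t y"
        using key[OF p(1,3,5), of y] key[OF p(2,4,5), of y] by simp
    qed (use p in auto)
    ultimately show False using one_sided[of \<tau>] by blast
  qed
qed

text \<open>Compared with \<open>transition\<close>, a section \<open>\<rho>\<close> becomes a
  constant sign on each connected chart. At \<open>S\<close> the constants of two charts differ by
  the same sign \<open>q\<close> as their side functions, so together they choose a side.\<close>

lemma connected_cover:
  assumes one_sided: "\<And>\<tau>. \<not> ((\<forall>p\<in>\<P>. \<tau> p = 1 \<or> \<tau> p = (-1::real)) \<and> (\<forall>U s a V t c x. (U,s,a) \<in> \<P> \<longrightarrow> (V,t,c) \<in> \<P> \<longrightarrow> x \<in> U \<longrightarrow> x \<in> V \<longrightarrow> x \<in> S \<longrightarrow>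
      (\<exists>T. openin X T \<and> x \<in> T \<and> T \<subseteq> U \<inter> V \<and> (\<forall>y\<in>T. \<tau> (U,s,a) * s y = \<tau> (V,t,c) * t y))))"
  shows "connected_space N"
proof (rule connected_N[OF connX], rule notI)
  fix \<rho> assume \<rho>: "\<forall>U b x. (U,b) \<in> cover_charts \<longrightarrow> x \<in> U \<longrightarrow>
      (\<exists>T. openin X T \<and> x \<in> T \<and> T \<subseteq> U \<and> (\<forall>y\<in>T. (\<rho> y = b y) = (\<rho> x = b x)))"
  have "\<exists>k. (k = 1 \<or> k = (-1::real)) \<and> (\<forall>x\<in>U. sheet_sign (\<rho> x) * transition s a x = k)" if p: "(U,s,a) \<in> \<P>" for U s a
  proof (cases "U = {}")
    case False
    then obtain x0 where x0: "x0 \<in> U" by blast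
    have UX: "topspace (subtopology X U) = U" using openin_subset[OF op[OF p]] by auto
    have "locally_constant (subtopology X U) (\<lambda>x. \<rho> x = (transition s a x > 0))"
      unfolding locally_constant_def UX
    proof
      fix x assume x: "x \<in> U"
      obtain T where T: "openin X T" "x \<in> T" "T \<subseteq> U" "\<forall>y\<in>T. (\<rho> y = (transition s a y > 0)) = (\<rho> x = (transition s a x > 0))"
        using \<rho>[rule_format, OF cover_chartI[OF p] x] by (elim exE conjE)
      have "openin (subtopology X U) T" using openin_open_subtopology[OF op[OF p]] T(1,3) by simp
      then show "\<exists>T. openin (subtopology X U) T \<and> x \<in> T \<and> (\<forall>y\<in>T. (\<rho> y = (transition s a y > 0)) = (\<rho> x = (transition s a x > 0)))"
        using T(2,4) by (intro exI[of _ T] conjI)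
    qed
    moreover have "connected_space (subtopology X U)" using conn[OF p] by (simp add: connectedin_def)
    ultimately have c: "(\<rho> x = (transition s a x > 0)) = (\<rho> x0 = (transition s a x0 > 0))" if "x \<in> U" for x
      using locally_constant_imp_constant[of "subtopology X U" "\<lambda>x. \<rho> x = (transition s a x > 0)" x x0] that x0 unfolding UX by simp
    have "sheet_sign (\<rho> x) * transition s a x = (if \<rho> x0 = (transition s a x0 > 0) then 1 else -1)" if "x \<in> U" for x
      using c[OF that] transition_val[OF p that] unfolding sheet_sign_def by auto
    then show ?thesis by (intro exI[of _ "if \<rho> x0 = (transition s a x0 > 0) then 1 else -1"]) simp
  qed auto
  then have "\<exists>\<tau>. \<forall>p\<in>\<P>. (\<tau> p = 1 \<or> \<tau> p = (-1::real)) \<and> (\<forall>x\<in>fst p. sheet_sign (\<rho> x) * transition (fst (snd p)) (snd (snd p)) x = \<tau> p)"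
    by (intro bchoice) auto
  then obtain \<tau> where \<tau>0: "\<forall>p\<in>\<P>. (\<tau> p = 1 \<or> \<tau> p = (-1::real)) \<and> (\<forall>x\<in>fst p. sheet_sign (\<rho> x) * transition (fst (snd p)) (snd (snd p)) x = \<tau> p)" ..
  have \<tau>: "\<tau> (U,s,a) = sheet_sign (\<rho> x) * transition s a x" if "(U,s,a) \<in> \<P>" "x \<in> U" for U s a x
    using bspec[OF \<tau>0 that(1)] that(2) by simp
  have "\<exists>T. openin X T \<and> x \<in> T \<and> T \<subseteq> U \<inter> V \<and> (\<forall>y\<in>T. \<tau> (U,s,a) * s y = \<tau> (V,t,c) * t y)"
    if p: "(U,s,a) \<in> \<P>" "(V,t,c) \<in> \<P>" "x \<in> U" "x \<in> V" "x \<in> S" for U s a V t c x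
  proof -
    obtain T q where T: "q = 1 \<or> q = -1" "openin X T" "x \<in> T" "T \<subseteq> U \<inter> V"
      "\<And>y. y \<in> T \<Longrightarrow> s y = q * t y" "\<And>y. y \<in> T \<Longrightarrow> transition s a y * transition t c y = q"
      by (rule transition_at_S[OF p]) (rule that)
    have "\<tau> (U,s,a) * s y = \<tau> (V,t,c) * t y" if y: "y \<in> T" for y
    proof -
      have yU: "y \<in> U" "y \<in> V" using y T(4) by auto
      have "transition s a y * q = (transition s a y * transition s a y) * transition t c y"
        unfolding T(6)[OF y, symmetric] by (simp add: mult.assoc)
      then have "transition s a y * q = transition t c y" unfolding transition_square[OF p(1) yU(1)] by simp
      then show ?thesis unfolding \<tau>[OF p(1) yU(1)] \<tau>[OF p(2) yU(2)] T(5)[OF y]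
        by (metis (no_types, opaque_lifting) mult.assoc)
    qed
    then show ?thesis using T(2-4) by (intro exI[of _ T] conjI ballI)
  qed
  moreover have "\<forall>p\<in>\<P>. \<tau> p = 1 \<or> \<tau> p = -1" using \<tau>0 by blast
  ultimately show False using one_sided[of \<tau>] by blast
qed

theorem double_cover_with_positive_betti:
  assumes lpc: "locally_path_connected_space X"
    and nontriv: "\<And>\<rho>. \<not> ((\<forall>x\<in>topspace X. \<rho> x = 1 \<or> \<rho> x = (-1::real)) \<and> (\<forall>U s a x. (U,s,a) \<in> \<P> \<longrightarrow> x \<in> U \<longrightarrow>
      (\<exists>T. openin X T \<and> x \<in> T \<and> T \<subseteq> U \<and> (\<forall>y\<in>T. \<rho> y * a y = \<rho> x * a x))))"
    and one_sided: "\<And>\<tau>. \<not> ((\<forall>p\<in>\<P>. \<tau> p = 1 \<or> \<tau> p = (-1::real)) \<and> (\<forall>U s a V t c x. (U,s,a) \<in> \<P> \<longrightarrow> (V,t,c) \<in> \<P> \<longrightarrow> x \<in> U \<longrightarrow> x \<in> V \<longrightarrow> x \<in> S \<longrightarrow>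
      (\<exists>T. openin X T \<and> x \<in> T \<and> T \<subseteq> U \<inter> V \<and> (\<forall>y\<in>T. \<tau> (U,s,a) * s y = \<tau> (V,t,c) * t y))))"
  shows "\<exists>(N :: ('a \<times> bool) topology) p. double_covering N p X \<and> connected_space N \<and> betti 1 N > 0"
proof -
  have con: "connected_space N" by (rule connected_cover[OF one_sided])
  have lp: "locally_path_connected_space N" by (rule locally_path_connected_N[OF lpc])
  have pc: "path_connected_space N" using path_connected_eq_connected_space[OF lp] con by simp
  have "betti 1 N > 0"
  proof (rule ccontr)
    assume "\<not> betti 1 N > 0"
    from potential_exists[OF potential_atlas_N pc lp this]
    obtain \<Psi> where "is_potential cover_potentials N id \<Psi>" ..
    from no_potential[OF this nontriv one_sided] show False .
  qed
  with double_covering_N con show ?thesis by blast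
qed

end

section \<open>Mod-2 characters\<close>

text \<open>Zorn gives a largest additively closed set over \<open>H0\<close> that avoids
  \<open>c\<close>. Since doubles lie in \<open>H0\<close>, it is a subgroup, and adjoining an
  outside element \<open>x\<close> adds only one coset; by maximality that coset contains
  \<open>c\<close>.\<close>

lemma maximal_index_two_subgroup:
  fixes H0 :: "'g::ab_group_add set"
  assumes add: "\<And>x y. x \<in> H0 \<Longrightarrow> y \<in> H0 \<Longrightarrow> x + y \<in> H0" and two: "\<And>x. x + x \<in> H0" and c: "c \<notin> H0"
  obtains H where "H0 \<subseteq> H" "c \<notin> H" "\<And>x y. x \<in> H \<Longrightarrow> y \<in> H \<Longrightarrow> x + y \<in> H" "\<And>x. x \<notin> H \<Longrightarrow> x + c \<in> H"
proof -
  define \<A> where "\<A> = {H. H0 \<subseteq> H \<and> c \<notin> H \<and> (\<forall>x\<in>H. \<forall>y\<in>H. x + y \<in> H)}"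
  have "\<exists>H\<in>\<A>. \<forall>X\<in>\<A>. H \<subseteq> X \<longrightarrow> X = H"
  proof (rule subset_Zorn_nonempty)
    have "H0 \<in> \<A>" using add c by (simp add: \<A>_def)
    then show "\<A> \<noteq> {}" by blast
    fix \<C> assume \<C>: "\<C> \<noteq> {}" "subset.chain \<A> \<C>"
    have sub: "\<C> \<subseteq> \<A>" and tot: "\<And>A B. A \<in> \<C> \<Longrightarrow> B \<in> \<C> \<Longrightarrow> A \<subseteq> B \<or> B \<subseteq> A"
      using \<C>(2) unfolding subset.chain_def by blast+
    have mem: "H0 \<subseteq> A" "c \<notin> A" "\<And>x y. x \<in> A \<Longrightarrow> y \<in> A \<Longrightarrow> x + y \<in> A" if "A \<in> \<C>" for A
      using subsetD[OF sub that] unfolding \<A>_def by blast+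
    show "\<Union>\<C> \<in> \<A>"
      unfolding \<A>_def mem_Collect_eq
    proof (intro conjI ballI)
      obtain A where "A \<in> \<C>" using \<C>(1) by blast
      then show "H0 \<subseteq> \<Union>\<C>" using mem(1) by blast
      show "c \<notin> \<Union>\<C>" using mem(2) by blast
      fix x y assume "x \<in> \<Union>\<C>" "y \<in> \<Union>\<C>"
      then obtain A B where AB: "A \<in> \<C>" "x \<in> A" "B \<in> \<C>" "y \<in> B" by blast
      from tot[OF AB(1,3)] show "x + y \<in> \<Union>\<C>"
      proof
        assume "A \<subseteq> B"
        then show ?thesis using mem(3)[OF AB(3), of x y] AB by blast
      next
        assume "B \<subseteq> A"
        then show ?thesis using mem(3)[OF AB(1), of x y] AB by blast
      qed
    qed
  qed
  then obtain H where H: "H \<in> \<A>" and max: "\<And>X. X \<in> \<A> \<Longrightarrow> H \<subseteq> X \<Longrightarrow> X = H" by blast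
  have HH: "H0 \<subseteq> H" "c \<notin> H" "\<And>x y. x \<in> H \<Longrightarrow> y \<in> H \<Longrightarrow> x + y \<in> H" using H unfolding \<A>_def by blast+
  have twoH: "x + x \<in> H" for x using HH(1) two by blast
  have "x + c \<in> H" if x: "x \<notin> H" for x
  proof -
    let ?X = "H \<union> (\<lambda>h. h + x) ` H"
    have zero: "0 \<in> H" using twoH[of 0] by simp
    have "x \<in> ?X" using image_eqI[of x "\<lambda>h. h + x" 0 H] zero by simp
    then have "?X \<noteq> H" using x by blast
    then have "?X \<notin> \<A>" using max[of ?X] by blast
    moreover have "y + z \<in> ?X" if "y \<in> ?X" "z \<in> ?X" for y z
    proof -
      from that(1) consider "y \<in> H" | h where "h \<in> H" "y = h + x" by blast
      then show ?thesis
      proof cases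
        case 1
        from that(2) consider "z \<in> H" | h where "h \<in> H" "z = h + x" by blast
        then show ?thesis
        proof cases
          case 1 then show ?thesis using HH(3) \<open>y \<in> H\<close> by blast
        next
          case 2
          have "y + z = (y + h) + x" using 2 by (simp add: add.assoc)
          then show ?thesis using HH(3)[OF \<open>y \<in> H\<close> 2(1)] by blast
        qed
      next
        case (2 h)
        from that(2) consider "z \<in> H" | k where "k \<in> H" "z = k + x" by blast
        then show ?thesis
        proof cases
          case 1
          have "y + z = (h + z) + x" using 2 by (simp add: add.assoc add.commute)
          then show ?thesis using HH(3)[OF 2(1) 1] by blast
        next
          case (2 k)
          have "y + z = (h + k) + (x + x)" using 2 \<open>y = h + x\<close> by (simp add: algebra_simps)
          then show ?thesis using HH(3)[OF HH(3)[OF \<open>h \<in> H\<close> 2(1)] twoH[of x]] by simp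
        qed
      qed
    qed
    ultimately have "c \<in> ?X" using HH(1) unfolding \<A>_def by blast
    then obtain h where h: "h \<in> H" "c = h + x" using HH(2) by blast
    have "x + c = h + (x + x)" using h(2) by (simp add: algebra_simps)
    then show ?thesis using HH(3)[OF h(1) twoH[of x]] by (simp only:)
  qed
  with HH show thesis using that by blast
qed

text \<open>The character is defined on all chains, not only on mod-2 cycles, so that it has values
  on single paths and thus acts as a cochain. The set \<open>H0\<close> collects what must have
  value 1: boundaries, mod-2 cycles of \<open>S\<close> and doubles. A class outside the image gives
  a chain \<open>c\<close> outside \<open>H0\<close>.\<close>

lemma sign_character_exists:
  assumes ns: "\<not> H1_mod2_inclusion_surjective M S"
  obtains \<omega> :: "'a chain \<Rightarrow> real" where
    "\<And>c d. \<omega> (c + d) = \<omega> c * \<omega> d" "\<And>c. \<omega> c = 1 \<or> \<omega> c = -1"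
    "\<And>b. singular_chain 2 M b \<Longrightarrow> \<omega> (chain_boundary 2 b) = 1"
    "\<And>d. mod2_cycle1 (subtopology M S) d \<Longrightarrow> \<omega> d = 1"
    "\<exists>c. mod2_cycle1 M c \<and> \<omega> c = -1"
proof -
  obtain c where c: "mod2_cycle1 M c" and nc: "\<And>d. mod2_cycle1 (subtopology M S) d \<Longrightarrow> \<not> mod2_homologous1 M c d"
    using ns unfolding H1_mod2_inclusion_surjective_def by blast
  define H0 where "H0 = {chain_boundary 2 b + d + (e + e) | b d e. singular_chain 2 M b \<and> mod2_cycle1 (subtopology M S) d}"
  have H0I: "chain_boundary 2 b + d + (e + e) \<in> H0" if "singular_chain 2 M b" "mod2_cycle1 (subtopology M S) d" for b d e
    unfolding H0_def using that by blast
  have cyc_add: "mod2_cycle1 Y (d + d')" if "mod2_cycle1 Y d" "mod2_cycle1 Y d'" for Y :: "'a topology" and d d'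
  proof -
    obtain e e' where e: "singular_chain 0 Y e" "chain_boundary 1 d = e + e" "singular_chain 0 Y e'" "chain_boundary 1 d' = e' + e'"
      using \<open>mod2_cycle1 Y d\<close> \<open>mod2_cycle1 Y d'\<close> unfolding mod2_cycle1_def by blast
    have "chain_boundary 1 (d + d') = (e + e') + (e + e')" unfolding chain_boundary_add e(2,4) by (simp add: algebra_simps)
    moreover have "singular_chain 0 Y (e + e')" using e by (simp add: singular_chain_add)
    moreover have "singular_chain 1 Y (d + d')" using that unfolding mod2_cycle1_def by (simp add: singular_chain_add)
    ultimately show ?thesis unfolding mod2_cycle1_def by blast
  qed
  have cyc0: "mod2_cycle1 Y 0" for Y :: "'a topology" unfolding mod2_cycle1_def by (intro conjI exI[of _ 0]) simp_all
  have add: "x + y \<in> H0" if xy: "x \<in> H0" "y \<in> H0" for x y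
  proof -
    obtain b d e where x: "x = chain_boundary 2 b + d + (e + e)" "singular_chain 2 M b" "mod2_cycle1 (subtopology M S) d"
      using xy(1) unfolding H0_def by blast
    obtain b' d' e' where y: "y = chain_boundary 2 b' + d' + (e' + e')" "singular_chain 2 M b'" "mod2_cycle1 (subtopology M S) d'"
      using xy(2) unfolding H0_def by blast
    have "x + y = chain_boundary 2 (b + b') + (d + d') + ((e + e') + (e + e'))"
      unfolding x(1) y(1) chain_boundary_add by (simp add: algebra_simps)
    then show ?thesis using H0I[OF singular_chain_add[OF x(2) y(2)] cyc_add[OF x(3) y(3)]] by simp
  qed
  have two: "x + x \<in> H0" for x using H0I[OF singular_chain_0 cyc0, of x] by simp
  have "c \<notin> H0"
  proof
    assume "c \<in> H0"
    then obtain b d e where x: "c = chain_boundary 2 b + d + (e + e)" "singular_chain 2 M b" "mod2_cycle1 (subtopology M S) d"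
      unfolding H0_def by blast
    have "singular_chain 1 M d"
      using x(3) unfolding mod2_cycle1_def singular_chain_subtopology by simp
    moreover have "singular_chain 1 M (chain_boundary 2 b)" using singular_chain_boundary[OF x(2)] by simp
    moreover have "singular_chain 1 M c" using c by (simp add: mod2_cycle1_def)
    \<comment> \<open>In \<open>H0\<close> the chain \<open>e\<close> is arbitrary. Its double lies
      in \<open>M\<close>, and doubling does not change the support, so \<open>e\<close> lies in
      \<open>M\<close> as well.\<close>
    moreover have "e + e = c - d - chain_boundary 2 b" unfolding x(1) by simp
    ultimately have "singular_chain 1 M (e + e)" by (simp only: singular_chain_diff)
    moreover have "Poly_Mapping.keys (e + e) = Poly_Mapping.keys e" by (auto simp: in_keys_iff lookup_add)
    ultimately have "singular_chain 1 M e" by (simp add: singular_chain_def)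
    moreover have "c - d = chain_boundary 2 b + e + e" unfolding x(1) by (simp add: algebra_simps)
    ultimately have "mod2_homologous1 M c d" unfolding mod2_homologous1_def using x(2) by blast
    then show False using nc[OF x(3)] by simp
  qed
  from maximal_index_two_subgroup[OF add two this]
  obtain H where H: "H0 \<subseteq> H" "c \<notin> H" "\<And>x y. x \<in> H \<Longrightarrow> y \<in> H \<Longrightarrow> x + y \<in> H" "\<And>x. x \<notin> H \<Longrightarrow> x + c \<in> H" by blast
  have twoH: "x + x \<in> H" for x using H(1) two by blast
  have minus: "- x \<in> H" if "x \<in> H" for x
  proof -
    have "- x = x + (- x + - x)" by simp
    then show ?thesis using H(3)[OF that twoH[of "- x"]] by simp
  qed
  have diffH: "y \<in> H" if "x + y \<in> H" "x \<in> H" for x y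
    using H(3)[OF that(1) minus[OF that(2)]] by simp
  define \<omega> where "\<omega> x = (if x \<in> H then 1 else (-1::real))" for x
  have "\<omega> (x + y) = \<omega> x * \<omega> y" for x y
  proof (cases "x \<in> H")
    case True
    then have "x + y \<in> H \<longleftrightarrow> y \<in> H" using H(3) diffH by blast
    then show ?thesis using True by (simp add: \<omega>_def)
  next
    case x: False
    show ?thesis
    proof (cases "y \<in> H")
      case True
      then have "x + y \<notin> H" using diffH[of y x] x by (auto simp: add.commute)
      then show ?thesis using x True by (simp add: \<omega>_def)
    next
      case False
      have "(x + c) + (y + c) \<in> H" using H(3)[OF H(4)[OF x] H(4)[OF False]] .
      also have "(x + c) + (y + c) = (c + c) + (x + y)" by (simp add: algebra_simps)
      finally have "x + y \<in> H" using diffH twoH by blast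
      then show ?thesis using x False by (simp add: \<omega>_def)
    qed
  qed
  moreover have "\<omega> x = 1 \<or> \<omega> x = -1" for x by (simp add: \<omega>_def)
  moreover have "\<omega> (chain_boundary 2 b) = 1" if "singular_chain 2 M b" for b
    using subsetD[OF H(1) H0I[OF that cyc0, of 0]] by (simp add: \<omega>_def)
  moreover have "\<omega> d = 1" if "mod2_cycle1 (subtopology M S) d" for d
    using subsetD[OF H(1) H0I[OF singular_chain_0 that, of 0]] by (simp add: \<omega>_def)
  moreover have "\<exists>c. mod2_cycle1 M c \<and> \<omega> c = -1" using c H(2) by (intro exI[of _ c]) (simp add: \<omega>_def)
  ultimately show thesis using that[of \<omega>] by blast
qed

lemma contractible_cycle_boundary:
  assumes X: "contractible_space X" and z: "singular_relcycle 1 X {} z"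
  shows "singular_relboundary 1 X {} z"
proof -
  have "trivial_group (homology_group 1 X)"
    using trivial_reduced_homology_group_contractible_space[OF X, of 1] by (simp add: un_reduced_homology_group)
  then have triv: "carrier (homology_group 1 X) = {\<one>\<^bsub>homology_group 1 X\<^esub>}"
    unfolding trivial_group_def by (rule conjunct2)
  have c: "carrier (homology_group 1 X) = homologous_rel_set 1 X {} ` singular_relcycle_set 1 X {}"
    using carrier_relative_homology_group[of 1 X "{}"] by simp
  have "homologous_rel_set 1 X {} z \<in> carrier (homology_group 1 X)"
    unfolding c by (rule imageI) (use z in blast)
  then have "homologous_rel_set 1 X {} z = \<one>\<^bsub>homology_group 1 X\<^esub>" unfolding triv by (rule singletonD)
  also have "\<dots> = singular_relboundary_set 1 X {}" using one_relative_homology_group[of 1 X "{}"] by simp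
  finally show ?thesis by (simp only: homologous_rel_set_eq_relboundary)
qed

section \<open>Local and global primitives of a character\<close>

locale sign_character =
  fixes M :: "'a topology" and \<omega> :: "'a chain \<Rightarrow> real"
  assumes \<omega>_add: "\<omega> (c + d) = \<omega> c * \<omega> d" and \<omega>_val: "\<omega> c = 1 \<or> \<omega> c = -1"
    and \<omega>_boundary: "singular_chain 2 M b \<Longrightarrow> \<omega> (chain_boundary 2 b) = 1"
begin

lemma \<omega>_square: "\<omega> c * \<omega> c = 1" using \<omega>_val[of c] by auto

lemma \<omega>_0: "\<omega> 0 = 1" using \<omega>_add[of 0 0] \<omega>_val[of 0] by auto

lemma \<omega>_minus: "\<omega> (- c) = \<omega> c" using \<omega>_add[of c "- c"] \<omega>_0 \<omega>_val[of c] \<omega>_val[of "- c"] by auto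

lemma \<omega>_diff: "\<omega> (c - d) = \<omega> c * \<omega> d" using \<omega>_add[of c "- d"] by (simp add: \<omega>_minus)

text \<open>Written multiplicatively, \<open>a\<close> is a 0-cochain on \<open>U\<close> with
  coboundary \<open>\<omega>\<close>, that is, a trivialization over \<open>U\<close> of the double
  cover belonging to the character.\<close>

definition primitive :: "'a set \<Rightarrow> ('a \<Rightarrow> real) \<Rightarrow> bool" where
  "primitive U a \<longleftrightarrow> (\<forall>x\<in>U. a x = 1 \<or> a x = -1) \<and>
     (\<forall>\<sigma>. singular_simplex 1 (subtopology M U) \<sigma> \<longrightarrow> \<omega> (frag_of \<sigma>) = a (\<sigma> (simplex_vertex 0)) * a (\<sigma> (simplex_vertex 1)))"

text \<open>The value at a point is the character of a path from a base point; \<open>cyc\<close>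
  makes it independent of the path. The lemma serves both contractible sets, where cycles bound, and
  the surface, on whose cycles the character is trivial.\<close>

lemma primitive_exists:
  assumes U: "U \<subseteq> topspace M" "path_connectedin M U"
    and cyc: "\<And>z. singular_relcycle 1 (subtopology M U) {} z \<Longrightarrow> \<omega> z = 1"
  shows "\<exists>a. primitive U a"
proof (cases "U = {}")
  case True
  then show ?thesis
    using singular_simplex_empty[of "subtopology M U"] by (auto simp: primitive_def)
next
  case False
  then obtain u where u: "u \<in> U" by blast
  let ?X = "subtopology M U"
  have tX: "topspace ?X = U" using U by auto
  have "path_connected_space ?X" using U by (simp add: path_connectedin_def)
  then have "\<exists>g. pathin ?X g \<and> g 0 = u \<and> g 1 = y" if "y \<in> U" for y
    using u that unfolding path_connected_space_def tX by blast
  then obtain p where p: "\<And>y. y \<in> U \<Longrightarrow> pathin ?X (p y) \<and> p y 0 = u \<and> p y 1 = y" by metis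
  let ?s = "\<lambda>y. frag_of (segment_simplex (p y) 0 1)"
  define a where "a y = \<omega> (?s y)" for y
  have "\<omega> (frag_of \<sigma>) = a (\<sigma> (simplex_vertex 0)) * a (\<sigma> (simplex_vertex 1))" if \<sigma>: "singular_simplex 1 ?X \<sigma>" for \<sigma>
  proof -
    let ?x = "\<sigma> (simplex_vertex 0)" and ?y = "\<sigma> (simplex_vertex 1)"
    have "\<sigma> z \<in> U" if "z \<in> standard_simplex 1" for z
      using \<sigma> that unfolding singular_simplex_subtopology by blast
    then have xy: "?x \<in> U" "?y \<in> U" by (simp_all add: simplex_vertex_in)
    let ?z = "?s ?x + frag_of \<sigma> - ?s ?y"
    have s: "singular_chain 1 ?X (?s y)" if "y \<in> U" for y
      unfolding singular_chain_of by (rule singular_simplex_segment) (use p[OF that] in auto)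
    have "singular_chain 1 ?X ?z"
      by (intro singular_chain_add singular_chain_diff s xy) (simp add: singular_chain_of \<sigma>[unfolded One_nat_def])
    moreover have "chain_boundary 1 ?z = 0"
      unfolding chain_boundary_add chain_boundary_diff chain_boundary_segment chain_boundary_1_of[of \<sigma>]
      using p[OF xy(1)] p[OF xy(2)] by simp
    ultimately have "\<omega> ?z = 1" by (intro cyc) (simp add: singular_cycle)
    then have "a ?x * \<omega> (frag_of \<sigma>) * a ?y = 1" unfolding \<omega>_diff \<omega>_add a_def .
    moreover have "a ?x = 1 \<or> a ?x = -1" "a ?y = 1 \<or> a ?y = -1" unfolding a_def by (rule \<omega>_val)+
    ultimately show ?thesis using \<omega>_val[of "frag_of \<sigma>"] by auto
  qed
  moreover have "a y = 1 \<or> a y = -1" for y unfolding a_def by (rule \<omega>_val)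
  ultimately show ?thesis unfolding primitive_def by blast
qed

lemma primitive_contractible:
  assumes U: "U \<subseteq> topspace M" "contractible_space (subtopology M U)"
  shows "\<exists>a. primitive U a"
proof (rule primitive_exists[OF U(1)])
  show "path_connectedin M U"
    using contractible_imp_path_connected_space[OF U(2)] U(1) by (simp add: path_connectedin_def)
  fix z assume "singular_relcycle 1 (subtopology M U) {} z"
  from contractible_cycle_boundary[OF U(2) this]
  obtain d where d: "singular_chain 2 (subtopology M U) d" "chain_boundary 2 d = z"
    unfolding singular_boundary by (auto simp: numeral_2_eq_2)
  then have "singular_chain 2 M d" by (simp add: singular_chain_subtopology)
  from \<omega>_boundary[OF this] show "\<omega> z = 1" unfolding d(2) .
qed

lemma primitive_path:
  assumes a: "primitive U a" and g: "pathin (subtopology M U) g"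
  shows "\<omega> (frag_of (segment_simplex g 0 1)) = a (g 0) * a (g 1)"
  using a singular_simplex_segment[OF g, of 0 1] unfolding primitive_def
  by (simp add: segment_simplex_vertices[of g 0 1, unfolded One_nat_def])

text \<open>Cutting a path in two changes it by a boundary, so the character is multiplicative along
  it.\<close>

lemma segment_character:
  assumes g: "pathin M g" and uvw: "u \<in> {0..1}" "v \<in> {0..1}" "w \<in> {0..1}"
  shows "\<omega> (frag_of (segment_simplex g u w)) = \<omega> (frag_of (segment_simplex g u v)) * \<omega> (frag_of (segment_simplex g v w))"
proof -
  obtain d where d: "singular_chain 2 M d"
    "chain_boundary 2 d = frag_of (segment_simplex g v w) - frag_of (segment_simplex g u w) + frag_of (segment_simplex g u v)"
    by (rule segment_triangle[OF g uvw]) (rule that)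
  from \<omega>_boundary[OF d(1)]
  have "\<omega> (frag_of (segment_simplex g v w)) * \<omega> (frag_of (segment_simplex g u w)) * \<omega> (frag_of (segment_simplex g u v)) = 1"
    unfolding d(2) \<omega>_add \<omega>_diff .
  then show ?thesis
    using \<omega>_val[of "frag_of (segment_simplex g v w)"] \<omega>_val[of "frag_of (segment_simplex g u w)"] \<omega>_val[of "frag_of (segment_simplex g u v)"] by auto
qed

text \<open>If \<open>\<rho>\<close> follows the local primitives up to sign, then
  \<open>\<omega>\<close> is the coboundary of \<open>\<rho>\<close> on all paths, and a coboundary
  is trivial on mod-2 cycles. This rules out a global trivialization of a nontrivial
  character.\<close>

lemma global_primitive:
  assumes \<rho>: "\<And>x. x \<in> topspace M \<Longrightarrow> \<rho> x = 1 \<or> \<rho> x = (-1::real)"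
    and loc: "\<And>x. x \<in> topspace M \<Longrightarrow> \<exists>U a T. primitive U a \<and> openin M T \<and> x \<in> T \<and> T \<subseteq> U \<and> (\<forall>y\<in>T. \<rho> y * a y = \<rho> x * a x)"
    and c: "mod2_cycle1 M c"
  shows "\<omega> c = 1"
proof (cases "\<exists>c0. \<omega> c0 = -1")
  case False
  then show ?thesis using \<omega>_val by blast
next
  case True
  then obtain c0 where c0: "\<omega> c0 = -1" ..
  have path: "\<omega> (frag_of (segment_simplex g 0 1)) = \<rho> (g 0) * \<rho> (g 1)" if g: "pathin M g" for g
  proof -
    have gM: "g t \<in> topspace M" if "t \<in> {0..1}" for t
      using g that unfolding pathin_def continuous_map_def by auto
    \<comment> \<open>Over a short piece of the path both factors change by the same local
      primitive, so \<open>m\<close> is constant; comparing its ends evaluates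
      \<open>\<omega>\<close> on \<open>g\<close>.\<close>
    define m where "m t = \<omega> (frag_of (segment_simplex g 0 t)) * \<rho> (g t)" for t
    have "locally_constant (top_of_set {0..1}) m"
      unfolding locally_constant_def topspace_euclidean_subtopology
    proof
      fix t :: real assume t: "t \<in> {0..1}"
      obtain U a T where UT: "primitive U a" "openin M T" "g t \<in> T" "T \<subseteq> U" "\<forall>y\<in>T. \<rho> y * a y = \<rho> (g t) * a (g t)"
        using loc[OF gM[OF t]] by (elim exE conjE)
      have "openin (top_of_set {0..1}) {s \<in> topspace (top_of_set {0..1}). g s \<in> T}"
        by (rule openin_continuous_map_preimage[OF g[unfolded pathin_def] UT(2)])
      then obtain O' where O': "open O'" "{s \<in> {0..1}. g s \<in> T} = {0..1} \<inter> O'" unfolding openin_open by auto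
      have "t \<in> O'" using O'(2) t UT(3) by blast
      then obtain \<delta> where \<delta>: "\<delta> > 0" "ball t \<delta> \<subseteq> O'" using O'(1) open_contains_ball by blast
      have gT: "g s \<in> T" if "s \<in> {0..1} \<inter> ball t \<delta>" for s using that O'(2) \<delta>(2) by blast
      have "m r = m t" if r: "r \<in> {0..1} \<inter> ball t \<delta>" for r
      proof -
        have r01: "r \<in> {0..1}" using r by simp
        have "segment_simplex g t r ` standard_simplex 1 \<subseteq> T"
        proof (rule image_subsetI)
          fix x assume x: "x \<in> standard_simplex 1"
          have conv: "x 0 * t + x 1 * r \<in> ball t \<delta>"
          proof -
            have xx: "0 \<le> x 1" "x 1 \<le> 1" "x 0 = 1 - x 1" using x unfolding in_standard_simplex_1 by auto
            have "x 0 * t + x 1 * r - t = x 1 * (r - t)" unfolding xx(3) by (simp add: algebra_simps)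
            moreover have "\<bar>x 1 * (r - t)\<bar> \<le> \<bar>r - t\<bar>" using xx by (simp add: abs_mult mult_left_le_one_le)
            moreover have "\<bar>r - t\<bar> < \<delta>" using r by (simp add: dist_real_def abs_minus_commute)
            ultimately show ?thesis by (simp add: dist_real_def)
          qed
          have "g (x 0 * t + x 1 * r) \<in> T" by (rule gT) (use conv convex_01[OF t r01 x] in blast)
          then show "segment_simplex g t r x \<in> T" using x by (simp add: segment_simplex_def)
        qed
        then have "singular_simplex 1 (subtopology M U) (segment_simplex g t r)"
          using singular_simplex_segment[OF g t r01] UT(4) unfolding singular_simplex_subtopology by blast
        then have seg: "\<omega> (frag_of (segment_simplex g t r)) = a (g t) * a (g r)"
          using UT(1) unfolding primitive_def segment_simplex_vertices by (metis segment_simplex_vertices)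
        have grT: "g r \<in> T" by (rule gT[OF r])
        then have ra: "\<rho> (g r) * a (g r) = \<rho> (g t) * a (g t)" using UT(5) by blast
        have at: "a (g t) * a (g t) = 1" using UT(1,3,4) unfolding primitive_def by fastforce
        have "m r = \<omega> (frag_of (segment_simplex g 0 t)) * a (g t) * (\<rho> (g r) * a (g r))"
          unfolding m_def segment_character[OF g _ t r01, of 0, simplified] seg by simp
        also have "\<dots> = \<omega> (frag_of (segment_simplex g 0 t)) * \<rho> (g t) * (a (g t) * a (g t))"
          unfolding ra by simp
        finally show ?thesis unfolding at m_def by simp
      qed
      then show "\<exists>T. openin (top_of_set {0..1}) T \<and> t \<in> T \<and> (\<forall>y\<in>T. m y = m t)"
      proof (intro exI conjI ballI)
        show "openin (top_of_set {0..1}) ({0..1} \<inter> ball t \<delta>)" by (rule openin_open_Int) simp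
        show "t \<in> {0..1} \<inter> ball t \<delta>" using t \<delta>(1) by simp
      qed
    qed
    moreover have "connected_space (top_of_set {0..1::real})"
      using connected_Icc[of 0 "1::real"] by (simp add: connectedin_def flip: connectedin_iff_connected)
    ultimately have m01: "m 1 = m 0" by (intro locally_constant_imp_constant[of "top_of_set {0..1}"]) auto
    \<comment> \<open>Multiplicativity for three equal parameters makes this sign its own
      square.\<close>
    have "\<omega> (frag_of (segment_simplex g 0 0)) = 1"
      using segment_character[OF g, of 0 0 0] \<omega>_val[of "frag_of (segment_simplex g 0 0)"] by auto
    with m01 have "\<omega> (frag_of (segment_simplex g 0 1)) * \<rho> (g 1) = \<rho> (g 0)" by (simp add: m_def)
    then show ?thesis using \<rho>[OF gM[of 1]] \<rho>[OF gM[of 0]] by auto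
  qed
  \<comment> \<open>The chains 0 and \<open>c0\<close> have characters 1 and -1, so
    \<open>\<omega> \<circ> \<Gamma>\<close> extends \<open>\<rho>\<close> multiplicatively from
    points to 0-chains. On a boundary of the form \<open>e + e\<close> it takes a square, hence
    1.\<close>
  define \<Gamma> where "\<Gamma> = frag_extend (\<lambda>p::(nat \<Rightarrow> real) \<Rightarrow> 'a. if \<rho> (p (simplex_vertex 0)) = 1 then 0 else c0)"
  have pt: "point_simplex x (simplex_vertex 0) = x" for x :: 'a
    by (simp add: point_simplex_def simplex_vertex_in)
  have \<Gamma>pt: "\<omega> (\<Gamma> (frag_of (point_simplex x))) = \<rho> x" if "x \<in> topspace M" for x
    using \<rho>[OF that] by (auto simp: \<Gamma>_def pt \<omega>_0 c0)
  have "\<omega> d = \<omega> (\<Gamma> (chain_boundary 1 d))" if d: "singular_chain 1 M d" for d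
    using d unfolding singular_chain_def
  proof (induction d rule: frag_induction)
    case zero
    then show ?case by (simp add: \<Gamma>_def)
  next
    case (one \<sigma>)
    then have \<sigma>: "singular_simplex 1 M \<sigma>" by simp
    obtain g where g: "pathin M g" "\<sigma> = segment_simplex g 0 1" by (rule simplex_eq_segment[OF \<sigma>])
    have gM: "g 0 \<in> topspace M" "g 1 \<in> topspace M" using g(1) unfolding pathin_def continuous_map_def by auto
    have "\<omega> (\<Gamma> (chain_boundary 1 (frag_of \<sigma>))) = \<rho> (g 1) * \<rho> (g 0)"
      unfolding g(2) chain_boundary_segment using \<Gamma>pt[OF gM(1)] \<Gamma>pt[OF gM(2)]
      by (simp only: \<Gamma>_def frag_extend_diff \<omega>_diff)
    then show ?case unfolding g(2) path[OF g(1)] by simp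
  next
    case (diff a b)
    then show ?case by (simp add: chain_boundary_diff \<Gamma>_def frag_extend_diff \<omega>_diff)
  qed
  moreover obtain e where "chain_boundary 1 c = e + e" "singular_chain 1 M c" using c unfolding mod2_cycle1_def by blast
  ultimately show ?thesis by (simp add: \<Gamma>_def frag_extend_add \<omega>_add \<omega>_square)
qed

end

section \<open>Manifolds and flat charts\<close>

lemma convex_fun_connected:
  fixes A :: "(nat \<Rightarrow> real) set"
  assumes conv: "\<And>x z t. \<lbrakk>x \<in> A; z \<in> A; 0 \<le> t; t \<le> 1\<rbrakk> \<Longrightarrow> (\<lambda>i. (1 - t) * x i + t * z i) \<in> A"
  shows "connected A"
proof (cases "A = {}")
  case False
  then obtain c where c: "c \<in> A" by blast
  have "contractible A" by (rule starlike_imp_contractible_fun[OF c]) (rule conv[OF _ c])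
  then have "connected_space (top_of_set A)" by (intro contractible_imp_connected_space) simp
  then show ?thesis by (simp add: connectedin_def flip: connectedin_iff_connected)
qed simp

definition coordinate_box :: "nat \<Rightarrow> (nat \<Rightarrow> real) \<Rightarrow> real \<Rightarrow> (nat \<Rightarrow> real) set" where
  "coordinate_box n y r = {v \<in> topspace (Euclidean_space n). \<forall>i<n. \<bar>v i - y i\<bar> < r}"

lemma box_convex:
  assumes "x \<in> coordinate_box n y r" "z \<in> coordinate_box n y r" "0 \<le> t" "t \<le> 1"
  shows "(\<lambda>i. (1 - t) * x i + t * z i) \<in> coordinate_box n y r"
  using assms abs_convex_less unfolding coordinate_box_def topspace_Euclidean_space by auto

lemma box_nhd:
  assumes "openin (Euclidean_space n) W" "y \<in> W"
  obtains \<epsilon> where "\<epsilon> > 0" "coordinate_box n y \<epsilon> \<subseteq> W"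
  by (rule Euclidean_space_box_nhd[OF assms, folded coordinate_box_def]) (rule that)

lemma box_center: "y \<in> topspace (Euclidean_space n) \<Longrightarrow> r > 0 \<Longrightarrow> y \<in> coordinate_box n y r"
  by (simp add: coordinate_box_def)

lemma openin_box: "openin (Euclidean_space n) (coordinate_box n y r)"
proof -
  have c: "continuous_map (Euclidean_space n) euclideanreal (\<lambda>v. v i)" for i
    unfolding Euclidean_space_def
    using continuous_map_product_projection[of i UNIV "\<lambda>_. euclideanreal"] by (intro continuous_map_from_subtopology) simp
  have 1: "openin (Euclidean_space n) {v \<in> topspace (Euclidean_space n). v i \<in> {y i - r<..<y i + r}}" for i
    by (rule openin_continuous_map_preimage[OF c]) simp
  show ?thesis
  proof (cases "n = 0")
    case True
    then have "coordinate_box n y r = topspace (Euclidean_space n)" by (simp add: coordinate_box_def)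
    then show ?thesis by simp
  next
    case False
    then have "openin (Euclidean_space n) (\<Inter>i\<in>{..<n}. {v \<in> topspace (Euclidean_space n). v i \<in> {y i - r<..<y i + r}})"
      using 1 by (intro openin_INT2) (auto simp: lessThan_empty_iff)
    also have "(\<Inter>i\<in>{..<n}. {v \<in> topspace (Euclidean_space n). v i \<in> {y i - r<..<y i + r}}) = coordinate_box n y r"
    proof (rule Set.set_eqI)
      fix v
      have e: "v i \<in> {y i - r<..<y i + r} \<longleftrightarrow> \<bar>v i - y i\<bar> < r" for i by (auto simp: abs_less_iff)
      have "v \<in> (\<Inter>i\<in>{..<n}. {v \<in> topspace (Euclidean_space n). v i \<in> {y i - r<..<y i + r}})
        \<longleftrightarrow> (\<forall>i<n. v \<in> topspace (Euclidean_space n) \<and> \<bar>v i - y i\<bar> < r)"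
        unfolding INT_iff Ball_def lessThan_iff mem_Collect_eq e ..
      then show "v \<in> (\<Inter>i\<in>{..<n}. {v \<in> topspace (Euclidean_space n). v i \<in> {y i - r<..<y i + r}}) \<longleftrightarrow> v \<in> coordinate_box n y r"
        unfolding coordinate_box_def using False by blast
    qed
    finally show ?thesis .
  qed
qed

lemma manifold_locally_path_connected:
  assumes X: "manifold n X"
  shows "locally_path_connected_space X"
  unfolding locally_path_connected_space
proof (intro allI impI)
  fix W x assume W: "openin X W \<and> x \<in> W"
  then have "x \<in> topspace X" using openin_subset by blast
  then obtain U V where U: "openin X U" "x \<in> U" and V: "openin (Euclidean_space n) V"
    and UV: "subtopology X U homeomorphic_space subtopology (Euclidean_space n) V"
    using X unfolding manifold_def by blast
  have "locally_path_connected_space (subtopology X U)"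
    using homeomorphic_locally_path_connected_space[OF UV]
      locally_path_connected_space_open_subset[OF locally_path_connected_Euclidean_space V] by blast
  moreover have "openin (subtopology X U) (U \<inter> W)" using U W by (simp add: openin_open_subtopology openin_Int)
  moreover have "x \<in> U \<inter> W" using U W by simp
  ultimately obtain T where T: "openin (subtopology X U) T" "path_connectedin (subtopology X U) T" "x \<in> T" "T \<subseteq> U \<inter> W"
    unfolding locally_path_connected_space by meson
  have "openin X T" using openin_trans_full[OF T(1) U(1)] .
  moreover have "path_connectedin X T" using T(2) by (simp add: path_connectedin_subtopology)
  ultimately show "\<exists>V. openin X V \<and> path_connectedin X V \<and> x \<in> V \<and> V \<subseteq> W" using T(3,4) by blast
qed

text \<open>A chart carries a small coordinate box into \<open>W\<close>, and boxes are
  convex.\<close>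

lemma manifold_contractible_nhd:
  assumes X: "manifold n X" and W: "openin X W" "x \<in> W"
  obtains U where "openin X U" "x \<in> U" "U \<subseteq> W" "contractible_space (subtopology X U)"
proof -
  have "x \<in> topspace X" using W openin_subset by blast
  then obtain U V where U: "openin X U" "x \<in> U" and V: "openin (Euclidean_space n) V"
    and UV: "subtopology X U homeomorphic_space subtopology (Euclidean_space n) V"
    using X unfolding manifold_def by blast
  obtain h k where hk: "homeomorphic_maps (subtopology X U) (subtopology (Euclidean_space n) V) h k"
    using UV unfolding homeomorphic_space_def by blast
  have UX: "U \<subseteq> topspace X" and VE: "V \<subseteq> topspace (Euclidean_space n)" using U V openin_subset by auto
  have ck: "continuous_map (subtopology (Euclidean_space n) V) (subtopology X U) k"
    and kh: "\<And>z. z \<in> U \<Longrightarrow> k (h z) = z" and hkV: "\<And>v. v \<in> V \<Longrightarrow> h (k v) = v"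
    using hk UX VE unfolding homeomorphic_maps_def by auto
  have hm: "homeomorphic_map (subtopology (Euclidean_space n) V) (subtopology X U) k"
    using hk homeomorphic_maps_imp_map homeomorphic_maps_sym by metis
  have hV: "h z \<in> V" if "z \<in> U" for z
  proof -
    have "continuous_map (subtopology X U) (subtopology (Euclidean_space n) V) h"
      using hk unfolding homeomorphic_maps_def by (rule conjunct1)
    moreover have "z \<in> topspace (subtopology X U)" using that UX by auto
    ultimately have "h z \<in> topspace (subtopology (Euclidean_space n) V)"
      using continuous_map_image_subset_topspace by blast
    then show ?thesis by simp
  qed
  have kU: "k v \<in> U" if "v \<in> V" for v
    using continuous_map_image_subset_topspace[OF ck] that VE by auto
  have "openin (subtopology (Euclidean_space n) V) {v \<in> topspace (subtopology (Euclidean_space n) V). k v \<in> W}"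
    by (rule openin_continuous_map_preimage[OF continuous_map_into_fulltopology[OF ck] W(1)])
  then have o: "openin (Euclidean_space n) {v \<in> topspace (subtopology (Euclidean_space n) V). k v \<in> W}"
    using openin_trans_full V by blast
  have "h x \<in> {v \<in> topspace (subtopology (Euclidean_space n) V). k v \<in> W}"
    using hV[OF U(2)] kh[OF U(2)] W(2) VE by auto
  from box_nhd[OF o this] obtain \<epsilon> where e: "\<epsilon> > 0" "coordinate_box n (h x) \<epsilon> \<subseteq> {v \<in> topspace (subtopology (Euclidean_space n) V). k v \<in> W}" .
  let ?A = "coordinate_box n (h x) \<epsilon>"
  have AV: "?A \<subseteq> V" and AW: "k ` ?A \<subseteq> W" using e(2) by auto
  have hxA: "h x \<in> ?A" by (rule box_center) (use hV[OF U(2)] VE e(1) in auto)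
  have Asub: "subtopology (subtopology (Euclidean_space n) V) ?A = top_of_set ?A"
  proof -
    have "V \<inter> ?A = ?A" "topspace (Euclidean_space n) \<inter> ?A = ?A" using AV VE by auto
    then show ?thesis unfolding subtopology_subtopology
      by (metis Euclidean_space_eq_top_of_set subtopology_subtopology)
  qed
  have ksub: "subtopology (subtopology X U) (k ` ?A) = subtopology X (k ` ?A)"
  proof -
    have "U \<inter> k ` ?A = k ` ?A" using kU AV by blast
    then show ?thesis unfolding subtopology_subtopology by simp
  qed
  have "homeomorphic_map (subtopology (subtopology (Euclidean_space n) V) ?A) (subtopology (subtopology X U) (k ` ?A)) k"
    by (rule homeomorphic_map_subtopologies[OF hm]) (use AV VE kU UX in auto)
  then have "homeomorphic_map (top_of_set ?A) (subtopology X (k ` ?A)) k" unfolding Asub ksub .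
  then have hs: "top_of_set ?A homeomorphic_space subtopology X (k ` ?A)"
    by (rule homeomorphic_map_imp_homeomorphic_space)
  have "contractible ?A"
    by (rule starlike_imp_contractible_fun[OF hxA]) (rule box_convex[OF _ hxA])
  then have "contractible_space (subtopology X (k ` ?A))"
    using homeomorphic_space_contractibility[OF hs] by simp
  moreover have "openin X (k ` ?A)"
  proof -
    have "openin (subtopology (Euclidean_space n) V) ?A" using openin_box AV V by (simp add: openin_open_subtopology)
    then have "openin (subtopology X U) (k ` ?A)"
      using homeomorphic_imp_open_map[OF hm] by (simp add: open_map_def)
    then show ?thesis using openin_trans_full U(1) by blast
  qed
  moreover have "x \<in> k ` ?A" using hxA kh[OF U(2)] by (metis imageI)
  ultimately show thesis using that AW by blast
qed

text \<open>The image of \<open>x\<close> is moved vertically, up and down, by half the radius of a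
  box inside the neighbourhood.\<close>

lemma flat_chart_thin:
  assumes h: "flat_chart M S U h" and T: "openin M T" "x \<in> T" "x \<in> U" "x \<in> S"
  obtains y z where "y \<in> T \<inter> U" "h y 2 > 0" "z \<in> T \<inter> U" "h z 2 < 0"
proof -
  note f = flat_chart_inverse[OF h]
  let ?\<theta> = "inv_into U h"
  have "openin (top_of_set R3) {v \<in> topspace (top_of_set R3). ?\<theta> v \<in> T}"
    by (rule openin_continuous_map_preimage[OF f(3) T(1)])
  then have "openin (Euclidean_space 3) {v \<in> R3. ?\<theta> v \<in> T}" using Euclidean_space_eq_top_of_set[of 3] by simp
  moreover have hx: "h x \<in> {v \<in> R3. ?\<theta> v \<in> T}" using f(6,7)[OF T(3)] T(2) by simp
  ultimately obtain \<epsilon> where e: "\<epsilon> > 0" "coordinate_box 3 (h x) \<epsilon> \<subseteq> {v \<in> R3. ?\<theta> v \<in> T}" by (rule box_nhd)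
  have hx2: "h x 2 = 0" using f(11)[OF T(3)] T(4) by simp
  have v: "(h x)(2 := c) \<in> coordinate_box 3 (h x) \<epsilon>" if "\<bar>c\<bar> < \<epsilon>" for c
    using that hx hx2 e(1) by (auto simp: coordinate_box_def topspace_Euclidean_space)
  have w: "?\<theta> ((h x)(2 := c)) \<in> T \<inter> U \<and> h (?\<theta> ((h x)(2 := c))) 2 = c" if "\<bar>c\<bar> < \<epsilon>" for c
  proof -
    have "(h x)(2 := c) \<in> {v \<in> R3. ?\<theta> v \<in> T}" using v[OF that] e(2) by blast
    then show ?thesis using f(8,9)[of "(h x)(2 := c)"] by simp
  qed
  show thesis using that[of "?\<theta> ((h x)(2 := \<epsilon>/2))" "?\<theta> ((h x)(2 := - \<epsilon>/2))"] w[of "\<epsilon>/2"] w[of "-\<epsilon>/2"] e(1) by simp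
qed

text \<open>In a box of \<open>h\<close>-coordinates the \<open>k\<close>-height vanishes exactly on
  the plane, so it has constant sign on each open half box, which is convex and hence connected. The
  two signs are opposite because \<open>k\<close> takes both signs near \<open>x\<close>.\<close>

lemma flat_chart_transition_sign:
  assumes h: "flat_chart M S U h" and k: "flat_chart M S V k" and x: "x \<in> U" "x \<in> V" "x \<in> S"
  shows "\<exists>q T. (q = 1 \<or> q = -1) \<and> openin M T \<and> x \<in> T \<and> T \<subseteq> U \<inter> V \<and> (\<forall>y\<in>T. sgn (h y 2) = q * sgn (k y 2))"
proof -
  note f = flat_chart_inverse[OF h] and g = flat_chart_inverse[OF k]
  let ?\<theta> = "inv_into U h"
  have "openin (top_of_set R3) {v \<in> topspace (top_of_set R3). ?\<theta> v \<in> V}"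
    by (rule openin_continuous_map_preimage[OF f(3) flat_chart_open[OF k]])
  then have "openin (Euclidean_space 3) {v \<in> R3. ?\<theta> v \<in> V}" using Euclidean_space_eq_top_of_set[of 3] by simp
  moreover have hx: "h x \<in> {v \<in> R3. ?\<theta> v \<in> V}" using f(6,7)[OF x(1)] x(2) by simp
  ultimately obtain \<epsilon> where e: "\<epsilon> > 0" "coordinate_box 3 (h x) \<epsilon> \<subseteq> {v \<in> R3. ?\<theta> v \<in> V}" by (rule box_nhd)
  let ?A = "coordinate_box 3 (h x) \<epsilon>"
  have AR: "?A \<subseteq> R3" and A\<theta>: "\<And>v. v \<in> ?A \<Longrightarrow> ?\<theta> v \<in> V" using e(2) by auto
  have hxA: "h x \<in> ?A" by (rule box_center) (use hx e(1) in auto)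
  define T where "T = ?\<theta> ` ?A"
  have oT: "openin M T"
  proof -
    have "openin (top_of_set R3) ?A" using openin_box[of 3] Euclidean_space_eq_top_of_set[of 3] by simp
    then have "openin (subtopology M U) T"
      using homeomorphic_imp_open_map[OF f(2)] unfolding T_def by (simp add: open_map_def)
    then show ?thesis using openin_trans_full flat_chart_open[OF h] by blast
  qed
  have xT: "x \<in> T" unfolding T_def using hxA f(7)[OF x(1)] by (metis imageI)
  have TU: "T \<subseteq> U" unfolding T_def using f(8) AR by blast
  have TV: "T \<subseteq> V" unfolding T_def using A\<theta> by blast
  have hT: "h y \<in> ?A" "?\<theta> (h y) = y" if y: "y \<in> T" for y
  proof -
    obtain v where v: "v \<in> ?A" "y = ?\<theta> v" using y unfolding T_def by blast
    have "h y = v" using f(9)[of v] v AR by auto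
    then show "h y \<in> ?A" using v by simp
    show "?\<theta> (h y) = y" using f(7) y TU by blast
  qed
  define F where "F v = k (?\<theta> v) 2" for v
  have cF: "continuous_on ?A F"
  proof -
    have "continuous_map (subtopology (top_of_set R3) ?A) (subtopology M V) ?\<theta>"
      using continuous_map_from_subtopology[OF f(3)] A\<theta> by (auto simp: continuous_map_in_subtopology)
    from continuous_map_compose[OF this g(1)]
    have "continuous_map (top_of_set ?A) (top_of_set R3) (k \<circ> ?\<theta>)"
      using AR by (simp add: subtopology_subtopology inf.absorb2)
    then have "continuous_on ?A (k \<circ> ?\<theta>)" by (simp add: continuous_map_in_subtopology)
    from continuous_on_product_then_coordinatewise[OF this, of 2] show ?thesis by (simp add: F_def o_def)
  qed
  have F0: "F v = 0 \<longleftrightarrow> v 2 = 0" if v: "v \<in> ?A" for v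
  proof -
    have "?\<theta> v \<in> V" "v \<in> R3" using A\<theta>[OF v] AR v by auto
    then show ?thesis using f(10)[of v] g(11)[of "?\<theta> v"] by (simp add: F_def)
  qed
  \<comment> \<open>Used with \<open>p\<close> equal to 1 and -1, to select the upper and the lower
    half of the box.\<close>
  have const: "\<exists>q. (q = 1 \<or> q = (-1::real)) \<and> (\<forall>v\<in>?A. p * v 2 > 0 \<longrightarrow> sgn (F v) = q)" for p :: real
  proof -
    let ?B = "{v \<in> ?A. p * v 2 > 0}"
    have "connected ?B"
    proof (rule convex_fun_connected)
      fix u v t assume *: "u \<in> ?B" "v \<in> ?B" "0 \<le> t" "t \<le> (1::real)"
      have "(1 - t) * (p * u 2) + t * (p * v 2) > 0"
      proof (cases "t = 0")
        case False
        then have "t * (p * v 2) > 0" using * by simp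
        moreover have "(1 - t) * (p * u 2) \<ge> 0" by (rule mult_nonneg_nonneg) (use * in auto)
        ultimately show ?thesis by linarith
      qed (use * in simp)
      then have "p * ((1 - t) * u 2 + t * v 2) > 0" by (simp add: algebra_simps)
      then show "(\<lambda>i. (1 - t) * u i + t * v i) \<in> ?B" using box_convex[of u 3 "h x" \<epsilon> v t] * by simp
    qed
    moreover have "continuous_on ?B F" by (rule continuous_on_subset[OF cF]) auto
    ultimately have con: "connected (F ` ?B)" by (rule connected_continuous_image[rotated])
    have Fne: "F v \<noteq> 0" if v: "v \<in> ?B" for v
    proof
      assume "F v = 0"
      then have "v 2 = 0" using F0[of v] v by simp
      then show False using v by simp
    qed
    show ?thesis
    proof (cases "\<exists>v\<in>?B. F v > 0")
      case True
      then obtain u where u: "u \<in> ?B" "F u > 0" by (elim bexE)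
      have "F v > 0" if v: "v \<in> ?B" for v
      proof (rule ccontr)
        assume "\<not> F v > 0"
        then have "F v \<le> 0" "0 \<le> F u" using u(2) by simp_all
        from connectedD_interval[OF con imageI[OF v] imageI[OF u(1)] this]
        obtain w where "w \<in> ?B" "0 = F w" by (elim imageE)
        with Fne[of w] show False by simp
      qed
      then have "sgn (F v) = 1" if "v \<in> ?A" "p * v 2 > 0" for v using that by simp
      then show ?thesis by (intro exI[of _ 1] conjI disjI1 ballI impI refl)
    next
      case False
      have "F v < 0" if v: "v \<in> ?B" for v
      proof -
        have "\<not> F v > 0" using False v by blast
        with Fne[OF v] show ?thesis by linarith
      qed
      then have "sgn (F v) = -1" if "v \<in> ?A" "p * v 2 > 0" for v using that by simp
      then show ?thesis by (intro exI[of _ "-1"] conjI disjI2 ballI impI refl)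
    qed
  qed
  obtain q where q: "q = 1 \<or> q = -1" "\<forall>v\<in>?A. 1 * v 2 > 0 \<longrightarrow> sgn (F v) = q"
    using const[of 1] by (elim exE conjE)
  obtain q' where q': "q' = 1 \<or> q' = -1" "\<forall>v\<in>?A. -1 * v 2 > 0 \<longrightarrow> sgn (F v) = q'"
    using const[of "-1"] by (elim exE conjE)
  have sF: "sgn (k y 2) = (if h y 2 > 0 then q else if h y 2 < 0 then q' else 0)" if y: "y \<in> T" for y
  proof -
    have "k y 2 = F (h y)" using hT[OF y] by (simp add: F_def)
    then show ?thesis using bspec[OF q(2) hT(1)[OF y]] bspec[OF q'(2) hT(1)[OF y]] F0[OF hT(1)[OF y]] by auto
  qed
  have "q' = - q"
  proof (rule ccontr)
    assume "q' \<noteq> - q"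
    then have qq: "q' = q" using q(1) q'(1) by auto
    obtain y z where yz: "y \<in> T \<inter> V" "k y 2 > 0" "z \<in> T \<inter> V" "k z 2 < 0"
      by (rule flat_chart_thin[OF k oT xT x(2,3)])
    have "sgn (k y 2) = 1" "sgn (k z 2) = -1" using yz by auto
    then show False using sF[of y] sF[of z] yz(1,3) qq q(1) by (auto split: if_splits)
  qed
  have "sgn (h y 2) = q * sgn (k y 2)" if y: "y \<in> T" for y
    using sF[OF y] \<open>q' = - q\<close> q(1) by (auto simp: sgn_if split: if_splits)
  then show ?thesis using q(1) oT xT TU TV by (intro exI[of _ q] exI[of _ T]) auto
qed

text \<open>Exchanging the sides within a chart lets any choice of side be realized as the positive
  one.\<close>

lemma flat_chart_flip:
  assumes h: "flat_chart M S U h"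
  shows "flat_chart M S U (\<lambda>y. (h y)(2 := - h y 2))"
proof -
  let ?f = "\<lambda>v::nat \<Rightarrow> real. v(2 := - v 2)"
  have ff: "?f (?f v) = v" for v by (simp add: fun_upd_idem)
  have fR: "?f v \<in> R3 \<longleftrightarrow> v \<in> R3" for v by (auto simp: topspace_Euclidean_space)
  have c: "continuous_map (Euclidean_space 3) (Euclidean_space 3) ?f"
  proof -
    have "continuous_on UNIV ?f"
      by (rule continuous_on_fun_upd_coord) (auto intro!: continuous_intros continuous_on_coordinate)
    then have "continuous_on R3 ?f" by (rule continuous_on_subset) simp
    moreover have "?f \<in> R3 \<rightarrow> R3" using fR by blast
    ultimately have "continuous_map (top_of_set R3) (top_of_set R3) ?f" by simp
    then show ?thesis unfolding Euclidean_space_eq_top_of_set[symmetric] .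
  qed
  have "homeomorphic_maps (Euclidean_space 3) (Euclidean_space 3) ?f ?f"
    unfolding homeomorphic_maps_def using c ff by blast
  then have "homeomorphic_map (Euclidean_space 3) (Euclidean_space 3) ?f" by (rule homeomorphic_maps_imp_map)
  from homeomorphic_map_compose[OF flat_chart_homeo[OF h] this]
  have "homeomorphic_map (subtopology M U) (Euclidean_space 3) (\<lambda>y. (h y)(2 := - h y 2))" by (simp add: o_def)
  moreover have "(\<lambda>y. (h y)(2 := - h y 2)) ` (U \<inter> S) = {v \<in> R3. v 2 = 0}"
  proof -
    have "(\<lambda>y. (h y)(2 := - h y 2)) ` (U \<inter> S) = ?f ` (h ` (U \<inter> S))" by (simp add: image_image)
    also have "\<dots> = ?f ` {v \<in> R3. v 2 = 0}" unfolding flat_chart_image[OF h] ..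
    also have "\<dots> = id ` {v \<in> R3. v 2 = 0}" by (intro image_cong) (auto simp: fun_upd_idem)
    finally show ?thesis by simp
  qed
  ultimately show ?thesis using flat_chart_open[OF h] by (simp add: flat_chart_def)
qed

section \<open>Normalizing primitives along the surface\<close>

context sign_character begin

text \<open>A path inside the overlap has a single character, which either primitive computes from
  its endpoints.\<close>

lemma primitive_product_locally_constant:
  assumes lpc: "locally_path_connected_space M" and UV: "openin M U" "openin M V"
    and a: "primitive U a" and c: "primitive V c" and x: "x \<in> U" "x \<in> V"
  shows "\<exists>T. openin M T \<and> x \<in> T \<and> T \<subseteq> U \<inter> V \<and> (\<forall>y\<in>T. a y * c y = a x * c x)"
proof -
  have "openin M (U \<inter> V)" using UV by (rule openin_Int)
  then obtain T where T: "openin M T" "path_connectedin M T" "x \<in> T" "T \<subseteq> U \<inter> V"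
    using lpc x unfolding locally_path_connected_space by (meson IntI)
  have "a y * c y = a x * c x" if y: "y \<in> T" for y
  proof -
    have "topspace (subtopology M T) = T" using openin_subset[OF T(1)] by auto
    then obtain g where g: "pathin (subtopology M T) g" "g 0 = x" "g 1 = y"
      using T(2,3) y unfolding path_connectedin_def path_connected_space_def by metis
    have "pathin (subtopology M W) g" if "T \<subseteq> W" for W
      using g(1) that unfolding pathin_subtopology by auto
    then have "pathin (subtopology M U) g" "pathin (subtopology M V) g" using T(4) by auto
    from primitive_path[OF a this(1)] primitive_path[OF c this(2)]
    have "a x * a y = c x * c y" unfolding g(2,3) by simp
    moreover have "a x = 1 \<or> a x = -1" "a y = 1 \<or> a y = -1" "c x = 1 \<or> c x = -1" "c y = 1 \<or> c y = -1"
      using a c x y T(4) unfolding primitive_def by blast+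
    ultimately show ?thesis by auto
  qed
  then show ?thesis using T(1,3,4) by (intro exI[of _ T] conjI ballI)
qed

lemma primitive_scale: "primitive U a \<Longrightarrow> r = 1 \<or> r = -1 \<Longrightarrow> primitive U (\<lambda>y. r * a y)"
  unfolding primitive_def by auto

text \<open>On the path-connected set \<open>U \<inter> S\<close> the two primitives differ by one
  sign, which is absorbed into \<open>a\<close>.\<close>

lemma primitive_agree:
  assumes a: "primitive U a" and g: "primitive S g" and pc: "path_connectedin M (U \<inter> S)" and x0: "x0 \<in> U \<inter> S"
  obtains a' where "primitive U a'" "\<And>y. y \<in> U \<inter> S \<Longrightarrow> a' y = g y"
proof -
  define r where "r = a x0 * g x0"
  have v: "a y = 1 \<or> a y = -1" "g y = 1 \<or> g y = -1" if "y \<in> U \<inter> S" for y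
    using a g that unfolding primitive_def by blast+
  have r: "r = 1 \<or> r = -1" using v[OF x0] by (auto simp: r_def)
  have "r * a y = g y" if y: "y \<in> U \<inter> S" for y
  proof -
    have "topspace (subtopology M (U \<inter> S)) = U \<inter> S" using pc unfolding path_connectedin_def by auto
    then obtain p where p: "pathin (subtopology M (U \<inter> S)) p" "p 0 = x0" "p 1 = y"
      using pc x0 y unfolding path_connectedin_def path_connected_space_def by metis
    have "pathin (subtopology M W) p" if "U \<inter> S \<subseteq> W" for W
      using p(1) that unfolding pathin_subtopology by auto
    then have "pathin (subtopology M U) p" "pathin (subtopology M S) p" by auto
    from primitive_path[OF a this(1)] primitive_path[OF g this(2)]
    have "a x0 * a y = g x0 * g y" unfolding p(2,3) by simp
    then show ?thesis using v[OF x0] v[OF y] by (auto simp: r_def)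
  qed
  then show thesis using that[OF primitive_scale[OF a r]] by blast
qed

end

lemma flat_chart_contractible:
  assumes h: "flat_chart M S U h"
  shows "contractible_space (subtopology M U)" "path_connectedin M (U \<inter> S)" "U \<inter> S \<noteq> {}"
proof -
  note f = flat_chart_inverse[OF h]
  have "subtopology M U homeomorphic_space Euclidean_space 3"
    by (rule homeomorphic_map_imp_homeomorphic_space[OF flat_chart_homeo[OF h]])
  then show "contractible_space (subtopology M U)"
    using homeomorphic_space_contractibility contractible_Euclidean_space by blast
  have "contractible plane3"
  proof (rule starlike_imp_contractible_fun)
    show "(\<lambda>_. 0) \<in> plane3" by (simp add: topspace_Euclidean_space)
  qed (auto simp: topspace_Euclidean_space)
  then have "contractible_space (top_of_set plane3)" by simp
  then have "path_connected_space (top_of_set plane3)" by (rule contractible_imp_path_connected_space)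
  then have "path_connectedin (top_of_set plane3) plane3"
    using path_connectedin_topspace[of "top_of_set plane3"] unfolding topspace_euclidean_subtopology by (rule iffD2[rotated])
  from path_connectedin_continuous_map_image[OF f(5) this]
  have "path_connectedin M (inv_into U h ` plane3)" by (simp add: path_connectedin_subtopology)
  moreover have "inv_into U h ` plane3 = U \<inter> S"
  proof
    show "inv_into U h ` plane3 \<subseteq> U \<inter> S" using f(8,10) by auto
    show "U \<inter> S \<subseteq> inv_into U h ` plane3"
    proof
      fix x assume x: "x \<in> U \<inter> S"
      then have "h x \<in> plane3" using f(6)[of x] f(11)[of x] by simp
      moreover have "x = inv_into U h (h x)" using f(7)[of x] x by simp
      ultimately show "x \<in> inv_into U h ` plane3" by blast
    qed
  qed
  ultimately show "path_connectedin M (U \<inter> S)" by simp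
  show "U \<inter> S \<noteq> {}"
  proof -
    have "(\<lambda>_. 0) \<in> R3" by (simp add: topspace_Euclidean_space)
    then have "inv_into U h (\<lambda>_. 0) \<in> U \<inter> S" using f(8) f(10) by simp
    then show ?thesis by blast
  qed
qed

theorem theoremA4:
  fixes M :: "'a topology" and S :: "'a set"
  assumes "closed_manifold 3 M" and "orientable 3 M"
    and "locally_flat_surface M S"
    and "closed_manifold 2 (subtopology M S)" and "\<not> orientable 2 (subtopology M S)"
    and "\<not> H1_mod2_inclusion_surjective M S"
  shows "\<exists>(N :: ('a \<times> bool) topology) p. double_covering N p M \<and> connected_space N \<and> betti 1 N > 0"
proof -
  have mM: "manifold 3 M" and conM: "connected_space M" and HM: "Hausdorff_space M"
    using assms(1) by (simp_all add: closed_manifold_def manifold_def)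
  have SM: "S \<subseteq> topspace M" using assms(3) by (simp add: locally_flat_surface_def)
  have tS: "topspace (subtopology M S) = S" using SM by auto
  have mS: "manifold 2 (subtopology M S)" and cS: "compact_space (subtopology M S)"
    and conS: "connected_space (subtopology M S)" and Sne: "S \<noteq> {}"
    using assms(4) tS by (simp_all add: closed_manifold_def)
  have clS: "closedin M S"
    using compactin_imp_closedin[OF HM, of S] cS SM by (simp add: compactin_subspace)
  have connS: "connectedin M S" using conS SM by (simp add: connectedin_def)
  have lpc: "locally_path_connected_space M" by (rule manifold_locally_path_connected[OF mM])
  have "path_connected_space (subtopology M S)"
    using path_connected_eq_connected_space[OF manifold_locally_path_connected[OF mS]] conS by simp
  then have pcS: "path_connectedin M S" using SM by (simp add: path_connectedin_def)
  have flat: "\<exists>U h. flat_chart M S U h \<and> x \<in> U" if "x \<in> S" for x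
    using assms(3) that unfolding locally_flat_surface_def flat_chart_def by blast
  obtain \<omega> :: "'a chain \<Rightarrow> real" where \<omega>: "\<And>c d. \<omega> (c + d) = \<omega> c * \<omega> d" "\<And>c. \<omega> c = 1 \<or> \<omega> c = -1"
    "\<And>b. singular_chain 2 M b \<Longrightarrow> \<omega> (chain_boundary 2 b) = 1"
    "\<And>d. mod2_cycle1 (subtopology M S) d \<Longrightarrow> \<omega> d = 1"
    "\<exists>c. mod2_cycle1 M c \<and> \<omega> c = -1"
    by (rule sign_character_exists[OF assms(6)]) (rule that)
  interpret sign_character M \<omega> using \<omega>(1-3) by unfold_locales
  have "\<omega> z = 1" if "singular_relcycle 1 (subtopology M S) {} z" for z
  proof (rule \<omega>(4))
    show "mod2_cycle1 (subtopology M S) z"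
      using that unfolding mod2_cycle1_def singular_cycle by (intro conjI exI[of _ 0]) simp_all
  qed
  \<comment> \<open>One primitive on all of \<open>S\<close> is fixed here; normalizing every chart
    by it is what makes the trivializations agree along the surface.\<close>
  then obtain g where g: "primitive S g" using primitive_exists[OF SM pcS] by blast
  \<comment> \<open>Charts missing \<open>S\<close> have no side to record; the constant 1 merely
    meets the requirement of being a sign off \<open>S\<close>.\<close>
  define side where "side U s \<longleftrightarrow> (\<exists>h. flat_chart M S U h \<and> s = (\<lambda>y. sgn (h y 2))) \<or> (U \<inter> S = {} \<and> s = (\<lambda>_. 1))"
    for U and s :: "'a \<Rightarrow> real"
  define \<P> where "\<P> = {(U,s,a). openin M U \<and> contractible_space (subtopology M U) \<and> primitive U a \<and> (\<forall>y\<in>U \<inter> S. a y = g y) \<and> side U s}"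
  have PD: "openin M U" "contractible_space (subtopology M U)" "primitive U a" "\<forall>y\<in>U \<inter> S. a y = g y" "side U s"
    if "(U,s,a) \<in> \<P>" for U s a using that by (simp_all add: \<P>_def)
  have flatD: "\<exists>h. flat_chart M S U h \<and> s = (\<lambda>y. sgn (h y 2))" if "(U,s,a) \<in> \<P>" "x \<in> U" "x \<in> S" for U s a x
    using PD(5)[OF that(1)] that(2,3) unfolding side_def by blast
  interpret sided_atlas M S \<P>
  proof
    show "connected_space M" "S \<subseteq> topspace M" "connectedin M S" "S \<noteq> {}" by fact+
  next
    fix U s a assume p: "(U,s,a) \<in> \<P>"
    show oU: "openin M U" by (rule PD(1)[OF p])
    have "path_connectedin M U"
      using contractible_imp_path_connected_space[OF PD(2)[OF p]] openin_subset[OF oU] by (simp add: path_connectedin_def)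
    then show "connectedin M U" by (rule path_connectedin_imp_connectedin)
  next
    fix x assume x: "x \<in> topspace M"
    show "\<exists>U s a. (U,s,a) \<in> \<P> \<and> x \<in> U"
    proof (cases "x \<in> S")
      case True
      then obtain U h where h: "flat_chart M S U h" "x \<in> U" using flat by blast
      note c = flat_chart_contractible[OF h(1)]
      obtain a0 where "primitive U a0"
        using primitive_contractible[OF openin_subset[OF flat_chart_open[OF h(1)]] c(1)] by blast
      from primitive_agree[OF this g c(2), of x]
      obtain a where "primitive U a" "\<And>y. y \<in> U \<inter> S \<Longrightarrow> a y = g y" using True h(2) by blast
      then have "(U, (\<lambda>y. sgn (h y 2)), a) \<in> \<P>"
        using h(1) c(1) flat_chart_open[OF h(1)] unfolding \<P>_def side_def by auto
      then show ?thesis using h(2) by blast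
    next
      case False
      have "openin M (topspace M - S)" using clS by (simp add: closedin_def)
      moreover have "x \<in> topspace M - S" using x False by simp
      ultimately obtain U where U: "openin M U" "x \<in> U" "U \<subseteq> topspace M - S" "contractible_space (subtopology M U)"
        by (rule manifold_contractible_nhd[OF mM])
      obtain a where "primitive U a" using primitive_contractible[OF openin_subset[OF U(1)] U(4)] by blast
      moreover have "U \<inter> S = {}" using U(3) by blast
      ultimately have "(U, (\<lambda>_. 1), a) \<in> \<P>" using U(1,4) unfolding \<P>_def side_def by auto
      then show ?thesis using U(2) by blast
    qed
  next
    fix U s a x assume p: "(U,s,a) \<in> \<P>" and x: "x \<in> U"
    show "a x = 1 \<or> a x = -1" using PD(3)[OF p] x unfolding primitive_def by blast
    show "s x = 0" if "x \<in> S"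
    proof -
      obtain h where h: "flat_chart M S U h" "s = (\<lambda>y. sgn (h y 2))" using flatD[OF p x \<open>x \<in> S\<close>] by blast
      then show ?thesis using flat_chart_inverse(11)[OF h(1) x] \<open>x \<in> S\<close> by simp
    qed
    show "s x = 1 \<or> s x = -1" if xS: "x \<notin> S"
      using PD(5)[OF p] unfolding side_def
    proof
      assume "\<exists>h. flat_chart M S U h \<and> s = (\<lambda>y. sgn (h y 2))"
      then obtain h where h: "flat_chart M S U h" "s = (\<lambda>y. sgn (h y 2))" by blast
      then show ?thesis using flat_chart_inverse(11)[OF h(1) x] xS by (auto simp: sgn_if)
    qed simp
    show "\<exists>T. openin M T \<and> x \<in> T \<and> T \<subseteq> U \<and> (\<forall>y\<in>T. s y = s x)" if xS: "x \<notin> S"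
      using PD(5)[OF p] unfolding side_def
    proof
      assume "\<exists>h. flat_chart M S U h \<and> s = (\<lambda>y. sgn (h y 2))"
      then obtain h where h: "flat_chart M S U h" and s: "s = (\<lambda>y. sgn (h y 2))" by blast
      note f = flat_chart_inverse[OF h]
      have cc: "continuous_map (subtopology M U) euclideanreal (\<lambda>y. h y 2)"
      proof -
        have "continuous_map (top_of_set R3) euclideanreal (\<lambda>v. v 2)" by simp
        from continuous_map_compose[OF f(1) this] show ?thesis by (simp add: o_def)
      qed
      have h0: "h x 2 \<noteq> 0" using f(11)[OF x] xS by simp
      have tU: "topspace (subtopology M U) = U" using openin_subset[OF PD(1)[OF p]] by auto
      let ?T = "{y \<in> topspace (subtopology M U). h y 2 \<in> (if h x 2 > 0 then {0<..} else {..<0})}"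
      have "openin (subtopology M U) ?T" by (rule openin_continuous_map_preimage[OF cc]) simp
      then have "openin M ?T" using openin_trans_full PD(1)[OF p] by blast
      moreover have "x \<in> ?T" using x h0 unfolding tU by auto
      moreover have "s y = s x" if "y \<in> ?T" for y using that h0 unfolding s by (auto simp: sgn_if split: if_splits)
      moreover have "?T \<subseteq> U" unfolding tU by blast
      ultimately show ?thesis by (intro exI[of _ ?T] conjI ballI)
    next
      assume "U \<inter> S = {} \<and> s = (\<lambda>_. 1)"
      then show ?thesis using PD(1)[OF p] x by (intro exI[of _ U]) simp
    qed
  next
    fix U s a V t c x assume p: "(U,s,a) \<in> \<P>" "(V,t,c) \<in> \<P>" and x: "x \<in> U" "x \<in> V"
    show "\<exists>T. openin M T \<and> x \<in> T \<and> T \<subseteq> U \<inter> V \<and> (\<forall>y\<in>T. a y * c y = a x * c x)"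
      by (rule primitive_product_locally_constant[OF lpc PD(1)[OF p(1)] PD(1)[OF p(2)] PD(3)[OF p(1)] PD(3)[OF p(2)] x])
    show "a x = c x" if "x \<in> S" using PD(4)[OF p(1)] PD(4)[OF p(2)] x that by simp
    show "\<exists>q T. (q = 1 \<or> q = -1) \<and> openin M T \<and> x \<in> T \<and> T \<subseteq> U \<inter> V \<and> (\<forall>y\<in>T. s y = q * t y)" if xS: "x \<in> S"
    proof -
      obtain h k where "flat_chart M S U h" "s = (\<lambda>y. sgn (h y 2))" "flat_chart M S V k" "t = (\<lambda>y. sgn (k y 2))"
        using flatD[OF p(1) x(1) xS] flatD[OF p(2) x(2) xS] by blast
      then show ?thesis using flat_chart_transition_sign[of M S U h V k x] x xS by simp
    qed
  next
    fix T x assume T: "openin M T" "x \<in> T" "x \<in> S"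
    then obtain U h where h: "flat_chart M S U h" "x \<in> U" using flat by blast
    obtain y z where "y \<in> T \<inter> U" "h y 2 > 0" "z \<in> T \<inter> U" "h z 2 < 0"
      by (rule flat_chart_thin[OF h(1) T(1,2) h(2) T(3)])
    then show "\<exists>y\<in>T. y \<notin> S" using flat_chart_inverse(11)[OF h(1), of y] by auto
  qed
  show ?thesis
  proof (rule double_cover_with_positive_betti[OF lpc]; rule notI; elim conjE)
    \<comment> \<open>A trivialization of the character would give it the value 1 on all mod-2
      cycles, although it is -1 on one of them.\<close>
    fix \<rho> assume \<rho>: "\<forall>x\<in>topspace M. \<rho> x = 1 \<or> \<rho> x = (-1::real)"
      and loc: "\<forall>U s a x. (U,s,a) \<in> \<P> \<longrightarrow> x \<in> U \<longrightarrow>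
        (\<exists>T. openin M T \<and> x \<in> T \<and> T \<subseteq> U \<and> (\<forall>y\<in>T. \<rho> y * a y = \<rho> x * a x))"
    have "\<exists>U a T. primitive U a \<and> openin M T \<and> x \<in> T \<and> T \<subseteq> U \<and> (\<forall>y\<in>T. \<rho> y * a y = \<rho> x * a x)" if x: "x \<in> topspace M" for x
    proof -
      obtain U s a where p: "(U,s,a) \<in> \<P>" "x \<in> U" using cov[OF x] by blast
      from loc[rule_format, OF p] PD(3)[OF p(1)] show ?thesis by blast
    qed
    then have "\<omega> c = 1" if "mod2_cycle1 M c" for c
      using global_primitive[of \<rho> c] \<rho> that by blast
    then show False using \<omega>(5) by force
  next
    fix \<tau> assume \<tau>: "\<forall>p\<in>\<P>. \<tau> p = 1 \<or> \<tau> p = (-1::real)"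
      and loc: "\<forall>U s a V t c x. (U,s,a) \<in> \<P> \<longrightarrow> (V,t,c) \<in> \<P> \<longrightarrow> x \<in> U \<longrightarrow> x \<in> V \<longrightarrow> x \<in> S \<longrightarrow>
      (\<exists>T. openin M T \<and> x \<in> T \<and> T \<subseteq> U \<inter> V \<and> (\<forall>y\<in>T. \<tau> (U,s,a) * s y = \<tau> (V,t,c) * t y))"
    \<comment> \<open>For each chart meeting \<open>S\<close> the sign \<open>\<tau>\<close> selects
      either \<open>h\<close> or its reflection, namely the one whose positive side is the chosen
      side. The selected charts therefore have matching sides, which would orient the
      surface.\<close>
    define \<C> where "\<C> = {(U,h). flat_chart M S U h \<and> (\<exists>s a. (U,s,a) \<in> \<P> \<and> (\<forall>y. sgn (h y 2) = \<tau> (U,s,a) * s y))}"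
    have CD: "\<exists>s a. (U,s,a) \<in> \<P> \<and> (\<forall>y. sgn (h y 2) = \<tau> (U,s,a) * s y)" if "(U,h) \<in> \<C>" for U h
      using that unfolding \<C>_def mem_Collect_eq prod.case by (rule conjunct2)
    have "orientable 2 (subtopology M S)"
    proof (rule two_sided_imp_orientable[OF HM assms(2) SM])
      show "flat_chart M S U h" if "(U,h) \<in> \<C>" for U h using that by (simp add: \<C>_def)
      show "\<exists>U h. (U,h) \<in> \<C> \<and> x \<in> U" if x: "x \<in> S" for x
      proof -
        obtain U s a where p: "(U,s,a) \<in> \<P>" "x \<in> U" using cov x SM by blast
        obtain h where h: "flat_chart M S U h" "s = (\<lambda>y. sgn (h y 2))" using flatD[OF p x] by blast
        have sy: "s y = sgn (h y 2)" for y using h(2) by simp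
        from \<tau> p(1) consider "\<tau> (U,s,a) = 1" | "\<tau> (U,s,a) = -1" by blast
        then show ?thesis
        proof cases
          case 1
          then have "\<forall>y. sgn (h y 2) = \<tau> (U,s,a) * s y" by (simp add: sy)
          then have "(U,h) \<in> \<C>"
            unfolding \<C>_def mem_Collect_eq prod.case using h(1) p(1) by (intro conjI exI)
          then show ?thesis using p(2) by blast
        next
          case 2
          then have "\<forall>y. sgn (((h y)(2 := - h y 2)) 2) = \<tau> (U,s,a) * s y" by (simp add: sy sgn_minus)
          then have "(U, \<lambda>y. (h y)(2 := - h y 2)) \<in> \<C>"
            unfolding \<C>_def mem_Collect_eq prod.case using flat_chart_flip[OF h(1)] p(1) by (intro conjI exI)
          then show ?thesis using p(2) by blast
        qed
      qed
      show "\<exists>T. openin M T \<and> x \<in> T \<and> T \<subseteq> U \<inter> V \<and> (\<forall>y\<in>T. sgn (h y 2) = sgn (k y 2))"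
        if UV: "(U,h) \<in> \<C>" "(V,k) \<in> \<C>" "x \<in> U \<inter> V \<inter> S" for U h V k x
      proof -
        obtain s a where s: "(U,s,a) \<in> \<P>" "\<forall>y. sgn (h y 2) = \<tau> (U,s,a) * s y" using CD[OF UV(1)] by (elim exE conjE)
        obtain t c where t: "(V,t,c) \<in> \<P>" "\<forall>y. sgn (k y 2) = \<tau> (V,t,c) * t y" using CD[OF UV(2)] by (elim exE conjE)
        have "x \<in> U" "x \<in> V" "x \<in> S" using UV(3) by auto
        from loc[rule_format, OF s(1) t(1) this] show ?thesis using s(2) t(2) by simp
      qed
    qed
    with assms(5) show False ..
  qed
qed

end
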